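(* Let $s\in\left(\frac14,1\right]$ be fixed. Let $\varphi\in H^s_{per,odd}$ be a real-valued periodic minimizer of $\inf_{u\in\mathcal Y_\tau}\mathcal E(u)$ (for a given $\tau>0$), with associated $\omega>0$ such that $(-\Delta)^s\varphi-\omega\varphi+\varphi^3=0$. If $\omega\in(0,1]$, then $\varphi$ is the zero solution of the equation $(-\Delta)^s\varphi-\omega\varphi+\varphi^3=0$. If $\omega>1$, then $\varphi$ is the odd periodic two-lobe solution of this equation.
   Context: All functions are $2\pi$-periodic, on $\mathbb T=[-\pi,\pi]$. The fractional Laplacian is $\widehat{(-\Delta)^s V}(\xi)=|\xi|^{2s}\widehat V(\xi)$, $\xi\in\mathbb Z$. $H^s_{per}$ is the periodic Sobolev space of real-valued functions with norm $\|f\|_{H^s_{per}}^2=2\pi\sum_{k\in\mathbb Z}(1+k^2)^s|\hat f(k)|^2$, $L^2_{per}=H^0_{per}$, and $H^s_{per,odd}$ is its subspace of odd functions. Set $$\mathcal Y_\tau=\{u\in H^s_{per,odd}:\ \|u\|_{L^2_{per}}^2=\tau\},\qquad \mathcal E(u)=\frac12\int_{-\pi}^{\pi}\big((-\Delta)^{s/2}u\big)^2+\frac12u^4\,dx.$$ A solution has a two-lobe profile if it has only one maximum and only one minimum on $[-\pi,\pi]$, where, without loss of generality, the maximum point is $x=\frac{\pi}{2}$ and the minimum point is $x=-\frac{\pi}{2}$. *)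

theory Defs
  imports "HOL-Analysis.Analysis"
begin

text \<open>
  Elements of Lebesgue and Sobolev spaces are given by representatives
  \<open>real \<Rightarrow> real\<close> that are Borel measurable and \<open>2\<pi>\<close>-periodic everywhere; every almost-everywhere
  class of periodic measurable functions contains such a representative. All other identities
  between such functions hold almost everywhere.
\<close>

definition periodic :: "(real \<Rightarrow> real) \<Rightarrow> bool" where
  "periodic f \<longleftrightarrow> (\<forall>x. f (x + 2 * pi) = f x)"

definition L1_per :: "(real \<Rightarrow> real) set" where
  "L1_per = {f \<in> borel_measurable borel. periodic f \<and> set_integrable lborel {-pi..pi} f}"

definition L2_per :: "(real \<Rightarrow> real) set" where
  "L2_per = {f \<in> borel_measurable borel. periodic f \<and>
     set_integrable lborel {-pi..pi} (\<lambda>x. (f x)\<^sup>2)}"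

text \<open>The factor \<open>1 / (2\<pi>)\<close> is the normalization for which the \<open>H\<^sup>0\<close> norm below is the usual
  \<open>L\<^sup>2\<close> norm on \<open>[-\<pi>, \<pi>]\<close>.\<close>

definition fourier_coeff :: "(real \<Rightarrow> real) \<Rightarrow> int \<Rightarrow> complex" where
  "fourier_coeff f k =
     (LINT x:{-pi..pi}|lborel. complex_of_real (f x) * exp (- \<i> * of_int k * complex_of_real x)) / (2 * pi)"

definition Hs_per :: "real \<Rightarrow> (real \<Rightarrow> real) set" where
  "Hs_per s = {f \<in> L2_per.
     (\<lambda>k::int. (1 + (real_of_int k)\<^sup>2) powr s * (cmod (fourier_coeff f k))\<^sup>2) summable_on UNIV}"

definition Hs_norm :: "real \<Rightarrow> (real \<Rightarrow> real) \<Rightarrow> real" where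
  "Hs_norm s f = sqrt (2 * pi *
     (\<Sum>\<^sub>\<infinity>k::int. (1 + (real_of_int k)\<^sup>2) powr s * (cmod (fourier_coeff f k))\<^sup>2))"

definition Hs_per_odd :: "real \<Rightarrow> (real \<Rightarrow> real) set" where
  "Hs_per_odd s = {f \<in> Hs_per s. AE x in lborel. f (- x) = - f x}"

text \<open>\<open>is_frac_laplacian s V W\<close>: the integrable function \<open>W\<close> is \<open>(-\<Delta>)\<^sup>s V\<close>. Integrable functions
  are determined almost everywhere by their Fourier coefficients, so \<open>W\<close> is unique up to null sets.
  Meant for \<open>s > 0\<close>: since \<open>0 powr 0 = 0\<close>, the symbol at frequency 0 vanishes even for \<open>s = 0\<close>.\<close>

definition is_frac_laplacian :: "real \<Rightarrow> (real \<Rightarrow> real) \<Rightarrow> (real \<Rightarrow> real) \<Rightarrow> bool" where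
  "is_frac_laplacian s V W \<longleftrightarrow> V \<in> L1_per \<and> W \<in> L1_per \<and>
     (\<forall>\<xi>. fourier_coeff W \<xi> =
        complex_of_real (\<bar>real_of_int \<xi>\<bar> powr (2 * s)) * fourier_coeff V \<xi>)"

definition frac_laplacian :: "real \<Rightarrow> (real \<Rightarrow> real) \<Rightarrow> real \<Rightarrow> real" where
  "frac_laplacian s V = (SOME W. is_frac_laplacian s V W)"

definition constraint_set :: "real \<Rightarrow> real \<Rightarrow> (real \<Rightarrow> real) set" where
  "constraint_set s \<tau> = {u \<in> Hs_per_odd s. (Hs_norm 0 u)\<^sup>2 = \<tau>}"

definition energy :: "real \<Rightarrow> (real \<Rightarrow> real) \<Rightarrow> real" where
  "energy s u = 1/2 * (LINT x:{-pi..pi}|lborel. (frac_laplacian (s / 2) u x)\<^sup>2 + 1/2 * (u x) ^ 4)"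

text \<open>For \<open>\<phi>\<close> in \<open>H\<^sup>s\<close> with \<open>s \<ge> 1/4\<close> the cube of \<open>\<phi>\<close> is integrable, so an \<open>H\<^sup>s\<close> solution in the
  sense of periodic distributions automatically has an integrable \<open>(-\<Delta>)\<^sup>s \<phi>\<close>; no regularity beyond
  \<open>H\<^sup>s\<close> is imposed here.\<close>

definition solves :: "real \<Rightarrow> real \<Rightarrow> (real \<Rightarrow> real) \<Rightarrow> bool" where
  "solves s \<omega> \<phi> \<longleftrightarrow>
     (\<exists>W. is_frac_laplacian s \<phi> W \<and> (AE x in lborel. W x - \<omega> * \<phi> x + (\<phi> x) ^ 3 = 0))"

text \<open>Maxima and minima are local ones, on the circle: neighbourhoods are taken in \<open>\<real>\<close>, so the
  endpoints \<open>\<plusminus>\<pi>\<close> get no one-sided treatment. For continuous periodic \<open>f\<close> the two points are then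
  also the unique global maximum and minimum points on \<open>[-\<pi>, \<pi>]\<close>.\<close>

definition two_lobe_profile :: "(real \<Rightarrow> real) \<Rightarrow> bool" where
  "two_lobe_profile f \<longleftrightarrow>
     {x \<in> {-pi..pi}. \<forall>\<^sub>F y in nhds x. f y \<le> f x} = {pi / 2} \<and>
     {x \<in> {-pi..pi}. \<forall>\<^sub>F y in nhds x. f x \<le> f y} = {- pi / 2}"

end

theory Submission
  imports Defs
begin

text \<open>
  Odd periodic functions are treated as sine series on \<open>[0, \<pi>]\<close>. By the binomial series for
  \<open>(1 - x)\<^sup>s\<close> the maximum principle for \<open>-d\<^sup>2/dx\<^sup>2\<close> on sine polynomials passes to
  \<open>(-\<Delta>)\<^sup>s\<close> with \<open>0 < s \<le> 1\<close>, so the resolvents \<open>T\<^sub>M = ((-\<Delta>)\<^sup>s + M)\<^sup>-\<^sup>1\<close> preserve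
  nonnegativity on \<open>(0, \<pi>)\<close>. Testing the equation with \<open>sgn \<phi>\<close> on \<open>{\<bar>\<phi>\<bar> > \<surd>\<omega>}\<close> gives
  \<open>\<bar>\<phi>\<bar> \<le> \<surd>\<omega>\<close>. For \<open>\<omega> \<le> 1\<close> pairing the equation with \<open>\<phi>\<close> yields \<open>\<phi> = 0\<close>, since the
  spectrum on odd functions starts at \<open>1\<close>.

  Rewriting the equation as \<open>u = T\<^sub>M f(u)\<close> with \<open>M = 2\<omega>\<close> and \<open>f(u) = 3\<omega>u - u\<^sup>3\<close> increasing, the
  iteration started at the square wave of height \<open>\<surd>\<omega>\<close> decreases to a solution \<open>U \<ge> \<bar>\<phi>\<bar>\<close>. The
  functions \<open>x \<mapsto> u(c + x) - u(c - x)\<close> are again odd, so positivity of \<open>T\<^sub>M\<close> propagates the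
  two-lobe shape along the iteration, and strict positivity makes it strict in the limit. Finally
  \<open>u\<^sup>2 \<mapsto> \<langle>(-\<Delta>)\<^sup>s u, u\<rangle>\<close> is convex, and comparing \<open>\<phi>\<close> with competitors
  \<open>\<surd>((1 - t \<kappa>) \<phi>\<^sup>2 + t U\<^sup>2)\<close> of equal mass shows \<open>\<bar>\<phi>\<bar> = U\<close>; by continuity \<open>\<phi> = \<plusminus>U\<close>.
\<close>

section \<open>Maximum principle for sine polynomials\<close>

text \<open>\<open>\<phi>\<close> comes without a sign and, for small \<open>s\<close>, without
  continuity or even boundedness, so its shape is not accessible directly. The shape is therefore
  proved for the maximal solution \<open>U\<close>, where every iterate has it, and is transferred
  at the end: along the competitors the energy has derivative
  \<open>\<integral> U^2 (\<phi>^2 - U^2)\<close> at \<open>t = 0\<close>, which minimality makes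
  nonnegative and \<open>\<bar>\<phi>\<bar> \<le> U\<close> makes nonpositive. Minimality of
  \<open>\<phi>\<close> enters in this comparison only. Every inequality rests on positivity of
  \<open>T\<^sub>M\<close>, proved at the level of Fourier multipliers on sine polynomials without a
  formula for the kernel. The condition \<open>1/4 < s\<close> is the convergence of
  \<open>\<Sum> (m^(2s) + M)^(-2)\<close>: it makes \<open>T\<^sub>M\<close> map \<open>L^2\<close>
  into continuous functions, so a solution known only as an \<open>L^2\<close> class acquires a
  continuous representative.\<close>

lemma local_min_second_deriv:
  fixes f :: "real \<Rightarrow> real"
  assumes f': "\<And>x. (f has_real_derivative f' x) (at x)"
    and d: "(f' has_real_derivative d) (at x)"
    and x: "a < x" "x < b"
    and le: "\<And>y. y \<in> {a..b} \<Longrightarrow> f x \<le> f y"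
  shows "d \<ge> 0"
proof (rule ccontr)
  assume "\<not> d \<ge> 0"
  have "f' x = 0"
    using DERIV_local_min[OF f', of "min (x - a) (b - x)" x] x le by (auto simp: abs_less_iff)
  with \<open>\<not> d \<ge> 0\<close> DERIV_neg_dec_right[OF d] obtain \<delta> where
    \<delta>: "\<delta> > 0" "\<And>h. 0 < h \<Longrightarrow> h < \<delta> \<Longrightarrow> f' (x + h) < 0" by auto
  define y where "y = x + min (\<delta> / 2) (b - x)"
  have y: "x < y" "y \<le> b" "y < x + \<delta>" using \<delta> x by (auto simp: y_def)
  have "f y < f x"
  proof (rule DERIV_neg_imp_decreasing_open[OF y(1)])
    fix z assume "x < z" "z < y"
    then show "\<exists>D. (f has_real_derivative D) (at z) \<and> D < 0"
      using f'[of z] \<delta>(2)[of "z - x"] y by auto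
  next
    show "continuous_on {x..y} f"
      using f' by (meson DERIV_continuous_on DERIV_subset has_field_derivative_at_within)
  qed
  with le[of y] x y show False by auto
qed

text \<open>\<open>t / (m^2 + t)\<close> is the multiplier that solves \<open>v - v''/t = g\<close>
  with zero boundary values. At an interior minimum \<open>v'' \<ge> 0\<close>, hence
  \<open>v \<ge> g \<ge> - \<kappa>\<close>; at \<open>0\<close> and \<open>pi\<close> sine
  polynomials vanish, and there \<open>\<kappa> \<ge> 0\<close> decides.\<close>

lemma elliptic_min_principle:
  fixes b :: "nat \<Rightarrow> real"
  assumes t: "t > 0" and \<kappa>: "\<kappa> \<ge> 0"
    and g: "\<And>x. x \<in> {0..pi} \<Longrightarrow> - \<kappa> \<le> (\<Sum>m<N. b m * sin (real m * x))"
    and x: "x \<in> {0..pi}"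
  shows "- \<kappa> \<le> (\<Sum>m<N. (t / ((real m)^2 + t)) * b m * sin (real m * x))"
proof -
  define c where "c m = (t / ((real m)^2 + t)) * b m" for m
  define v where "v x = (\<Sum>m<N. c m * sin (real m * x))" for x
  define v1 where "v1 x = (\<Sum>m<N. c m * (real m * cos (real m * x)))" for x
  define v2 where "v2 x = (\<Sum>m<N. - (c m * ((real m)^2 * sin (real m * x))))" for x
  have d1: "(v has_real_derivative v1 x) (at x)" for x
    unfolding v_def v1_def by (auto intro!: derivative_eq_intros sum.cong)
  have d2: "(v1 has_real_derivative v2 x) (at x)" for x
    unfolding v1_def v2_def by (auto intro!: derivative_eq_intros sum.cong simp: power2_eq_square)
  have geq: "v x - v2 x / t = (\<Sum>m<N. b m * sin (real m * x))" for x
  proof -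
    have pos: "(real m)^2 + t \<noteq> 0" for m using t by (smt (verit) zero_le_power2)
    have "c m * sin (real m * x) + c m * ((real m)^2 * sin (real m * x)) / t = b m * sin (real m * x)" for m
      unfolding c_def using t pos[of m] by (simp add: divide_simps) (simp add: algebra_simps)
    then show ?thesis
      unfolding v_def v2_def sum_divide_distrib sum_subtractf[symmetric] by (intro sum.cong) auto
  qed
  have "continuous_on {0..pi} v" unfolding v_def by (intro continuous_intros)
  then obtain z where z: "z \<in> {0..pi}" "\<And>y. y \<in> {0..pi} \<Longrightarrow> v z \<le> v y"
    using continuous_attains_inf[of "{0..pi}" v] by auto
  have "- \<kappa> \<le> v z"
  proof (cases "z = 0 \<or> z = pi")
    case True
    then have "v z = 0" unfolding v_def by auto
    then show ?thesis using \<kappa> by simp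
  next
    case False
    then have "v2 z \<ge> 0"
      using local_min_second_deriv[OF d1 d2, of 0 z pi] z by auto
    then show ?thesis using geq[of z] g[OF z(1)] t
      by (smt (verit) divide_nonneg_nonneg)
  qed
  then show ?thesis using z(2)[OF x] unfolding v_def c_def by auto
qed

lemma elliptic_power_min_principle:
  fixes b :: "nat \<Rightarrow> real"
  assumes t: "t > 0" and \<kappa>: "\<kappa> \<ge> 0"
    and g: "\<And>x. x \<in> {0..pi} \<Longrightarrow> - \<kappa> \<le> (\<Sum>m<N. b m * sin (real m * x))"
    and x: "x \<in> {0..pi}"
  shows "- \<kappa> \<le> (\<Sum>m<N. (t / ((real m)^2 + t)) ^ n * b m * sin (real m * x))"
  using x
proof (induction n arbitrary: x)
  case (Suc n)
  show ?case
    using elliptic_min_principle[OF t \<kappa>, where N = N and x = x and b = "\<lambda>m. (t / ((real m)^2 + t)) ^ n * b m"] Suc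
    by (simp add: mult.assoc)
qed (use g in simp)

text \<open>With \<open>\<rho> = t / (m^2 + t)\<close>, the operator \<open>(1 - \<rho>)^s\<close>
  is \<open>1\<close> minus nonnegative multiples of powers of a positivity-preserving operator, so
  it is nonpositive at a negative minimum of \<open>v\<close>. Multiplied by \<open>t^s\<close> and
  with \<open>t\<close> going to infinity it becomes \<open>(-\<Delta>)\<^sup>s\<close>, so
  \<open>M v\<close> alone must dominate \<open>- \<kappa>\<close> there.\<close>

lemma fractional_min_principle:
  fixes b :: "nat \<Rightarrow> real"
  assumes s: "0 < s" "s \<le> 1" and M: "M > 0" and \<kappa>: "\<kappa> \<ge> 0"
    and g: "\<And>x. x \<in> {0..pi} \<Longrightarrow> - \<kappa> \<le> (\<Sum>m<N. (real m powr (2 * s) + M) * b m * sin (real m * x))"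
    and x: "x \<in> {0..pi}"
  shows "- (\<kappa> / M) \<le> (\<Sum>m<N. b m * sin (real m * x))"
proof -
  define v where "v x = (\<Sum>m<N. b m * sin (real m * x))" for x
  have "continuous_on {0..pi} v" unfolding v_def by (intro continuous_intros)
  then obtain z where z: "z \<in> {0..pi}" "\<And>y. y \<in> {0..pi} \<Longrightarrow> v z \<le> v y"
    using continuous_attains_inf[of "{0..pi}" v] by auto
  have "- (\<kappa> / M) \<le> v z"
  proof (rule ccontr)
    assume neg: "\<not> - (\<kappa> / M) \<le> v z"
    define \<mu> where "\<mu> = - v z"
    have \<mu>: "\<mu> > \<kappa> / M" "\<mu> \<ge> 0" using neg \<kappa> M unfolding \<mu>_def
      by (auto, smt (verit) divide_nonneg_pos)
    \<comment> \<open>Taylor coefficients of \<open>(1 - x)^s\<close>: \<open>a 0 = 1\<close>, and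
      the others are nonpositive because \<open>0 < s \<le> 1\<close>.\<close>
    define a where "a n = (-1) ^ n * (s gchoose n)" for n
    have a_neg: "a n \<le> 0" if n: "n \<noteq> 0" for n
    proof -
      obtain k where k: "n = Suc k" using n not0_implies_Suc by auto
      have "a n = pochhammer (- s) n / fact n"
        unfolding a_def gbinomial_pochhammer by (simp add: power_mult_distrib[symmetric])
      also have "\<dots> = - s * pochhammer (1 - s) k / fact n"
        unfolding k pochhammer_rec by simp
      also have "\<dots> \<le> 0"
        using s unfolding pochhammer_prod
        by (intro divide_nonpos_pos mult_nonpos_nonneg prod_nonneg) auto
      finally show ?thesis .
    qed
    \<comment> \<open>Partial sums are the Taylor coefficients of
      \<open>(1 - x)^s / (1 - x)\<close>, nonnegative because \<open>s \<le> 1\<close>.\<close>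
    have a_sum: "(\<Sum>k\<le>n. a k) \<ge> 0" for n
    proof -
      have "(\<Sum>k\<le>n. a k) = (- 1) ^ n * (s - 1 gchoose n)"
        using gbinomial_sum_lower_neg[of s n] unfolding a_def by (simp add: mult.commute)
      also have "\<dots> = pochhammer (1 - s) n / fact n"
        unfolding gbinomial_pochhammer by (simp add: power_mult_distrib[symmetric])
      also have "\<dots> \<ge> 0"
        using s unfolding pochhammer_prod by (intro divide_nonneg_pos prod_nonneg) auto
      finally show ?thesis .
    qed
    have frac_le: "(\<Sum>m<N. (1 - t / ((real m)^2 + t)) powr s * (b m * sin (real m * z))) \<le> 0"
      if t: "t > 0" for t
    proof -
      define \<rho> where "\<rho> m = t / ((real m)^2 + t)" for m
      have "(\<lambda>n. a n * \<rho> m ^ n * (b m * sin (real m * z))) sums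
              ((1 - \<rho> m) powr s * (b m * sin (real m * z)))" for m
      \<comment> \<open>Mode \<open>0\<close> has \<open>\<rho> 0 = 1\<close>, on the boundary of
        the disc of convergence; its sine vanishes.\<close>
      proof (cases "m = 0")
        case False
        then have "\<bar>- \<rho> m\<bar> < 1" using t unfolding \<rho>_def
            by (auto simp: divide_simps) (smt (verit) zero_le_power2)
        from sums_mult2[OF gen_binomial_real[OF this, of s], of "b m * sin (real m * z)"]
        show ?thesis unfolding a_def by (simp add: power_minus[of "\<rho> m"] mult_ac)
      qed simp
      then have "(\<lambda>n. \<Sum>m<N. a n * \<rho> m ^ n * (b m * sin (real m * z))) sums
              (\<Sum>m<N. (1 - \<rho> m) powr s * (b m * sin (real m * z)))"
        by (intro sums_sum) auto
      then have lim: "(\<lambda>n. \<Sum>k\<le>n. \<Sum>m<N. a k * \<rho> m ^ k * (b m * sin (real m * z))) \<longlonglongrightarrow>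
              (\<Sum>m<N. (1 - \<rho> m) powr s * (b m * sin (real m * z)))"
        by (simp add: sums_def_le)
      \<comment> \<open>For \<open>k = 0\<close> this is an equality, as \<open>a 0 = 1\<close> and
        \<open>v z = - \<mu>\<close>; for \<open>k > 0\<close> the powers of the elliptic resolvent
        stay above \<open>- \<mu>\<close> and \<open>a k \<le> 0\<close> reverses the
        inequality.\<close>
      have term_le: "(\<Sum>m<N. a k * \<rho> m ^ k * (b m * sin (real m * z))) \<le> - \<mu> * a k" for k
      proof (cases "k = 0")
        case True
        then show ?thesis by (simp add: a_def \<mu>_def v_def)
      next
        case False
        have "- \<mu> \<le> (\<Sum>m<N. \<rho> m ^ k * b m * sin (real m * z))"
          unfolding \<rho>_def
          by (rule elliptic_power_min_principle[OF t \<mu>(2) _ z(1)])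
            (use z(2) in \<open>auto simp: \<mu>_def v_def\<close>)
        from mult_left_mono_neg[OF this a_neg[OF False]] show ?thesis
          by (simp add: sum_distrib_left mult_ac)
      qed
      have "(\<Sum>k\<le>n. \<Sum>m<N. a k * \<rho> m ^ k * (b m * sin (real m * z))) \<le> 0" for n
      proof -
        have "(\<Sum>k\<le>n. \<Sum>m<N. a k * \<rho> m ^ k * (b m * sin (real m * z))) \<le> (\<Sum>k\<le>n. - \<mu> * a k)"
          by (intro sum_mono term_le)
        also have "\<dots> = - \<mu> * (\<Sum>k\<le>n. a k)" by (simp add: sum_distrib_left)
        also have "\<dots> \<le> 0" using a_sum[of n] \<mu>(2) by simp
        finally show ?thesis .
      qed
      with LIMSEQ_le_const2[OF lim] show ?thesis unfolding \<rho>_def by blast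
    qed
    \<comment> \<open>\<open>t (1 - t / (m^2 + t)) = m^2 - m^4 / (m^2 + t)\<close>, which tends to
      \<open>m^2\<close>.\<close>
    have lim: "((\<lambda>t. \<Sum>m<N. (t * (1 - t / ((real m)^2 + t))) powr s * (b m * sin (real m * z))) \<longlongrightarrow>
            (\<Sum>m<N. real m powr (2 * s) * (b m * sin (real m * z)))) at_top"
    proof (intro tendsto_sum)
      fix m
      show "((\<lambda>t. (t * (1 - t / ((real m)^2 + t))) powr s * (b m * sin (real m * z))) \<longlongrightarrow>
         real m powr (2 * s) * (b m * sin (real m * z))) at_top"
      proof (cases "m = 0")
        case False
        have "((\<lambda>t. t * (1 - t / ((real m)^2 + t))) \<longlongrightarrow> (real m)^2) at_top"
        proof -
          have 1: "((\<lambda>t. (real m)^2 - (real m)^2 * (real m)^2 * inverse ((real m)^2 + t)) \<longlongrightarrow> (real m)^2 - (real m)^2 * (real m)^2 * 0) at_top"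
            by (intro tendsto_diff tendsto_mult tendsto_const tendsto_inverse_0_at_top
                filterlim_tendsto_add_at_top[OF tendsto_const] filterlim_ident)
          show ?thesis
          proof (rule Lim_transform_eventually)
            show "((\<lambda>t. (real m)^2 - (real m)^2 * (real m)^2 * inverse ((real m)^2 + t)) \<longlongrightarrow> (real m)^2) at_top"
              using 1 by simp
            show "\<forall>\<^sub>F t in at_top. (real m)^2 - (real m)^2 * (real m)^2 * inverse ((real m)^2 + t) = t * (1 - t / ((real m)^2 + t))"
              using eventually_gt_at_top[of 0]
            proof eventually_elim
              case (elim t)
              then have "(real m)^2 + t \<noteq> 0" by (smt (verit) zero_le_power2)
              then show ?case by (simp add: field_simps)
            qed
          qed
        qed
        then have "((\<lambda>t. (t * (1 - t / ((real m)^2 + t))) powr s) \<longlongrightarrow> ((real m)^2) powr s) at_top"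
          using False by (intro tendsto_powr tendsto_const) auto
        moreover have "((real m)^2) powr s = real m powr (2 * s)"
          using False by (simp add: powr_powr flip: powr_numeral)
        ultimately show ?thesis by (intro tendsto_mult tendsto_const) simp
      qed simp
    qed
    have "(\<Sum>m<N. real m powr (2 * s) * (b m * sin (real m * z))) \<le> 0"
    proof (rule tendsto_upperbound[OF lim])
      show "\<forall>\<^sub>F t in at_top. (\<Sum>m<N. (t * (1 - t / ((real m)^2 + t))) powr s * (b m * sin (real m * z))) \<le> 0"
        using eventually_gt_at_top[of 0]
      proof eventually_elim
        case (elim t)
        have "(t * (1 - t / ((real m)^2 + t))) powr s = t powr s * (1 - t / ((real m)^2 + t)) powr s" for m
          using elim by (intro powr_mult)
        then have "(\<Sum>m<N. (t * (1 - t / ((real m)^2 + t))) powr s * (b m * sin (real m * z))) =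
           t powr s * (\<Sum>m<N. (1 - t / ((real m)^2 + t)) powr s * (b m * sin (real m * z)))"
          by (simp add: sum_distrib_left mult_ac)
        then show ?case using frac_le[OF elim] by (simp add: mult_nonneg_nonpos)
      qed
    qed simp
    moreover have "(\<Sum>m<N. (real m powr (2 * s) + M) * b m * sin (real m * z)) =
        (\<Sum>m<N. real m powr (2 * s) * (b m * sin (real m * z))) + M * v z"
      unfolding v_def by (simp add: algebra_simps sum.distrib sum_distrib_left)
    ultimately have "- \<kappa> \<le> M * v z" using g[OF z(1)] by simp
    then show False using \<mu>(1) M unfolding \<mu>_def by (simp add: field_simps)
  qed
  then show ?thesis using z(2)[OF x] unfolding v_def by auto
qed

section \<open>Sine coefficients on the half period\<close>

text \<open>Odd periodic functions are determined by their restriction to \<open>[0, \<pi>]\<close>. A density is used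
  instead of a restricted space so that the \<open>\<sigma>\<close>-algebra stays the Borel one.\<close>

definition HP :: "real measure" where
  "HP = density lborel (indicator {0..pi})"

lemma sets_HP [measurable_cong, simp]: "sets HP = sets borel"
  by (simp add: HP_def)

lemma space_HP [simp]: "space HP = UNIV"
  by (simp add: HP_def)

lemma measurable_HP: "f \<in> borel_measurable borel \<Longrightarrow> f \<in> borel_measurable HP"
  by (simp add: HP_def)

lemma emeasure_HP_UNIV: "emeasure HP UNIV = ennreal pi"
  by (simp add: HP_def emeasure_density)

interpretation HP: finite_measure HP
  by standard (simp add: emeasure_HP_UNIV)

lemma measure_HP_UNIV [simp]: "measure HP UNIV = pi"
  by (simp add: measure_def emeasure_HP_UNIV)

lemma AE_HP_iff: "(AE x in HP. P x) \<longleftrightarrow> (AE x in lborel. x \<in> {0..pi} \<longrightarrow> P x)"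
  unfolding HP_def by (subst AE_density) (auto simp: indicator_def)

lemma AE_HP_I: "(\<And>x. x \<in> {0..pi} \<Longrightarrow> P x) \<Longrightarrow> AE x in HP. P x"
  by (simp add: AE_HP_iff)

lemma AE_HP_I': "(\<And>x. x \<in> {0<..<pi} \<Longrightarrow> P x) \<Longrightarrow> AE x in HP. P x"
  unfolding AE_HP_iff using AE_lborel_singleton[of 0] AE_lborel_singleton[of pi]
  by eventually_elim force

lemma integral_HP_eq:
  fixes f :: "real \<Rightarrow> 'a::{banach, second_countable_topology}"
  assumes [measurable]: "f \<in> borel_measurable borel"
  shows "(LINT x|HP. f x) = (LINT x:{0..pi}|lborel. f x)"
proof -
  have "(indicator {0..pi} :: real \<Rightarrow> ennreal) = (\<lambda>x. ennreal (indicator {0..pi} x))"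
    by (simp add: fun_eq_iff ennreal_indicator)
  then show ?thesis unfolding HP_def set_lebesgue_integral_def by (simp add: integral_density)
qed

lemma integrable_HP_iff:
  fixes f :: "real \<Rightarrow> 'a::{banach, second_countable_topology}"
  assumes [measurable]: "f \<in> borel_measurable borel"
  shows "integrable HP f \<longleftrightarrow> set_integrable lborel {0..pi} f"
proof -
  have "(indicator {0..pi} :: real \<Rightarrow> ennreal) = (\<lambda>x. ennreal (indicator {0..pi} x))"
    by (simp add: fun_eq_iff ennreal_indicator)
  then show ?thesis unfolding HP_def set_integrable_def by (simp add: integrable_density)
qed

lemma integral_HP_mono:
  fixes f g :: "real \<Rightarrow> real"
  assumes "integrable HP f" "integrable HP g" "\<And>x. x \<in> {0..pi} \<Longrightarrow> f x \<le> g x"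
  shows "(LINT x|HP. f x) \<le> (LINT x|HP. g x)"
  by (rule integral_mono_AE) (use assms AE_HP_I in auto)

lemma integrable_HP_bounded:
  fixes f :: "real \<Rightarrow> real"
  assumes "f \<in> borel_measurable borel" "\<And>x. x \<in> {0..pi} \<Longrightarrow> \<bar>f x\<bar> \<le> B"
  shows "integrable HP f"
  by (rule HP.integrable_const_bound[of _ B]) (use assms in \<open>auto intro!: AE_HP_I\<close>)

lemma integrable_HP_bounded_mult:
  fixes f :: "real \<Rightarrow> real"
  assumes g: "integrable HP g" and f: "f \<in> borel_measurable borel" "AE x in HP. \<bar>f x\<bar> \<le> B"
  shows "integrable HP (\<lambda>x. g x * f x)"
proof (rule Bochner_Integration.integrable_bound)
  show "integrable HP (\<lambda>x. B * g x)" using g by simp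
  show "AE x in HP. norm (g x * f x) \<le> norm (B * g x)"
    using f(2) by eventually_elim (auto simp: abs_mult mult.commute intro!: mult_right_mono)
qed (use f borel_measurable_integrable[OF g] in auto)

section \<open>Square-integrable functions on the half period\<close>

definition sq_int :: "(real \<Rightarrow> real) \<Rightarrow> bool" where
  "sq_int f \<longleftrightarrow> f \<in> borel_measurable borel \<and> integrable HP (\<lambda>x. (f x)^2)"

lemma sq_int_measurable [measurable_dest]: "sq_int f \<Longrightarrow> f \<in> borel_measurable borel"
  by (simp add: sq_int_def)

lemma sq_int_integrable_sq: "sq_int f \<Longrightarrow> integrable HP (\<lambda>x. (f x)^2)"
  by (simp add: sq_int_def)

lemma sq_int_mult:
  assumes "sq_int f" "sq_int g"
  shows "integrable HP (\<lambda>x. f x * g x)"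
proof (rule Bochner_Integration.integrable_bound)
  show "integrable HP (\<lambda>x. (f x)^2 + (g x)^2)" using assms by (simp add: sq_int_def)
  have "\<bar>a * b\<bar> \<le> a^2 + b^2" for a b :: real
  proof -
    have "2 * (\<bar>a\<bar> * \<bar>b\<bar>) \<le> a^2 + b^2" using sum_squares_bound[of "\<bar>a\<bar>" "\<bar>b\<bar>"] by (simp add: mult.assoc)
    moreover have "0 \<le> \<bar>a\<bar> * \<bar>b\<bar>" by simp
    ultimately show ?thesis unfolding abs_mult by linarith
  qed
  then show "AE x in HP. norm (f x * g x) \<le> norm ((f x)^2 + (g x)^2)" by auto
qed (use assms in measurable)

lemma sq_int_bounded:
  assumes "f \<in> borel_measurable borel" "\<And>x. x \<in> {0..pi} \<Longrightarrow> \<bar>f x\<bar> \<le> B"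
  shows "sq_int f"
  unfolding sq_int_def
proof
  show "integrable HP (\<lambda>x. (f x)^2)"
  proof (rule integrable_HP_bounded[where B = "B^2"])
    fix x :: real assume "x \<in> {0..pi}"
    from power_mono[OF assms(2)[OF this] abs_ge_zero, of 2] show "\<bar>(f x)^2\<bar> \<le> B^2" by simp
  qed (use assms(1) in measurable)
qed fact

lemma sq_int_AE_bounded:
  assumes "f \<in> borel_measurable borel" "AE x in HP. \<bar>f x\<bar> \<le> B"
  shows "sq_int f"
  unfolding sq_int_def
proof
  show "integrable HP (\<lambda>x. (f x)^2)"
  proof (rule HP.integrable_const_bound[of _ "B^2"])
    show "AE x in HP. norm ((f x)^2) \<le> B^2"
      using assms(2) by eventually_elim (use power_mono[OF _ abs_ge_zero, of _ B 2] in auto)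
  qed (use assms(1) in measurable)
qed fact

lemma sq_int_integrable: "sq_int f \<Longrightarrow> integrable HP f"
  using sq_int_mult[OF _ sq_int_bounded[of "\<lambda>_. 1" 1], of f] by simp

lemma sq_int_add: "sq_int f \<Longrightarrow> sq_int g \<Longrightarrow> sq_int (\<lambda>x. f x + g x)"
  using sq_int_mult[of f g] by (auto simp: sq_int_def power2_sum mult.assoc)

lemma sq_int_diff: "sq_int f \<Longrightarrow> sq_int g \<Longrightarrow> sq_int (\<lambda>x. f x - g x)"
  using sq_int_mult[of f g] by (auto simp: sq_int_def power2_diff mult.assoc)

lemma sq_int_cmult: "sq_int f \<Longrightarrow> sq_int (\<lambda>x. c * f x)"
  by (auto simp: sq_int_def power_mult_distrib)

lemma sq_int_sin: "sq_int (\<lambda>x. sin (real m * x))"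
  by (rule sq_int_bounded[of _ 1]) auto

lemma sq_int_sum: "(\<And>i. i \<in> A \<Longrightarrow> sq_int (f i)) \<Longrightarrow> sq_int (\<lambda>x. \<Sum>i\<in>A. f i x)"
proof (induction A rule: infinite_finite_induct)
  case (insert a A) then show ?case using sq_int_add[of "f a"] by auto
qed (auto intro: sq_int_bounded[of _ 0])

text \<open>The factor \<open>2 / pi\<close> gives the coefficients of the sine expansion on
  \<open>[0, pi]\<close>; the index \<open>0\<close> is kept, with value \<open>0\<close>, so that
  all series run over \<open>nat\<close>.\<close>

definition sine_coeff :: "(real \<Rightarrow> real) \<Rightarrow> nat \<Rightarrow> real" where
  "sine_coeff g m = 2 / pi * (LINT x|HP. g x * sin (real m * x))"

lemma sine_coeff_0 [simp]: "sine_coeff g 0 = 0"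
  by (simp add: sine_coeff_def)

lemma integrable_mult_sin: "integrable HP g \<Longrightarrow> integrable HP (\<lambda>x. g x * sin (real m * x))"
  by (rule integrable_HP_bounded_mult[where B = 1]) auto

lemma sine_coeff_cong_AE:
  assumes "AE x in HP. f x = g x" "f \<in> borel_measurable borel" "g \<in> borel_measurable borel"
  shows "sine_coeff f m = sine_coeff g m"
  unfolding sine_coeff_def
  by (intro arg_cong2[where f = "(*)"] refl integral_cong_AE) (use assms in auto)

lemma sine_coeff_add:
  "integrable HP f \<Longrightarrow> integrable HP g \<Longrightarrow>
     sine_coeff (\<lambda>x. f x + g x) m = sine_coeff f m + sine_coeff g m"
  unfolding sine_coeff_def by (simp add: distrib_right integrable_mult_sin distrib_left)

lemma sine_coeff_diff:
  "integrable HP f \<Longrightarrow> integrable HP g \<Longrightarrow>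
     sine_coeff (\<lambda>x. f x - g x) m = sine_coeff f m - sine_coeff g m"
  unfolding sine_coeff_def by (simp add: left_diff_distrib integrable_mult_sin right_diff_distrib)

lemma sine_coeff_cmult: "sine_coeff (\<lambda>x. c * f x) m = c * sine_coeff f m"
  unfolding sine_coeff_def by (simp add: mult.assoc)

lemma integral_cos_HP:
  "(LINT x|HP. cos (of_int k * x)) = (if k = 0 then pi else 0)"
proof (cases "k = 0")
  case False
  have "(\<integral>x. cos (of_int k * x) * indicator {0..pi} x \<partial>lborel) =
      sin (of_int k * pi) / of_int k - sin (of_int k * 0) / of_int k"
    by (rule integral_FTC_Icc_real)
      (use False in \<open>auto intro!: derivative_eq_intros continuous_intros\<close>)
  moreover have "sin (of_int k * pi) = 0"
    by (metis mult.commute sin_integer_2pi sin_int_times_real sin_npi_int)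
  ultimately show ?thesis using False
    by (simp add: integral_HP_eq set_lebesgue_integral_def mult.commute)
qed simp

lemma integral_sin_sin_HP:
  "(LINT x|HP. sin (real m * x) * sin (real n * x)) = (if m = n \<and> m \<noteq> 0 then pi / 2 else 0)"
proof -
  have eq: "sin (real m * x) * sin (real n * x) =
      (cos (of_int (int m - int n) * x) - cos (of_int (int m + int n) * x)) / 2" for x
    by (simp add: cos_diff cos_add algebra_simps)
  have int: "integrable HP (\<lambda>x. cos (of_int k * x))" for k
    by (rule integrable_HP_bounded[of _ 1]) auto
  show ?thesis unfolding eq using int integral_cos_HP
    by (auto simp: Bochner_Integration.integral_diff[OF int int] simp del: of_int_diff of_int_add)
qed

lemma sine_coeff_sine_sum:
  "sine_coeff (\<lambda>x. \<Sum>k<N. c k * sin (real k * x)) m = (if m < N \<and> m \<noteq> 0 then c m else 0)"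
proof -
  have "(LINT x|HP. (\<Sum>k<N. c k * sin (real k * x)) * sin (real m * x)) =
      (\<Sum>k<N. c k * (LINT x|HP. sin (real k * x) * sin (real m * x)))"
    unfolding sum_distrib_right
    by (subst Bochner_Integration.integral_sum)
      (auto simp: mult.assoc intro!: integrable_HP_bounded[of _ 1] sq_int_mult[OF sq_int_sin sq_int_sin])
  also have "\<dots> = (\<Sum>k<N. if k = m then (if m \<noteq> 0 then c m * (pi / 2) else 0) else 0)"
    by (intro sum.cong) (auto simp: integral_sin_sin_HP)
  also have "\<dots> = (if m < N \<and> m \<noteq> 0 then c m * (pi / 2) else 0)" by (simp add: sum.delta)
  finally show ?thesis by (simp add: sine_coeff_def)
qed

lemma sine_sum_integral:
  assumes g: "integrable HP g"
  shows "(LINT x|HP. g x * (\<Sum>k<N. c k * sin (real k * x))) = pi / 2 * (\<Sum>k<N. c k * sine_coeff g k)"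
proof -
  have "(LINT x|HP. g x * (\<Sum>k<N. c k * sin (real k * x))) =
      (LINT x|HP. (\<Sum>k<N. c k * (g x * sin (real k * x))))"
    by (simp add: sum_distrib_left mult_ac)
  also have "\<dots> = (\<Sum>k<N. c k * (LINT x|HP. g x * sin (real k * x)))"
    using integrable_mult_sin[OF g] by (subst Bochner_Integration.integral_sum) auto
  finally show ?thesis by (simp add: sine_coeff_def sum_distrib_left)
qed

section \<open>Bessel's inequality and completeness of the sine system\<close>

lemma bessel_identity:
  assumes g: "sq_int g"
  shows "(LINT x|HP. (g x - (\<Sum>k<N. sine_coeff g k * sin (real k * x)))^2) =
    (LINT x|HP. (g x)^2) - pi / 2 * (\<Sum>k<N. (sine_coeff g k)^2)"
proof -
  define S where "S x = (\<Sum>k<N. sine_coeff g k * sin (real k * x))" for x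
  have S: "sq_int S" unfolding S_def by (intro sq_int_sum sq_int_cmult sq_int_sin)
  have gS: "(LINT x|HP. g x * S x) = pi / 2 * (\<Sum>k<N. (sine_coeff g k)^2)"
    unfolding S_def using sine_sum_integral[OF sq_int_integrable[OF g]] by (simp add: power2_eq_square)
  have SS: "(LINT x|HP. S x * S x) = pi / 2 * (\<Sum>k<N. (sine_coeff g k)^2)"
  proof -
    have "(LINT x|HP. S x * S x) = pi / 2 * (\<Sum>k<N. sine_coeff g k * sine_coeff S k)"
      using sine_sum_integral[OF sq_int_integrable[OF S], of "sine_coeff g" N] by (simp add: S_def[symmetric])
    also have "(\<Sum>k<N. sine_coeff g k * sine_coeff S k) = (\<Sum>k<N. (sine_coeff g k)^2)"
      unfolding S_def by (intro sum.cong) (auto simp: sine_coeff_sine_sum power2_eq_square)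
    finally show ?thesis .
  qed
  have "(LINT x|HP. (g x - S x)^2) = (LINT x|HP. (g x)^2 - 2 * (g x * S x) + S x * S x)"
    by (simp add: power2_eq_square algebra_simps)
  also have "\<dots> = (LINT x|HP. (g x)^2) - 2 * (LINT x|HP. g x * S x) + (LINT x|HP. S x * S x)"
    using sq_int_mult[OF g S] sq_int_mult[OF S S] sq_int_integrable_sq[OF g] by simp
  finally show ?thesis unfolding gS SS by (simp add: S_def)
qed

lemma bessel_inequality:
  assumes g: "sq_int g"
  shows "summable (\<lambda>k. (sine_coeff g k)^2)" "pi / 2 * (\<Sum>k. (sine_coeff g k)^2) \<le> (LINT x|HP. (g x)^2)"
    "pi / 2 * (sine_coeff g m)^2 \<le> (LINT x|HP. (g x)^2)"
proof -
  have le: "(\<Sum>k<N. (sine_coeff g k)^2) \<le> 2 / pi * (LINT x|HP. (g x)^2)" for N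
  proof -
    have "0 \<le> (LINT x|HP. (g x - (\<Sum>k<N. sine_coeff g k * sin (real k * x)))^2)" by simp
    then show ?thesis unfolding bessel_identity[OF g] by (simp add: field_simps)
  qed
  show 1: "summable (\<lambda>k. (sine_coeff g k)^2)"
    by (rule summableI_nonneg_bounded[OF _ le]) simp
  have 2: "(\<Sum>k. (sine_coeff g k)^2) \<le> 2 / pi * (LINT x|HP. (g x)^2)"
    by (rule suminf_le_const[OF 1 le])
  then show "pi / 2 * (\<Sum>k. (sine_coeff g k)^2) \<le> (LINT x|HP. (g x)^2)" by (simp add: field_simps)
  have "(sine_coeff g m)^2 \<le> (\<Sum>k. (sine_coeff g k)^2)"
    using sum_le_suminf[OF 1, of "{m}"] by auto
  with 2 have "(sine_coeff g m)^2 \<le> 2 / pi * (LINT x|HP. (g x)^2)" by linarith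
  then show "pi / 2 * (sine_coeff g m)^2 \<le> (LINT x|HP. (g x)^2)" by (simp add: field_simps)
qed

text \<open>Substituting \<open>y = cos x\<close>, Weierstrass approximation makes \<open>G\<close>
  orthogonal to every continuous function; dominated convergence passes to half-lines, and a Dynkin
  argument to all Borel sets. The setting is \<open>L^1\<close> because uniqueness of
  \<open>(-\<Delta>)\<^sup>s\<close> has to hold there.\<close>

lemma cos_moments_zero_imp_AE_zero:
  fixes G :: "real \<Rightarrow> real"
  assumes G: "integrable HP G" and mom: "\<And>j. (LINT x|HP. G x * cos x ^ j) = 0"
  shows "AE x in HP. G x = 0"
proof -
  have Gm [measurable]: "G \<in> borel_measurable borel"
    using borel_measurable_integrable[OF G] by simp
  have cont: "(LINT x|HP. G x * w x) = 0" if w: "continuous_on UNIV w" for w :: "real \<Rightarrow> real"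
  proof -
    have wm [measurable]: "w \<in> borel_measurable borel" using w by (rule borel_measurable_continuous_onI)
    have ac: "continuous_on {-1..1} (\<lambda>y. w (arccos y))"
      using continuous_on_compose[OF continuous_on_arccos' continuous_on_subset[OF w]]
      by (auto simp: o_def)
    have "bounded (w ` {0..pi})"
      by (intro compact_imp_bounded compact_continuous_image continuous_on_subset[OF w]) auto
    then obtain B where B: "\<And>x. x \<in> {0..pi} \<Longrightarrow> \<bar>w x\<bar> \<le> B"
      unfolding bounded_iff by force
    have Gw: "integrable HP (\<lambda>x. G x * w x)"
      by (rule integrable_HP_bounded_mult[OF G wm, of B]) (use B in \<open>auto intro: AE_HP_I\<close>)
    have le: "\<bar>LINT x|HP. G x * w x\<bar> \<le> e * (LINT x|HP. \<bar>G x\<bar>)" if e: "e > 0" for e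
    proof -
      obtain q where q: "real_polynomial_function q" "\<And>y. y \<in> {-1..1} \<Longrightarrow> \<bar>w (arccos y) - q y\<bar> < e"
        using Stone_Weierstrass_real_polynomial_function[OF compact_Icc ac e] by blast
      then obtain a n where an: "q = (\<lambda>y. \<Sum>i\<le>n. a i * y ^ i)"
        by (auto simp: real_polynomial_function_iff_sum)
      have intc: "integrable HP (\<lambda>x. G x * cos x ^ i)" for i
        by (rule integrable_HP_bounded_mult[OF G, of _ 1]) (auto simp: power_abs intro!: power_le_one)
      have Gq: "integrable HP (\<lambda>x. G x * q (cos x))" "(LINT x|HP. G x * q (cos x)) = 0"
      proof -
        have *: "G x * q (cos x) = (\<Sum>i\<le>n. a i * (G x * cos x ^ i))" for x
          unfolding an by (simp add: sum_distrib_left mult_ac)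
        show "integrable HP (\<lambda>x. G x * q (cos x))" unfolding * using intc by simp
        show "(LINT x|HP. G x * q (cos x)) = 0" unfolding * using intc mom
          by (subst Bochner_Integration.integral_sum) auto
      qed
      have "\<bar>LINT x|HP. G x * w x\<bar> = \<bar>LINT x|HP. G x * w x - G x * q (cos x)\<bar>"
        using Gw Gq by simp
      also have "\<dots> \<le> (LINT x|HP. \<bar>G x * w x - G x * q (cos x)\<bar>)"
        by (rule integral_abs_bound)
      also have "\<dots> \<le> (LINT x|HP. e * \<bar>G x\<bar>)"
      proof (rule integral_HP_mono)
        fix x :: real assume x: "x \<in> {0..pi}"
        have "\<bar>w x - q (cos x)\<bar> \<le> e" using q(2)[of "cos x"] x by (simp add: arccos_cos)
        then have "\<bar>G x\<bar> * \<bar>w x - q (cos x)\<bar> \<le> \<bar>G x\<bar> * e" by (intro mult_left_mono) auto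
        then show "\<bar>G x * w x - G x * q (cos x)\<bar> \<le> e * \<bar>G x\<bar>"
          by (simp add: abs_mult right_diff_distrib[symmetric] mult.commute)
      qed (use Gw Gq G in auto)
      finally show ?thesis by simp
    qed
    have "\<bar>LINT x|HP. G x * w x\<bar> \<le> 0"
    proof (rule field_le_epsilon)
      fix e :: real assume e: "e > 0"
      define I where "I = (LINT x|HP. \<bar>G x\<bar>)"
      have I: "I \<ge> 0" unfolding I_def by simp
      have "\<bar>LINT x|HP. G x * w x\<bar> \<le> e / (I + 1) * I"
        using le[of "e / (I + 1)"] e I unfolding I_def by simp
      also have "\<dots> \<le> e" using e I by (simp add: field_simps)
      finally show "\<bar>LINT x|HP. G x * w x\<bar> \<le> 0 + e" by simp
    qed
    then show ?thesis by simp
  qed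
  have half: "(LINT x|HP. indicator {..a} x * G x) = 0" for a :: real
  proof -
    define w where "w n x = max 0 (min 1 (1 - real n * (x - a)))" for n x
    have wc: "continuous_on UNIV (w n)" for n unfolding w_def by (intro continuous_intros)
    then have wm [measurable]: "w n \<in> borel_measurable borel" for n
      by (intro borel_measurable_continuous_onI)
    have "(\<lambda>n. LINT x|HP. G x * w n x) \<longlonglongrightarrow> (LINT x|HP. indicator {..a} x * G x)"
    proof (rule integral_dominated_convergence[where w = "\<lambda>x. \<bar>G x\<bar>"])
      show "AE x in HP. (\<lambda>n. G x * w n x) \<longlonglongrightarrow> indicator {..a} x * G x"
      proof (rule AE_I2)
        fix x :: real
        show "(\<lambda>n. G x * w n x) \<longlonglongrightarrow> indicator {..a} x * G x"
        proof (cases "x \<le> a")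
          case True
          then have "w n x = 1" for n unfolding w_def by (auto simp: mult_nonneg_nonpos)
          then show ?thesis using True by simp
        next
          case False
          obtain n0 :: nat where n0: "1 / (x - a) < real n0" using reals_Archimedean2 by blast
          have "w n x = 0" if "n \<ge> n0" for n
          proof -
            have "1 < real n0 * (x - a)" using n0 False by (simp add: field_simps)
            also have "\<dots> \<le> real n * (x - a)" using that False by (intro mult_right_mono) auto
            finally show ?thesis unfolding w_def by auto
          qed
          then have "\<forall>\<^sub>F n in sequentially. G x * w n x = 0"
            by (auto simp: eventually_sequentially)
          then show ?thesis using False by (simp add: tendsto_eventually)
        qed
      qed
      show "AE x in HP. norm (G x * w n x) \<le> \<bar>G x\<bar>" for n
        by (rule AE_I2) (auto simp: w_def abs_mult intro!: mult_left_le)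
    qed (use G in auto)
    then show ?thesis using cont[OF wc] by (simp add: LIMSEQ_const_iff)
  qed
  have GA: "integrable HP (\<lambda>x. indicator A x * G x)" if [measurable]: "A \<in> sets borel" for A
    using integrable_mult_indicator[OF _ G, of A] by simp
  have all: "(LINT x|HP. indicator A x * G x) = 0" if "A \<in> sets borel" for A
  proof -
    have G0: "(LINT x|HP. G x) = 0" using mom[of 0] by simp
    have A: "A \<in> sigma_sets UNIV (range (\<lambda>a::real. {..a}))"
      using that unfolding borel_eq_atMost by simp
    have Bor: "A \<in> sets borel" if "A \<in> sigma_sets UNIV (range (\<lambda>a::real. {..a}))" for A
      using that unfolding borel_eq_atMost by simp
    have "Int_stable (range (\<lambda>a::real. {..a}))"
      by (auto simp: Int_stable_def Int_atMost)
    moreover have "range (\<lambda>a::real. {..a}) \<subseteq> Pow UNIV" by simp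
    ultimately show ?thesis using A
    proof (induction rule: sigma_sets_induct_disjoint)
      case (compl A)
      note [measurable] = Bor[OF compl(1)]
      have "(LINT x|HP. indicator (UNIV - A) x * G x) = (LINT x|HP. G x - indicator A x * G x)"
        by (intro Bochner_Integration.integral_cong) (auto simp: indicator_def)
      then show ?case using G GA[OF Bor[OF compl(1)]] compl(2) G0 by simp
    next
      case (union A)
      have B: "A i \<in> sets borel" for i using union(2) Bor by blast
      then have [measurable]: "(\<Union>i. A i) \<in> sets borel" by auto
      have "(LINT x:(\<Union>i. A i)|HP. G x) = (\<Sum>i. (LINT x:(A i)|HP. G x))"
        by (rule lebesgue_integral_countable_add)
          (use B union(1) GA in \<open>auto simp: set_integrable_def disjoint_family_on_def\<close>)
      then show ?case using union(3) by (simp add: set_lebesgue_integral_def)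
    qed (auto simp: half)
  qed
  show ?thesis
    by (rule density_unique_real[of HP G "\<lambda>_. 0", OF G]) (auto simp: set_lebesgue_integral_def all)
qed

text \<open>The product formula for \<open>sin (m x) cos x\<close> spreads the vanishing to all
  moments against \<open>sin (m x) cos x ^ j\<close>; the case \<open>m = 1\<close> says that
  \<open>G sin\<close> has no cosine moments, and \<open>sin\<close> does not vanish inside the
  interval.\<close>

lemma sine_coeff_zero_imp_AE_zero:
  fixes G :: "real \<Rightarrow> real"
  assumes G: "integrable HP G" and zero: "\<And>m. sine_coeff G m = 0"
  shows "AE x in HP. G x = 0"
proof -
  have Gm [measurable]: "G \<in> borel_measurable borel"
    using borel_measurable_integrable[OF G] by simp
  have int: "integrable HP (\<lambda>x. G x * (sin (real m * x) * cos x ^ j))" for m j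
    by (rule integrable_HP_bounded_mult[OF G, of _ 1])
      (auto simp: abs_mult power_abs intro!: mult_le_one power_le_one)
  have 0: "(LINT x|HP. G x * (sin (real m * x) * cos x ^ j)) = 0" for m j
  proof (induction j arbitrary: m)
    case 0
    then show ?case using zero[of m] by (simp add: sine_coeff_def)
  next
    case (Suc j)
    show ?case
    proof (cases m)
      case (Suc n)
      have "sin (real m * x) * cos x = (sin (real (Suc m) * x) + sin (real n * x)) / 2" for x
      proof -
        have "real (Suc m) * x = real m * x + x" "real n * x = real m * x - x"
          unfolding Suc by (auto simp: algebra_simps)
        then show ?thesis by (simp only: sin_add sin_diff) simp
      qed
      note prod = this
      have eq: "G x * (sin (real m * x) * cos x ^ Suc j) =
         (G x * (sin (real (Suc m) * x) * cos x ^ j) + G x * (sin (real n * x) * cos x ^ j)) / 2" for x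
      proof -
        have "G x * (sin (real m * x) * cos x ^ Suc j) = G x * cos x ^ j * (sin (real m * x) * cos x)"
          by simp
        also have "\<dots> = (G x * (sin (real (Suc m) * x) * cos x ^ j) + G x * (sin (real n * x) * cos x ^ j)) / 2"
          unfolding prod by (simp add: field_simps del: of_nat_Suc)
        finally show ?thesis .
      qed
      show ?thesis unfolding eq using int Suc.IH by (simp del: of_nat_Suc)
    qed simp
  qed
  have "AE x in HP. G x * sin x = 0"
  proof (rule cos_moments_zero_imp_AE_zero)
    show "integrable HP (\<lambda>x. G x * sin x)" using int[of 1 0] by simp
    show "(LINT x|HP. G x * sin x * cos x ^ j) = 0" for j using 0[of 1 j] by (simp add: mult_ac)
  qed
  moreover have "AE x in HP. sin x \<noteq> 0"
    by (rule AE_HP_I') (metis greaterThanLessThan_iff less_irrefl sin_gt_zero)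
  ultimately show ?thesis by eventually_elim simp
qed

lemma sine_coeff_eq_imp_AE_eq:
  assumes "integrable HP f" "integrable HP g" "\<And>m. sine_coeff f m = sine_coeff g m"
  shows "AE x in HP. f x = g x"
proof -
  have "AE x in HP. f x - g x = 0"
    by (rule sine_coeff_zero_imp_AE_zero) (use assms in \<open>auto simp: sine_coeff_diff\<close>)
  then show ?thesis by eventually_elim simp
qed

section \<open>Riesz-Fischer, Parseval and Poisson means\<close>

lemma sine_sum_norm:
  assumes "d 0 = 0"
  shows "(LINT x|HP. (\<Sum>k<N. d k * sin (real k * x))^2) = pi / 2 * (\<Sum>k<N. (d k)^2)"
proof -
  define S where "S x = (\<Sum>k<N. d k * sin (real k * x))" for x
  have S: "sq_int S" unfolding S_def by (intro sq_int_sum sq_int_cmult sq_int_sin)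
  have "(LINT x|HP. S x * (\<Sum>k<N. d k * sin (real k * x))) = pi / 2 * (\<Sum>k<N. d k * sine_coeff S k)"
    by (rule sine_sum_integral[OF sq_int_integrable[OF S]])
  also have "(\<Sum>k<N. d k * sine_coeff S k) = (\<Sum>k<N. (d k)^2)"
    unfolding S_def by (intro sum.cong) (auto simp: sine_coeff_sine_sum power2_eq_square assms)
  finally show ?thesis unfolding S_def by (simp add: power2_eq_square)
qed

text \<open>The function is a pointwise limit of a subsequence of partial sums, set to
  \<open>0\<close> where there is no limit. Hence oddness and periodicity hold at every point; for
  periodicity, membership in \<open>L1_per\<close> demands this.\<close>

lemma riesz_fischer:
  assumes c: "summable (\<lambda>m. (c m)^2)" and c0: "c 0 = 0"
  obtains w where "sq_int w" "\<And>m. sine_coeff w m = c m"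
    "(LINT x|HP. (w x)^2) = pi / 2 * (\<Sum>m. (c m)^2)"
    "\<And>x. w (- x) = - w x" "\<And>x. w (x + 2 * pi) = w x"
proof -
  define S where "S n x = (\<Sum>k<n. c k * sin (real k * x))" for n x
  have S: "sq_int (S n)" for n unfolding S_def by (intro sq_int_sum sq_int_cmult sq_int_sin)
  note [measurable] = sq_int_measurable[OF S]
  define \<tau> where "\<tau> n = (\<Sum>k. (c k)^2) - (\<Sum>k<n. (c k)^2)" for n
  have \<tau>_lim: "\<tau> \<longlonglongrightarrow> 0"
    using tendsto_diff[OF tendsto_const summable_LIMSEQ[OF c], of "\<Sum>k. (c k)^2"]
    unfolding \<tau>_def by simp
  have \<tau>_mono: "\<tau> n \<le> \<tau> m" if "m \<le> n" for m n
    unfolding \<tau>_def using that by (auto intro!: sum_mono2)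
  have dist: "(LINT x|HP. (S i x - S j x)^2) \<le> pi / 2 * \<tau> j" if "j \<le> i" for i j
  proof -
    define d where "d k = (if k < j then 0 else c k)" for k
    have "S i x - S j x = (\<Sum>k<i. d k * sin (real k * x))" for x
    proof -
      have "S i x = S j x + (\<Sum>k\<in>{j..<i}. c k * sin (real k * x))"
        unfolding S_def using that sum.atLeastLessThan_concat[of 0 j i "\<lambda>k. c k * sin (real k * x)"]
        by (simp add: atLeast0LessThan)
      also have "(\<Sum>k\<in>{j..<i}. c k * sin (real k * x)) = (\<Sum>k<i. d k * sin (real k * x))"
        by (rule sum.mono_neutral_cong_left) (auto simp: d_def)
      finally show ?thesis by simp
    qed
    then have "(LINT x|HP. (S i x - S j x)^2) = pi / 2 * (\<Sum>k<i. (d k)^2)"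
      using sine_sum_norm[of d i] c0 by (simp add: d_def)
    also have "(\<Sum>k<i. (d k)^2) = (\<Sum>k\<in>{j..<i}. (c k)^2)"
      by (rule sum.mono_neutral_cong_right) (auto simp: d_def)
    also have "\<dots> \<le> \<tau> j"
    proof -
      have "(\<Sum>k<j. (c k)^2) + (\<Sum>k\<in>{j..<i}. (c k)^2) = (\<Sum>k<i. (c k)^2)"
        using that sum.atLeastLessThan_concat[of 0 j i "\<lambda>k. (c k)^2"] by (simp add: atLeast0LessThan)
      moreover have "(\<Sum>k<i. (c k)^2) \<le> (\<Sum>k. (c k)^2)" by (rule sum_le_suminf[OF c]) auto
      ultimately show ?thesis unfolding \<tau>_def by linarith
    qed
    finally show ?thesis by simp
  qed
  have L1: "\<exists>N. \<forall>i\<ge>N. \<forall>j\<ge>N. (LINT x|HP. norm (S i x - S j x)) < e" if e: "e > 0" for e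
  proof -
    \<comment> \<open>Chosen so that in \<open>\<epsilon> pi + (pi / 2) \<tau> / \<epsilon>\<close>
      the first term is \<open>e / 2\<close> and the second is below \<open>e / 2\<close> once
      \<open>\<tau> N < \<epsilon> e / pi\<close>.\<close>
    define \<epsilon> where "\<epsilon> = e / (2 * pi)"
    have \<epsilon>: "\<epsilon> > 0" using e by (simp add: \<epsilon>_def)
    then have "\<epsilon> * e / pi > 0" using e by simp
    then have "\<forall>\<^sub>F n in sequentially. \<tau> n < \<epsilon> * e / pi"
      using order_tendstoD(2)[OF \<tau>_lim] by blast
    then obtain N where N: "\<tau> N < \<epsilon> * e / pi" by (auto simp: eventually_sequentially)
    have le: "(LINT x|HP. norm (S i x - S j x)) < e" if "i \<ge> N" "j \<ge> N" "j \<le> i" for i j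
    proof -
      have int: "integrable HP (\<lambda>x. (S i x - S j x)^2)"
        using sq_int_integrable_sq[OF sq_int_diff[OF S S]] .
      have "\<bar>a\<bar> \<le> \<epsilon> + a^2 / \<epsilon>" for a :: real
      proof (cases "\<bar>a\<bar> \<le> \<epsilon>")
        case False
        then have "\<bar>a\<bar> * \<epsilon> \<le> \<bar>a\<bar> * \<bar>a\<bar>" by (intro mult_left_mono) auto
        then have "\<bar>a\<bar> \<le> a^2 / \<epsilon>" using \<epsilon> by (simp add: field_simps power2_eq_square)
        then show ?thesis using \<epsilon> by simp
      qed (use \<epsilon> in \<open>smt (verit) divide_nonneg_pos zero_le_power2\<close>)
      then have "(LINT x|HP. norm (S i x - S j x)) \<le> (LINT x|HP. \<epsilon> + (S i x - S j x)^2 / \<epsilon>)"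
        using int sq_int_integrable[OF sq_int_diff[OF S S]] by (intro integral_mono) auto
      also have "\<dots> = \<epsilon> * pi + (LINT x|HP. (S i x - S j x)^2) / \<epsilon>"
        using int by (simp add: Bochner_Integration.integral_add)
      also have "\<dots> \<le> \<epsilon> * pi + (pi / 2 * \<tau> N) / \<epsilon>"
      proof -
        have "pi / 2 * \<tau> j \<le> pi / 2 * \<tau> N" using \<tau>_mono[OF that(2)] by simp
        from order_trans[OF dist[OF that(3)] this] show ?thesis
          using \<epsilon> by (intro add_left_mono divide_right_mono) auto
      qed
      also have "\<dots> < e"
      proof -
        have "(pi / 2 * \<tau> N) / \<epsilon> < (pi / 2 * (\<epsilon> * e / pi)) / \<epsilon>"
          using N \<epsilon> by (intro divide_strict_right_mono mult_strict_left_mono) auto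
        also have "\<dots> = e / 2" using \<epsilon> by simp
        finally have "(pi / 2 * \<tau> N) / \<epsilon> < e / 2" .
        moreover have "\<epsilon> * pi = e / 2" unfolding \<epsilon>_def by simp
        ultimately show ?thesis by linarith
      qed
      finally show ?thesis .
    qed
    show ?thesis
    proof (intro exI[of _ N] allI impI)
      fix i j assume "i \<ge> N" "j \<ge> N"
      then show "(LINT x|HP. norm (S i x - S j x)) < e"
        using le[of i j] le[of j i] by (cases "j \<le> i") (auto simp: abs_minus_commute)
    qed
  qed
  obtain r where r: "strict_mono r" and Cau: "AE x in HP. Cauchy (\<lambda>i. S (r i) x)"
    by (rule cauchy_L1_AE_cauchy_subseq[OF sq_int_integrable[OF S] L1])
  define w where "w x = (if convergent (\<lambda>i. S (r i) x) then lim (\<lambda>i. S (r i) x) else 0)" for x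
  have "w = (\<lambda>x. if Cauchy (\<lambda>i. S (r i) x) then lim (\<lambda>i. S (r i) x) else 0)"
    unfolding w_def Cauchy_convergent_iff ..
  then have wm [measurable]: "w \<in> borel_measurable borel"
    by simp measurable
  have lim: "AE x in HP. (\<lambda>i. S (r i) x) \<longlonglongrightarrow> w x"
    using Cau by eventually_elim (auto simp: w_def Cauchy_convergent_iff convergent_LIMSEQ_iff)
  \<comment> \<open>Fatou's lemma transfers the \<open>L^2\<close> distance between partial sums to
    the limit, although the subsequence was extracted from a Cauchy property in
    \<open>L^1\<close>.\<close>
  have fatou: "(\<integral>\<^sup>+x. ennreal ((w x - S n x)^2) \<partial>HP) \<le> ennreal (pi / 2 * \<tau> n)" for n
  proof -
    have "(\<integral>\<^sup>+x. ennreal ((w x - S n x)^2) \<partial>HP) =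
        (\<integral>\<^sup>+x. liminf (\<lambda>i. ennreal ((S (r i) x - S n x)^2)) \<partial>HP)"
    proof (rule nn_integral_cong_AE, use lim in eventually_elim)
      case (elim x)
      then have "(\<lambda>i. ennreal ((S (r i) x - S n x)^2)) \<longlonglongrightarrow> ennreal ((w x - S n x)^2)"
        by (intro tendsto_intros)
      from lim_imp_Liminf[OF sequentially_bot this] show ?case by (rule sym)
    qed
    also have "\<dots> \<le> liminf (\<lambda>i. \<integral>\<^sup>+x. ennreal ((S (r i) x - S n x)^2) \<partial>HP)"
      by (rule nn_integral_liminf) measurable
    also have "\<dots> \<le> ennreal (pi / 2 * \<tau> n)"
    proof (rule Liminf_le)
      show "\<forall>\<^sub>F i in sequentially. (\<integral>\<^sup>+x. ennreal ((S (r i) x - S n x)^2) \<partial>HP) \<le> ennreal (pi / 2 * \<tau> n)"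
        using eventually_ge_at_top[of n]
      proof eventually_elim
        case (elim i)
        then have "n \<le> r i" using strict_mono_imp_increasing[OF r, of i] by linarith
        have "(\<integral>\<^sup>+x. ennreal ((S (r i) x - S n x)^2) \<partial>HP) = ennreal (LINT x|HP. (S (r i) x - S n x)^2)"
          using sq_int_integrable_sq[OF sq_int_diff[OF S S]] by (intro nn_integral_eq_integral) auto
        then show ?case using dist[OF \<open>n \<le> r i\<close>] by (simp add: ennreal_leI)
      qed
    qed simp
    finally show ?thesis .
  qed
  have wS: "sq_int (\<lambda>x. w x - S n x)" for n
    unfolding sq_int_def
  proof
    show "integrable HP (\<lambda>x. (w x - S n x)^2)"
      using fatou[of n] by (intro integrableI_bounded) (auto intro: le_less_trans)
  qed measurable
  have w: "sq_int w" using sq_int_add[OF wS S, of 0 0] by simp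
  have wSle: "(LINT x|HP. (w x - S n x)^2) \<le> pi / 2 * \<tau> n" for n
  proof -
    have "\<tau> n \<ge> 0" unfolding \<tau>_def using sum_le_suminf[OF c, of "{..<n}"] by simp
    moreover have "ennreal (LINT x|HP. (w x - S n x)^2) \<le> ennreal (pi / 2 * \<tau> n)"
      using fatou[of n] nn_integral_eq_integral[OF sq_int_integrable_sq[OF wS]] by simp
    ultimately show ?thesis by (subst (asm) ennreal_le_iff) auto
  qed
  have coeff: "sine_coeff w m = c m" for m
  proof -
    \<comment> \<open>For \<open>n > m\<close> the coefficient of \<open>w - S n\<close> no longer
      depends on \<open>n\<close>, while Bessel bounds it by a tail that vanishes.\<close>
    have "pi / 2 * (sine_coeff w m - c m)^2 \<le> pi / 2 * \<tau> n" if "n > m" for n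
    proof -
      have "sine_coeff (\<lambda>x. w x - S n x) m = sine_coeff w m - c m"
        using that c0 sine_coeff_diff[OF sq_int_integrable[OF w] sq_int_integrable[OF S]]
        unfolding S_def sine_coeff_sine_sum by auto
      then show ?thesis using order_trans[OF bessel_inequality(3)[OF wS[of n], of m] wSle[of n]] by simp
    qed
    then have "pi / 2 * (sine_coeff w m - c m)^2 \<le> pi / 2 * 0"
      by (intro tendsto_lowerbound[OF tendsto_mult[OF tendsto_const \<tau>_lim]])
        (auto simp: eventually_sequentially intro!: exI[of _ "Suc m"])
    then have "(sine_coeff w m - c m)^2 \<le> 0" using pi_gt_zero
      by (metis mult_zero_right mult_le_cancel_left_pos pi_half_gt_zero)
    then show ?thesis by simp
  qed
  have "(LINT x|HP. (w x)^2) \<le> pi / 2 * (\<Sum>m. (c m)^2)"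
    using wSle[of 0] by (simp add: S_def \<tau>_def)
  moreover have "pi / 2 * (\<Sum>m. (c m)^2) \<le> (LINT x|HP. (w x)^2)"
    using bessel_inequality(2)[OF w] by (simp add: coeff)
  ultimately have norm: "(LINT x|HP. (w x)^2) = pi / 2 * (\<Sum>m. (c m)^2)" by simp
  have odd: "w (- x) = - w x" for x
  proof -
    have Sodd: "S n (- x) = - S n x" for n unfolding S_def by (simp add: sum_negf)
    have conv: "convergent (\<lambda>i. - S (r i) x) \<longleftrightarrow> convergent (\<lambda>i. S (r i) x)"
      by (rule convergent_minus_iff[symmetric])
    show ?thesis
    proof (cases "convergent (\<lambda>i. S (r i) x)")
      case True
      then have "(\<lambda>i. - S (r i) x) \<longlonglongrightarrow> - lim (\<lambda>i. S (r i) x)"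
        by (intro tendsto_minus) (simp add: convergent_LIMSEQ_iff)
      then show ?thesis using True conv unfolding w_def Sodd by (simp add: limI)
    qed (use conv in \<open>simp add: w_def Sodd\<close>)
  qed
  have "S n (x + 2 * pi) = S n x" for n x
  proof -
    have "sin (real k * (x + 2 * pi)) = sin (real k * x)" for k
      using sin.plus_of_nat[of "real k * x" k] by (simp add: algebra_simps)
    then show ?thesis unfolding S_def by simp
  qed
  then have per: "w (x + 2 * pi) = w x" for x unfolding w_def by simp
  show ?thesis by (rule that[OF w coeff norm odd per])
qed

text \<open>Completeness turns Bessel's inequality into an equality: the Riesz-Fischer function with
  the coefficients of \<open>g\<close> has the required norm and agrees with \<open>g\<close> almost
  everywhere.\<close>

lemma parseval_norm:
  assumes g: "sq_int g"
  shows "(LINT x|HP. (g x)^2) = pi / 2 * (\<Sum>m. (sine_coeff g m)^2)"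
proof -
  obtain w where w: "sq_int w" "\<And>m. sine_coeff w m = sine_coeff g m"
    "(LINT x|HP. (w x)^2) = pi / 2 * (\<Sum>m. (sine_coeff g m)^2)"
    using riesz_fischer[OF bessel_inequality(1)[OF g]] by (metis sine_coeff_0)
  have "AE x in HP. w x = g x"
    by (intro sine_coeff_eq_imp_AE_eq sq_int_integrable w g)
  then have "(LINT x|HP. (w x)^2) = (LINT x|HP. (g x)^2)"
    using sq_int_measurable[OF g] sq_int_measurable[OF w(1)] by (intro integral_cong_AE) auto
  then show ?thesis using w(3) by simp
qed

lemma parseval:
  assumes g: "sq_int g" and h: "sq_int h"
  shows "(\<lambda>m. sine_coeff g m * sine_coeff h m) sums (2 / pi * (LINT x|HP. g x * h x))"
proof -
  have sums: "(\<lambda>m. (sine_coeff f m)^2) sums (2 / pi * (LINT x|HP. (f x)^2))" if "sq_int f" for f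
    unfolding parseval_norm[OF that] using summable_sums[OF bessel_inequality(1)[OF that]] by simp
  have "(\<lambda>m. ((sine_coeff (\<lambda>x. g x + h x) m)^2 - (sine_coeff (\<lambda>x. g x - h x) m)^2) / 4) sums
     ((2 / pi * (LINT x|HP. (g x + h x)^2) - 2 / pi * (LINT x|HP. (g x - h x)^2)) / 4)"
    by (intro sums_divide sums_diff sums sq_int_add sq_int_diff g h)
  moreover have "((sine_coeff (\<lambda>x. g x + h x) m)^2 - (sine_coeff (\<lambda>x. g x - h x) m)^2) / 4 =
     sine_coeff g m * sine_coeff h m" for m
    unfolding sine_coeff_add[OF g[THEN sq_int_integrable] h[THEN sq_int_integrable]]
      sine_coeff_diff[OF g[THEN sq_int_integrable] h[THEN sq_int_integrable]]
    by (simp add: power2_eq_square algebra_simps)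
  moreover have "(2 / pi * (LINT x|HP. (g x + h x)^2) - 2 / pi * (LINT x|HP. (g x - h x)^2)) / 4 =
      2 / pi * (LINT x|HP. g x * h x)"
  proof -
   have "(LINT x|HP. (g x + h x)^2) - (LINT x|HP. (g x - h x)^2) = 4 * (LINT x|HP. g x * h x)"
  proof -
    have "(LINT x|HP. (g x + h x)^2) - (LINT x|HP. (g x - h x)^2) = (LINT x|HP. (g x + h x)^2 - (g x - h x)^2)"
      using sq_int_integrable_sq[OF sq_int_add[OF g h]] sq_int_integrable_sq[OF sq_int_diff[OF g h]] by simp
    also have "\<dots> = (LINT x|HP. 4 * (g x * h x))"
      by (simp add: power2_eq_square algebra_simps)
    finally show ?thesis by simp
  qed
   then show ?thesis unfolding right_diff_distrib[symmetric] by simp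
  qed
  ultimately show ?thesis by simp
qed

text \<open>Absolute summability of \<open>a\<close> allows a \<open>g\<close> that is merely
  integrable; thus \<open>W\<close> in \<open>L^1\<close> can be paired with a resolvent
  series.\<close>

lemma integral_series:
  fixes a :: "nat \<Rightarrow> real" and h :: "nat \<Rightarrow> real \<Rightarrow> real"
  assumes a: "summable (\<lambda>m. \<bar>a m\<bar>)" and g: "integrable HP g"
    and h [measurable]: "\<And>m. h m \<in> borel_measurable borel" and h1: "\<And>m x. \<bar>h m x\<bar> \<le> 1"
  shows "(\<lambda>m. a m * (LINT x|HP. g x * h m x)) sums (LINT x|HP. g x * (\<Sum>m. a m * h m x))"
proof -
  have gh: "integrable HP (\<lambda>x. g x * h m x)" for m
    by (rule integrable_HP_bounded_mult[OF g h, of _ 1]) (use h1 in auto)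
  have ah: "summable (\<lambda>m. \<bar>a m * h m x\<bar>)" for x
    by (rule summable_comparison_test'[OF a, of 0])
      (use h1 in \<open>auto simp: abs_mult intro!: mult_left_le\<close>)
  have "(\<lambda>m. LINT x|HP. g x * (a m * h m x)) sums (LINT x|HP. (\<Sum>m. g x * (a m * h m x)))"
  proof (rule sums_integral)
    show int: "integrable HP (\<lambda>x. g x * (a m * h m x))" for m
      using gh[of m] by (simp add: mult.left_commute)
    show "AE x in HP. summable (\<lambda>m. norm (g x * (a m * h m x)))"
      by (rule AE_I2) (use ah in \<open>auto simp: abs_mult intro!: summable_mult\<close>)
    show "summable (\<lambda>m. LINT x|HP. norm (g x * (a m * h m x)))"
    proof (rule summable_comparison_test'[OF summable_mult2[OF a, of "LINT x|HP. \<bar>g x\<bar>"], of 0])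
      fix m
      have "(LINT x|HP. norm (g x * (a m * h m x))) \<le> (LINT x|HP. \<bar>a m\<bar> * \<bar>g x\<bar>)"
      proof (rule integral_mono)
        show "integrable HP (\<lambda>x. norm (g x * (a m * h m x)))"
          by (rule integrable_norm[OF int])
        show "norm (g x * (a m * h m x)) \<le> \<bar>a m\<bar> * \<bar>g x\<bar>" for x
          using mult_left_mono[OF h1[of m x], of "\<bar>a m\<bar> * \<bar>g x\<bar>"] by (simp add: abs_mult mult_ac)
      qed (use g in simp)
      then show "norm (LINT x|HP. norm (g x * (a m * h m x))) \<le> \<bar>a m\<bar> * (LINT x|HP. \<bar>g x\<bar>)"
        by simp
    qed
  qed
  moreover have "(\<Sum>m. g x * (a m * h m x)) = g x * (\<Sum>m. a m * h m x)" for x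
    using summable_rabs_cancel[OF ah] by (rule suminf_mult)
  moreover have "(LINT x|HP. g x * (a m * h m x)) = a m * (LINT x|HP. g x * h m x)" for m
    by (simp add: mult.left_commute)
  ultimately show ?thesis by simp
qed

section \<open>Abel means and the Poisson kernel\<close>

lemma cos_power_series:
  assumes r: "0 \<le> r" "r < 1"
  shows "(\<lambda>m. r ^ m * cos (real m * t)) sums
    (1 / 2 + (1 - r^2) / (2 * (1 - 2 * r * cos t + r^2)))"
proof -
  define z where "z = of_real r * cis t"
  have "norm z < 1" using r by (simp add: z_def norm_mult)
  from sums_Re[OF geometric_sums[OF this]]
  have "(\<lambda>m. Re (z ^ m)) sums Re (1 / (1 - z))" .
  moreover have "Re (z ^ m) = r ^ m * cos (real m * t)" for m
  proof -
    have "z ^ m = of_real (r ^ m) * cis (real m * t)"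
      unfolding z_def power_mult_distrib Complex.DeMoivre of_real_power by (rule refl)
    then show ?thesis by simp
  qed
  moreover have "Re (1 / (1 - z)) = 1 / 2 + (1 - r^2) / (2 * (1 - 2 * r * cos t + r^2))"
  proof -
    have D: "(1 - r * cos t)^2 + (r * sin t)^2 = 1 - 2 * r * cos t + r^2"
      by (simp add: power2_diff power_mult_distrib sin_squared_eq algebra_simps)
    have "r * cos t < 1" using r by (smt (verit) cos_le_one mult_left_le)
    then have "(1 - r * cos t)^2 > 0" by simp
    then have "1 - 2 * r * cos t + r^2 > 0" unfolding D[symmetric] by (smt (verit) zero_le_power2)
    moreover have "Re (1 / (1 - z)) = (1 - r * cos t) / (1 - 2 * r * cos t + r^2)"
      unfolding D[symmetric] by (simp add: z_def Re_divide)
    ultimately show ?thesis by (simp add: field_simps)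
  qed
  ultimately show ?thesis by simp
qed

text \<open>The Abel mean is \<open>1 / pi\<close> times the integral of \<open>g\<close> against
  \<open>K y = Q (x - y) - Q (x + y)\<close>, with \<open>Q\<close> half the Poisson kernel. On
  \<open>[0, pi]\<close> this odd reflection is nonnegative since
  \<open>cos (x + y) \<le> cos (x - y)\<close>, and its mass is at most that of the even reflection,
  which is \<open>pi\<close>.\<close>

lemma poisson_lower_bound:
  assumes g: "integrable HP g" and \<kappa>: "\<kappa> \<ge> 0" and lb: "AE x in HP. - \<kappa> \<le> g x"
    and r: "0 \<le> r" "r < 1" and x: "x \<in> {0..pi}"
  shows "- \<kappa> \<le> (\<Sum>m. r ^ m * sine_coeff g m * sin (real m * x))"
proof -
  define Q where "Q t = (1 - r^2) / (2 * (1 - 2 * r * cos t + r^2))" for t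
  have Dpos: "1 - 2 * r * cos t + r^2 > 0" for t
  proof -
    have "r * cos t \<le> r" using r by (simp add: mult_left_le)
    moreover have "0 < (1 - r)^2" using r by simp
    ultimately show ?thesis by (simp add: power2_diff)
  qed
  have Qm [measurable]: "Q \<in> borel_measurable borel" unfolding Q_def by measurable
  have r2: "r^2 \<le> 1" using r by (simp add: power_le_one)
  have Q0: "Q t \<ge> 0" for t using Dpos[of t] r2 unfolding Q_def by simp
  define K where "K y = Q (x - y) - Q (x + y)" for y
  have Km [measurable]: "K \<in> borel_measurable borel" unfolding K_def by measurable
  have C: "(\<lambda>m. r ^ m * cos (real m * t)) sums (1 / 2 + Q t)" for t
    unfolding Q_def by (rule cos_power_series[OF r])
  have Ksum: "(\<lambda>m. 2 * (r ^ m * sin (real m * x) * sin (real m * y))) sums K y" for y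
    using sums_diff[OF C[of "x - y"] C[of "x + y"]]
    by (simp add: K_def right_diff_distrib distrib_left cos_diff cos_add mult_ac)
  have K0: "K y \<ge> 0" if "y \<in> {0..pi}" for y
  proof -
    have "cos (x + y) \<le> cos (x - y)"
      using sin_ge_zero[of x] sin_ge_zero[of y] x that by (simp add: cos_add cos_diff)
    then have "r * cos (x + y) \<le> r * cos (x - y)" using r by (intro mult_left_mono)
    then show ?thesis unfolding K_def Q_def using Dpos[of "x - y"] Dpos[of "x + y"] r2
      by (simp add: divide_left_mono)
  qed
  have Kle: "K y \<le> Q (x - y) + Q (x + y)" for y unfolding K_def using Q0[of "x + y"] by simp
  define B where "B = (1 - r^2) / (2 * (1 - r)^2)"
  have QB: "Q t \<le> B" for t
  proof -
    have "r * cos t \<le> r" using r by (simp add: mult_left_le)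
    then have "(1 - r)^2 \<le> 1 - 2 * r * cos t + r^2" by (simp add: power2_diff)
    moreover have "0 < (1 - r)^2" using r by simp
    ultimately show ?thesis unfolding B_def Q_def using r2 Dpos[of t]
      by (intro divide_left_mono) auto
  qed
  have intQ: "integrable HP (\<lambda>y. Q (x - y) + Q (x + y))"
  proof (rule integrable_HP_bounded[of _ "B + B"])
    show "\<bar>Q (x - y) + Q (x + y)\<bar> \<le> B + B" for y
      using QB[of "x - y"] QB[of "x + y"] Q0[of "x - y"] Q0[of "x + y"] by linarith
  qed measurable
  have Kb: "\<bar>K y\<bar> \<le> B" for y
    unfolding K_def using QB[of "x - y"] QB[of "x + y"] Q0[of "x - y"] Q0[of "x + y"] by linarith
  have intK: "integrable HP K" by (rule integrable_HP_bounded[of _ B]) (use Kb in auto)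
  have r_sum: "summable (\<lambda>m. \<bar>r ^ m * a m\<bar>)" if "\<And>m. \<bar>a m\<bar> \<le> 1" for a :: "nat \<Rightarrow> real"
    by (rule summable_comparison_test'[OF summable_geometric[of r], of 0])
      (use r that in \<open>auto simp: abs_mult power_abs intro!: mult_left_le\<close>)
  have "(LINT y|HP. Q (x - y) + Q (x + y)) = pi"
  proof -
    \<comment> \<open>After integration only mode \<open>0\<close> of the cosine expansion survives;
      the summand \<open>1\<close> collects the two constants \<open>1/2\<close> of the series for
      \<open>x - y\<close> and \<open>x + y\<close>.\<close>
    have eq: "1 + (Q (x - y) + Q (x + y)) = 2 * (\<Sum>m. (r ^ m * cos (real m * x)) * cos (real m * y))" for y
    proof -
      have "(\<lambda>m. 2 * ((r ^ m * cos (real m * x)) * cos (real m * y))) sums (1 + (Q (x - y) + Q (x + y)))"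
        using sums_add[OF C[of "x - y"] C[of "x + y"]]
        by (simp add: right_diff_distrib distrib_left cos_diff cos_add mult_ac add_ac)
      from sums_unique[OF this] sums_summable[OF this] show ?thesis
        by (simp add: suminf_mult summable_mult_D)
    qed
    have "(\<lambda>m. (r ^ m * cos (real m * x)) * (LINT y|HP. 1 * cos (real m * y))) sums
        (LINT y|HP. 1 * (\<Sum>m. (r ^ m * cos (real m * x)) * cos (real m * y)))"
      by (rule integral_series) (auto intro!: r_sum)
    moreover have "(r ^ m * cos (real m * x)) * (LINT y|HP. 1 * cos (real m * y)) = (if m = 0 then pi else 0)" for m
      using integral_cos_HP[of "int m"] by simp
    ultimately have "(\<lambda>m. if m = 0 then pi else 0) sums (LINT y|HP. (\<Sum>m. (r ^ m * cos (real m * x)) * cos (real m * y)))"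
      by simp
    moreover have "(\<lambda>m. if m = (0::nat) then pi else 0) sums pi" by (rule sums_single)
    ultimately have "(LINT y|HP. (\<Sum>m. (r ^ m * cos (real m * x)) * cos (real m * y))) = pi"
      by (rule sums_unique2)
    then have "(LINT y|HP. 1 + (Q (x - y) + Q (x + y))) = 2 * pi" unfolding eq by simp
    then show ?thesis using intQ by (subst (asm) Bochner_Integration.integral_add) auto
  qed
  then have intKle: "(LINT y|HP. K y) \<le> pi"
    using integral_mono[OF intK intQ Kle] by simp
  have "(\<lambda>m. (r ^ m * sin (real m * x)) * (LINT y|HP. g y * sin (real m * y))) sums
      (LINT y|HP. g y * (\<Sum>m. (r ^ m * sin (real m * x)) * sin (real m * y)))"
    by (rule integral_series[OF _ g]) (auto intro!: r_sum)
  moreover have "(\<Sum>m. (r ^ m * sin (real m * x)) * sin (real m * y)) = K y / 2" for y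
    using sums_unique[OF sums_divide[OF Ksum[of y], of 2]] by simp
  ultimately have "(\<lambda>m. (r ^ m * sin (real m * x)) * (LINT y|HP. g y * sin (real m * y))) sums
      ((LINT y|HP. g y * K y) / 2)" by simp
  from sums_mult[OF this, of "2 / pi"]
  have "(\<lambda>m. r ^ m * sine_coeff g m * sin (real m * x)) sums ((LINT y|HP. g y * K y) / pi)"
    by (simp add: sine_coeff_def mult_ac)
  then have "(\<Sum>m. r ^ m * sine_coeff g m * sin (real m * x)) = (LINT y|HP. g y * K y) / pi"
    by (rule sums_unique[symmetric])
  moreover have "- \<kappa> * pi \<le> (LINT y|HP. g y * K y)"
  proof -
    have "- \<kappa> * pi \<le> - \<kappa> * (LINT y|HP. K y)" using \<kappa> intKle by (simp add: mult_left_mono)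
    also have "\<dots> = (LINT y|HP. - \<kappa> * K y)" by simp
    also have "\<dots> \<le> (LINT y|HP. g y * K y)"
    proof (rule integral_mono_AE)
      show "integrable HP (\<lambda>y. g y * K y)"
        by (rule integrable_HP_bounded_mult[OF g, of _ B]) (use Kb in auto)
      have "AE y in HP. K y \<ge> 0" by (rule AE_HP_I[OF K0])
      with lb show "AE y in HP. - \<kappa> * K y \<le> g y * K y"
        by eventually_elim (rule mult_right_mono)
    qed (use intK in simp)
    finally show ?thesis .
  qed
  then have "(- \<kappa> * pi) / pi \<le> (LINT y|HP. g y * K y) / pi" by (intro divide_right_mono) auto
  ultimately show ?thesis by simp
qed

section \<open>The resolvent of the fractional Laplacian\<close>

text \<open>\<open>1 / 4 < s\<close> makes the squared resolvent multipliers summable;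
  \<open>s \<le> 1\<close> is what the binomial argument for the minimum principle requires.\<close>

locale fractional_exponent =
  fixes s :: real
  assumes s_gt: "1 / 4 < s" and s_le: "s \<le> 1"
begin

definition lam :: "nat \<Rightarrow> real" where
  "lam m = real m powr (2 * s)"

text \<open>Given by its sine series and not as an \<open>L^2\<close> class: for square-integrable
  \<open>g\<close> and \<open>M > 0\<close> the series converges absolutely and yields a function
  that is continuous, odd and periodic at every point.\<close>

definition resolvent :: "real \<Rightarrow> (real \<Rightarrow> real) \<Rightarrow> real \<Rightarrow> real" where
  "resolvent M g x = (\<Sum>m. sine_coeff g m / (lam m + M) * sin (real m * x))"

lemma lam_nonneg [simp]: "lam m \<ge> 0"
  by (simp add: lam_def)

lemma lam_0 [simp]: "lam 0 = 0" and lam_1 [simp]: "lam (Suc 0) = 1"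
  by (simp_all add: lam_def)

lemma lam_ge_1: "m \<ge> 1 \<Longrightarrow> lam m \<ge> 1"
  unfolding lam_def using s_gt by (intro ge_one_powr_ge_zero) auto

lemma lam_gt_1: "m \<ge> 2 \<Longrightarrow> lam m > 1"
  unfolding lam_def using s_gt powr_less_mono2[of "2 * s" 1 "real m"] by simp

lemma lam_M_pos: "M > 0 \<Longrightarrow> lam m + M > 0"
  using lam_nonneg[of m] by linarith

lemma multiplier_summable:
  assumes M: "M > 0"
  shows "summable (\<lambda>m. (1 / (lam m + M))^2)"
proof (rule summable_comparison_test'[of "\<lambda>m. real m powr (- (4 * s))" 1])
  show "summable (\<lambda>m. real m powr (- (4 * s)))"
    using s_gt by (subst summable_real_powr_iff) simp
  fix m :: nat assume m: "m \<ge> 1"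
  have "(1 / (lam m + M))^2 \<le> (1 / lam m)^2"
    using lam_ge_1[OF m] M by (intro power_mono divide_left_mono) auto
  also have "(lam m)^2 = real m powr (4 * s)"
    unfolding lam_def power2_eq_square powr_add[symmetric] by simp
  then have "(1 / lam m)^2 = real m powr (- (4 * s))"
    by (simp add: power_divide powr_minus_divide)
  finally show "norm ((1 / (lam m + M))^2) \<le> real m powr (- (4 * s))" by simp
qed

lemma multiplier_coeff_summable:
  assumes c: "summable (\<lambda>m. (c m)^2)" and M: "M > 0"
  shows "summable (\<lambda>m. \<bar>c m / (lam m + M)\<bar>)"
proof (rule summable_comparison_test'[OF summable_add[OF c multiplier_summable[OF M]], of 0])
  fix m
  have "2 * (\<bar>c m\<bar> * (1 / (lam m + M))) \<le> (c m)^2 + (1 / (lam m + M))^2"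
    using sum_squares_bound[of "\<bar>c m\<bar>" "1 / (lam m + M)"] by (simp add: mult.assoc)
  moreover have "\<bar>c m / (lam m + M)\<bar> = \<bar>c m\<bar> * (1 / (lam m + M))" using lam_M_pos[OF M, of m] by simp
  moreover have "0 \<le> \<bar>c m\<bar> * (1 / (lam m + M))" using lam_M_pos[OF M, of m] by simp
  ultimately have "\<bar>c m / (lam m + M)\<bar> \<le> (c m)^2 + (1 / (lam m + M))^2" by linarith
  then show "norm \<bar>c m / (lam m + M)\<bar> \<le> (c m)^2 + (1 / (lam m + M))^2"
    unfolding real_norm_def abs_abs .
qed

lemmas resolvent_coeff_summable = multiplier_coeff_summable[OF bessel_inequality(1)]

lemma abs_mult_sin_le: "\<bar>a * sin y\<bar> \<le> \<bar>a :: real\<bar>"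
  by (simp add: abs_mult mult_left_le)

lemma summable_mult_sin:
  fixes a :: "nat \<Rightarrow> real"
  assumes "summable (\<lambda>m. \<bar>a m\<bar>)"
  shows "summable (\<lambda>m. \<bar>a m * sin (real m * x)\<bar>)" "summable (\<lambda>m. a m * sin (real m * x))"
proof -
  show "summable (\<lambda>m. \<bar>a m * sin (real m * x)\<bar>)"
    by (rule summable_comparison_test'[OF assms, of 0]) (auto simp: abs_mult intro!: mult_left_le)
  then show "summable (\<lambda>m. a m * sin (real m * x))" by (rule summable_rabs_cancel)
qed

lemma resolvent_summable:
  assumes "sq_int g" "M > 0"
  shows "summable (\<lambda>m. sine_coeff g m / (lam m + M) * sin (real m * x))"
  by (rule summable_mult_sin(2)[OF resolvent_coeff_summable[OF assms]])

lemma sine_series_continuous: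
  assumes "summable (\<lambda>m. \<bar>a m\<bar>)"
  shows "continuous_on UNIV (\<lambda>x. \<Sum>m. a m * sin (real m * x))"
proof (rule uniform_limit_theorem)
  show "uniform_limit UNIV (\<lambda>n x. \<Sum>m<n. a m * sin (real m * x)) (\<lambda>x. \<Sum>m. a m * sin (real m * x)) sequentially"
    by (rule Weierstrass_m_test[OF _ assms]) (auto simp: abs_mult intro!: mult_left_le)
qed (auto intro!: always_eventually continuous_intros)

lemma resolvent_continuous:
  assumes "sq_int g" "M > 0"
  shows "continuous_on UNIV (resolvent M g)"
  using sine_series_continuous[OF resolvent_coeff_summable[OF assms]] unfolding resolvent_def .

lemma resolvent_bounded:
  assumes "sq_int g" "M > 0"
  shows "\<bar>resolvent M g x\<bar> \<le> (\<Sum>m. \<bar>sine_coeff g m / (lam m + M)\<bar>)"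
proof -
  note s = resolvent_coeff_summable[OF assms]
  have "\<bar>resolvent M g x\<bar> \<le> (\<Sum>m. \<bar>sine_coeff g m / (lam m + M) * sin (real m * x)\<bar>)"
    unfolding resolvent_def by (rule summable_rabs[OF summable_mult_sin(1)[OF s]])
  also have "\<dots> \<le> (\<Sum>m. \<bar>sine_coeff g m / (lam m + M)\<bar>)"
    by (rule suminf_le[OF abs_mult_sin_le summable_mult_sin(1)[OF s] s])
  finally show ?thesis .
qed

lemma resolvent_sq_int:
  assumes "sq_int g" "M > 0"
  shows "sq_int (resolvent M g)"
  by (rule sq_int_bounded[OF borel_measurable_continuous_onI[OF resolvent_continuous[OF assms]]])
    (rule resolvent_bounded[OF assms])

lemma resolvent_odd: "sq_int g \<Longrightarrow> M > 0 \<Longrightarrow> resolvent M g (- x) = - resolvent M g x"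
  unfolding resolvent_def using suminf_minus[OF resolvent_summable, of g M x] by simp

lemma sin_nat_periodic: "sin (real k * (x + 2 * pi)) = sin (real k * x)"
  using sin.plus_of_nat[of "real k * x" k] by (simp add: algebra_simps)

lemma resolvent_periodic: "resolvent M g (x + 2 * pi) = resolvent M g x"
  unfolding resolvent_def sin_nat_periodic ..

lemma sine_coeff_sine_series:
  assumes "summable (\<lambda>m. \<bar>a m\<bar>)"
  shows "sine_coeff (\<lambda>x. \<Sum>m. a m * sin (real m * x)) k = (if k = 0 then 0 else a k)"
proof -
  have "(\<lambda>m. a m * (LINT x|HP. sin (real k * x) * sin (real m * x))) sums
      (LINT x|HP. sin (real k * x) * (\<Sum>m. a m * sin (real m * x)))"
    by (rule integral_series[OF assms sq_int_integrable[OF sq_int_sin]]) auto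
  moreover have "a m * (LINT x|HP. sin (real k * x) * sin (real m * x)) =
      (if m = k then (if k = 0 then 0 else a k * (pi / 2)) else 0)" for m
    by (auto simp: integral_sin_sin_HP)
  ultimately have "(\<lambda>m. if m = k then (if k = 0 then 0 else a k * (pi / 2)) else 0) sums
      (LINT x|HP. sin (real k * x) * (\<Sum>m. a m * sin (real m * x)))" by simp
  from sums_unique2[OF this sums_single[of k "\<lambda>_. if k = 0 then 0 else a k * (pi / 2)"]]
  show ?thesis unfolding sine_coeff_def by (simp add: mult.commute)
qed

lemma sine_coeff_resolvent:
  assumes "sq_int g" "M > 0"
  shows "sine_coeff (resolvent M g) m = sine_coeff g m / (lam m + M)"
  using sine_coeff_sine_series[OF resolvent_coeff_summable[OF assms], of m] unfolding resolvent_def by auto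

lemma resolvent_add:
  assumes "sq_int f" "sq_int g" "M > 0"
  shows "resolvent M (\<lambda>x. f x + g x) x = resolvent M f x + resolvent M g x"
  unfolding resolvent_def
  by (subst suminf_add[OF resolvent_summable resolvent_summable])
    (use assms in \<open>auto simp: sine_coeff_add sq_int_integrable algebra_simps add_divide_distrib\<close>)

lemma resolvent_diff:
  assumes "sq_int f" "sq_int g" "M > 0"
  shows "resolvent M (\<lambda>x. f x - g x) x = resolvent M f x - resolvent M g x"
  unfolding resolvent_def
  by (subst suminf_diff[OF resolvent_summable resolvent_summable])
    (use assms in \<open>auto simp: sine_coeff_diff sq_int_integrable algebra_simps diff_divide_distrib\<close>)

lemma resolvent_cmult:
  assumes "sq_int g" "M > 0"
  shows "resolvent M (\<lambda>x. c * g x) x = c * resolvent M g x"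
  unfolding resolvent_def suminf_mult[OF resolvent_summable[OF assms], symmetric] by (simp add: sine_coeff_cmult mult_ac)

lemma resolvent_cong_coeff:
  assumes "\<And>m. sine_coeff f m = sine_coeff g m"
  shows "resolvent M f = resolvent M g"
  unfolding resolvent_def assms ..

text \<open>Truncating the sine series of \<open>g\<close> could destroy the lower bound, whereas
  its Abel means keep it by the Poisson kernel. Their coefficients decay geometrically, so a
  truncation costs only \<open>e\<close> uniformly in the point, and the minimum principle for sine
  polynomials applies with \<open>\<kappa> + e\<close>; then \<open>e\<close> tends to
  \<open>0\<close> and \<open>r\<close> to \<open>1\<close>.\<close>

lemma resolvent_lower_bound:
  assumes g: "sq_int g" and M: "M > 0" and \<kappa>: "\<kappa> \<ge> 0" and lb: "AE x in HP. - \<kappa> \<le> g x"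
    and x: "x \<in> {0..pi}"
  shows "- (\<kappa> / M) \<le> resolvent M g x"
proof -
  define b where "b m = sine_coeff g m" for m
  have bs: "summable (\<lambda>m. \<bar>b m / (lam m + M)\<bar>)" unfolding b_def by (rule resolvent_coeff_summable[OF g M])
  define B where "B = 2 / pi * (LINT x|HP. \<bar>g x\<bar>)"
  have bB: "\<bar>b m\<bar> \<le> B" for m
  proof -
    have "\<bar>LINT x|HP. g x * sin (real m * x)\<bar> \<le> (LINT x|HP. \<bar>g x * sin (real m * x)\<bar>)"
      by (rule integral_abs_bound)
    also have "\<dots> \<le> (LINT x|HP. \<bar>g x\<bar>)"
      using sq_int_integrable[OF g]
      by (intro integral_mono integrable_abs integrable_mult_sin) (auto simp: abs_mult intro!: mult_left_le)
    finally show ?thesis unfolding b_def sine_coeff_def B_def by (simp add: abs_mult divide_right_mono)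
  qed
  have r_bound: "- (\<kappa> / M) \<le> (\<Sum>m. r ^ m * (b m / (lam m + M) * sin (real m * x)))"
    if r: "0 \<le> r" "r < 1" for r
  proof -
    have rb: "summable (\<lambda>m. \<bar>r ^ m * b m\<bar>)"
      by (rule summable_comparison_test'[OF summable_mult2[OF summable_geometric[of r], of B], of 0])
        (use r bB in \<open>auto simp: abs_mult power_abs intro!: mult_left_mono\<close>)
    have rs: "summable (\<lambda>m. r ^ m * (b m / (lam m + M) * sin (real m * x)))"
    proof (rule summable_rabs_cancel, rule summable_comparison_test'[OF bs, of 0])
      fix m
      have "\<bar>r ^ m\<bar> \<le> 1" using r by (simp add: power_abs power_le_one)
      then have "\<bar>r ^ m\<bar> * (\<bar>b m / (lam m + M)\<bar> * \<bar>sin (real m * x)\<bar>) \<le> 1 * (\<bar>b m / (lam m + M)\<bar> * 1)"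
        by (intro mult_mono) auto
      then show "norm \<bar>r ^ m * (b m / (lam m + M) * sin (real m * x))\<bar> \<le> \<bar>b m / (lam m + M)\<bar>"
        by (simp only: abs_mult real_norm_def abs_abs)
    qed
    have eps: "- ((\<kappa> + e) / M) \<le> (\<Sum>m. r ^ m * (b m / (lam m + M) * sin (real m * x)))" if e: "e > 0" for e
    proof -
      \<comment> \<open>The tail is bounded without its sine factors, hence for all points at
        once.\<close>
      from suminf_exist_split[OF e, of "\<lambda>m. \<bar>r ^ m * b m\<bar>"] rb obtain N0 where
        N0: "\<And>n. n \<ge> N0 \<Longrightarrow> norm (\<Sum>i. \<bar>r ^ (i + n) * b (i + n)\<bar>) < e" by auto
      have part: "- ((\<kappa> + e) / M) \<le> (\<Sum>m<N. r ^ m * (b m / (lam m + M) * sin (real m * x)))" if N: "N \<ge> N0" for N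
      proof -
        have "- ((\<kappa> + e) / M) \<le> (\<Sum>m<N. (r ^ m * (b m / (lam m + M))) * sin (real m * x))"
        proof (rule fractional_min_principle[OF _ s_le M _ _ x])
          fix y :: real assume y: "y \<in> {0..pi}"
          have sy: "summable (\<lambda>m. r ^ m * b m * sin (real m * y))" "summable (\<lambda>m. \<bar>r ^ m * b m * sin (real m * y)\<bar>)"
            using summable_mult_sin[OF rb] by auto
          have "- \<kappa> \<le> (\<Sum>m. r ^ m * b m * sin (real m * y))"
            unfolding b_def by (rule poisson_lower_bound[OF sq_int_integrable[OF g] \<kappa> lb r y])
          also have "\<dots> = (\<Sum>m. r ^ (m + N) * b (m + N) * sin (real (m + N) * y)) + (\<Sum>m<N. r ^ m * b m * sin (real m * y))"
            by (rule suminf_split_initial_segment[OF sy(1)])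
          also have "(\<Sum>m. r ^ (m + N) * b (m + N) * sin (real (m + N) * y)) \<le> (\<Sum>m. \<bar>r ^ (m + N) * b (m + N)\<bar>)"
          proof (rule suminf_le)
            fix m show "r ^ (m + N) * b (m + N) * sin (real (m + N) * y) \<le> \<bar>r ^ (m + N) * b (m + N)\<bar>"
              by (rule order_trans[OF abs_ge_self]) (auto simp: abs_mult intro!: mult_left_le)
          qed (use summable_ignore_initial_segment[OF sy(1), of N] summable_ignore_initial_segment[OF rb, of N] in auto)
          also have "\<dots> \<le> e" using N0[OF N] by simp
          finally have "- (\<kappa> + e) \<le> (\<Sum>m<N. r ^ m * b m * sin (real m * y))" by simp
          also have "\<dots> = (\<Sum>m<N. (real m powr (2 * s) + M) * (r ^ m * (b m / (lam m + M))) * sin (real m * y))"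
          proof (intro sum.cong refl)
            fix m
            have "lam m + M \<noteq> 0" using lam_M_pos[OF M, of m] by simp
            then show "r ^ m * b m * sin (real m * y) =
                (real m powr (2 * s) + M) * (r ^ m * (b m / (lam m + M))) * sin (real m * y)"
              unfolding lam_def[symmetric] by simp
          qed
          finally show "- (\<kappa> + e) \<le> (\<Sum>m<N. (real m powr (2 * s) + M) * (r ^ m * (b m / (lam m + M))) * sin (real m * y))" .
        qed (use s_gt \<kappa> e in auto)
        then show ?thesis by (simp add: mult.assoc)
      qed
      show ?thesis
        by (rule LIMSEQ_le_const[OF summable_LIMSEQ[OF rs]]) (use part in auto)
    qed
    show ?thesis
    proof (rule field_le_epsilon)
      fix e :: real assume "e > 0"
      then show "- (\<kappa> / M) \<le> (\<Sum>m. r ^ m * (b m / (lam m + M) * sin (real m * x))) + e"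
        using eps[of "e * M"] M by (simp add: add_divide_distrib)
    qed
  qed
  define r where "r n = real n / real (Suc n)" for n
  have r: "0 \<le> r n" "r n < 1" for n unfolding r_def by auto
  have r1: "r \<longlonglongrightarrow> 1" unfolding r_def by (rule LIMSEQ_n_over_Suc_n)
  \<comment> \<open>Tannery's theorem: the resolvent coefficients are absolutely summable and
    dominate for every \<open>r n\<close>.\<close>
  have "(\<lambda>n. \<Sum>m. r n ^ m * (b m / (lam m + M) * sin (real m * x))) \<longlonglongrightarrow>
      (\<Sum>m. b m / (lam m + M) * sin (real m * x))"
  proof (rule tannerys_theorem[THEN conjunct2, THEN conjunct2, OF _ _ bs])
    show "(\<lambda>n. r n ^ m * (b m / (lam m + M) * sin (real m * x))) \<longlonglongrightarrow> b m / (lam m + M) * sin (real m * x)" for m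
      using tendsto_mult[OF tendsto_power[OF r1, of m] tendsto_const[of "b m / (lam m + M) * sin (real m * x)"]]
      by simp
    show "\<forall>\<^sub>F (m, n) in sequentially \<times>\<^sub>F sequentially.
       norm (r n ^ m * (b m / (lam m + M) * sin (real m * x))) \<le> \<bar>b m / (lam m + M)\<bar>"
    proof (rule always_eventually, safe)
      fix m n
      have "\<bar>r n ^ m\<bar> \<le> 1" using r[of n] by (simp add: power_abs power_le_one)
      then have "\<bar>r n ^ m\<bar> * (\<bar>b m / (lam m + M)\<bar> * \<bar>sin (real m * x)\<bar>) \<le> 1 * (\<bar>b m / (lam m + M)\<bar> * 1)"
        by (intro mult_mono) auto
      then show "norm (r n ^ m * (b m / (lam m + M) * sin (real m * x))) \<le> \<bar>b m / (lam m + M)\<bar>"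
        by (simp only: abs_mult real_norm_def)
    qed
  qed simp
  then show ?thesis unfolding resolvent_def b_def[symmetric]
    by (rule LIMSEQ_le_const) (use r_bound[OF r] in auto)
qed

lemma resolvent_nonneg:
  assumes "sq_int g" "M > 0" "AE x in HP. 0 \<le> g x" "x \<in> {0..pi}"
  shows "0 \<le> resolvent M g x"
  using resolvent_lower_bound[of g M 0 x] assms by simp

lemma resolvent_mono:
  assumes f: "sq_int f" and g: "sq_int g" and M: "M > 0" and le: "AE x in HP. f x \<le> g x" and x: "x \<in> {0..pi}"
  shows "resolvent M f x \<le> resolvent M g x"
  using resolvent_nonneg[OF sq_int_diff[OF g f] M _ x] le by (simp add: resolvent_diff[OF g f M])

lemma resolvent_upper_bound:
  assumes g: "sq_int g" and M: "M > 0" and \<kappa>: "\<kappa> \<ge> 0" and ub: "AE x in HP. g x \<le> \<kappa>" and x: "x \<in> {0..pi}"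
  shows "resolvent M g x \<le> \<kappa> / M"
  using resolvent_lower_bound[OF sq_int_cmult[OF g, of "-1"] M \<kappa> _ x] ub resolvent_cmult[OF g M, of "-1" x] by simp

lemma resolvent_symmetric:
  assumes "sq_int f" "sq_int g" "M > 0"
  shows "(LINT x|HP. f x * resolvent M g x) = (LINT x|HP. resolvent M f x * g x)"
proof -
  have "2 / pi * (LINT x|HP. f x * resolvent M g x) = 2 / pi * (LINT x|HP. resolvent M f x * g x)"
    using parseval[OF assms(1) resolvent_sq_int[OF assms(2,3)]] parseval[OF resolvent_sq_int[OF assms(1,3)] assms(2)] assms
    by (intro sums_unique2[of "\<lambda>m. sine_coeff f m * sine_coeff g m / (lam m + M)"]) (auto simp: sine_coeff_resolvent)
  then show ?thesis by simp
qed

end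

section \<open>Reflections, a priori bound and strict positivity\<close>

lemma fold_integral:
  fixes H :: "real \<Rightarrow> 'a::{banach, second_countable_topology}"
  assumes Hm [measurable]: "H \<in> borel_measurable borel" and H: "set_integrable lborel {-pi..pi} H"
  shows "integrable HP H" "integrable HP (\<lambda>x. H (- x))"
    "(LINT x:{-pi..pi}|lborel. H x) = (LINT x|HP. H x + H (- x))"
proof -
  have p: "set_integrable lborel {0..pi} H" and n: "set_integrable lborel {-pi..0} H"
    by (auto intro: set_integrable_subset[OF H])
  show 1: "integrable HP H" unfolding integrable_HP_iff[OF Hm] by (rule p)
  have ind: "indicator {-pi..0} (0 + - 1 * x) = (indicator {0..pi} x :: real)" for x :: real
    by (auto simp: indicator_def)
  have n': "set_integrable lborel {0..pi} (\<lambda>x. H (- x))"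
    using lborel_integrable_real_affine[OF n[unfolded set_integrable_def], of "-1" 0] unfolding ind
    by (simp add: set_integrable_def)
  then show 2: "integrable HP (\<lambda>x. H (- x))" by (subst integrable_HP_iff) auto
  have neg: "(LINT x:{-pi..0}|lborel. H x) = (LINT x:{0..pi}|lborel. H (- x))"
    unfolding set_lebesgue_integral_def
    by (subst lborel_integral_real_affine[of "-1" _ 0]) (simp_all only: ind, simp)
  have "(LINT x:{-pi..pi}|lborel. H x) = (\<integral>x. indicator {-pi..0} x *\<^sub>R H x + indicator {0..pi} x *\<^sub>R H x \<partial>lborel)"
    unfolding set_lebesgue_integral_def
    by (rule integral_cong_AE) (use AE_lborel_singleton[of 0] in \<open>auto simp: indicator_def elim!: eventually_mono\<close>)
  also have "\<dots> = (LINT x:{-pi..0}|lborel. H x) + (LINT x:{0..pi}|lborel. H x)"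
    using p n unfolding set_lebesgue_integral_def set_integrable_def by simp
  also have "\<dots> = (LINT x|HP. H x + H (- x))"
    using 1 2 unfolding neg by (simp add: integral_HP_eq)
  finally show "(LINT x:{-pi..pi}|lborel. H x) = (LINT x|HP. H x + H (- x))" .
qed

lemma shift_integral:
  fixes H :: "real \<Rightarrow> real"
  assumes Hm [measurable]: "H \<in> borel_measurable borel" and B: "\<And>x. \<bar>H x\<bar> \<le> B"
    and per: "\<And>x. H (x + 2 * pi) = H x" and c: "0 \<le> c" "c \<le> 2 * pi"
  shows "(LINT x:{-pi..pi}|lborel. H (c + x)) = (LINT x:{-pi..pi}|lborel. H x)"
proof -
  have si: "set_integrable lborel A H" if "A \<in> sets borel" "A \<subseteq> {a..b}" for A and a b :: real
  proof (rule set_integrable_bound[where f = "\<lambda>_. B"])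
    have "emeasure lborel A \<le> emeasure lborel {a..b}" using that by (intro emeasure_mono) auto
    also have "\<dots> < \<infinity>" by (simp add: emeasure_lborel_Icc_eq)
    finally show "set_integrable lborel A (\<lambda>_. B)" using that unfolding set_integrable_def by simp
    show "set_borel_measurable lborel A H" using that unfolding set_borel_measurable_def by measurable
    show "AE x in lborel. x \<in> A \<longrightarrow> norm (H x) \<le> norm B" using order_trans[OF B abs_ge_self] by auto
  qed
  have ind: "(indicator {-pi..pi} (- c + 1 * x) :: real) = indicator {c - pi..c + pi} x" for x
    by (auto simp: indicator_def)
  have "(LINT x:{-pi..pi}|lborel. H (c + x)) = (LINT x:{c - pi..c + pi}|lborel. H x)"
    unfolding set_lebesgue_integral_def
    by (subst lborel_integral_real_affine[of 1 _ "- c"]) (simp_all only: ind, simp)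
  also have "{c - pi..c + pi} = {c - pi..pi} \<union> {pi<..c + pi}" using c by auto
  also have "(LINT x:{c - pi..pi} \<union> {pi<..c + pi}|lborel. H x) =
      (LINT x:{c - pi..pi}|lborel. H x) + (LINT x:{pi<..c + pi}|lborel. H x)"
    using si[of "{c - pi..pi}" "c - pi" pi] si[of "{pi<..c + pi}" pi "c + pi", OF _ greaterThanAtMost_subseteq_atLeastAtMost_iff[THEN iffD2]]
    by (intro set_integral_Un) auto
  also have "(LINT x:{pi<..c + pi}|lborel. H x) = (LINT x:{-pi<..c - pi}|lborel. H x)"
  proof -
    have ind: "(indicator {pi<..c + pi} (2 * pi + 1 * x) :: real) = indicator {-pi<..c - pi} x" for x
      by (auto simp: indicator_def)
    show ?thesis unfolding set_lebesgue_integral_def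
      by (subst lborel_integral_real_affine[of 1 _ "2 * pi"]) (simp_all only: ind, simp add: per add.commute)
  qed
  also have "(LINT x:{c - pi..pi}|lborel. H x) + (LINT x:{-pi<..c - pi}|lborel. H x) = (LINT x:{-pi..pi}|lborel. H x)"
  proof -
    have 1: "integrable lborel (\<lambda>x. indicator {c - pi..pi} x *\<^sub>R H x)"
      "integrable lborel (\<lambda>x. indicator {-pi<..c - pi} x *\<^sub>R H x)"
      using si[of "{c - pi..pi}" "c - pi" pi] si[of "{-pi<..c - pi}" "-pi" "c - pi", OF _ greaterThanAtMost_subseteq_atLeastAtMost_iff[THEN iffD2]]
      unfolding set_integrable_def by auto
    have "(LINT x:{-pi..pi}|lborel. H x) =
        (\<integral>x. indicator {c - pi..pi} x *\<^sub>R H x + indicator {-pi<..c - pi} x *\<^sub>R H x \<partial>lborel)"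
      unfolding set_lebesgue_integral_def
    proof (rule integral_cong_AE)
      show "AE x in lborel. indicator {-pi..pi} x *\<^sub>R H x =
          indicator {c - pi..pi} x *\<^sub>R H x + indicator {-pi<..c - pi} x *\<^sub>R H x"
        using AE_lborel_singleton[of "c - pi"] AE_lborel_singleton[of "-pi"]
        by eventually_elim (use c in \<open>auto simp: indicator_def\<close>)
    qed measurable
    then show ?thesis using 1 unfolding set_lebesgue_integral_def by simp
  qed
  finally show ?thesis .
qed

text \<open>Reflection about \<open>c\<close> acts on odd functions as the multiplier
  \<open>2 cos (m c)\<close>, so it commutes with the resolvent. This is why monotonicity is
  expressed by reflections: the differences are again odd, and positivity is available for odd
  functions. The computation moves the translation onto the sine factor by periodicity.\<close>

lemma sine_coeff_reflect:
  fixes g :: "real \<Rightarrow> real"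
  assumes gm [measurable]: "g \<in> borel_measurable borel" and B: "\<And>x. \<bar>g x\<bar> \<le> B"
    and odd: "\<And>x. g (- x) = - g x" and per: "\<And>x. g (x + 2 * pi) = g x"
    and c: "0 \<le> c" "c \<le> 2 * pi"
  shows "sine_coeff (\<lambda>x. g (c + x) - g (c - x)) m = 2 * cos (real m * c) * sine_coeff g m"
proof -
  define H where "H y = g y * sin (real m * (y - c))" for y
  have Hm [measurable]: "H \<in> borel_measurable borel" unfolding H_def by measurable
  have HB: "\<bar>H x\<bar> \<le> B" for x
  proof -
    have "\<bar>g x\<bar> * \<bar>sin (real m * (x - c))\<bar> \<le> B * 1"
      using order_trans[OF abs_ge_zero B[of x]] by (intro mult_mono B) auto
    then show ?thesis unfolding H_def abs_mult by simp
  qed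
  have Hper: "H (x + 2 * pi) = H x" for x
  proof -
    have "real m * (x + 2 * pi - c) = real m * ((x - c) + 2 * pi)" by simp
    then show ?thesis unfolding H_def per using sin.plus_of_nat[of "real m * (x - c)" m]
      by (simp add: distrib_left mult_ac)
  qed
  have si: "set_integrable lborel {-pi..pi} F" if [measurable]: "F \<in> borel_measurable borel" and "\<And>x. \<bar>F x\<bar> \<le> B" for F :: "real \<Rightarrow> real"
  proof (rule set_integrable_bound[where f = "\<lambda>_. B"])
    show "set_integrable lborel {-pi..pi} (\<lambda>_. B)" unfolding set_integrable_def by simp
    show "AE x in lborel. x \<in> {-pi..pi} \<longrightarrow> norm (F x) \<le> norm B" using order_trans[OF that(2) abs_ge_self] by auto
  qed (simp add: set_borel_measurable_def)
  have "(LINT x|HP. (g (c + x) - g (c - x)) * sin (real m * x)) = (LINT x|HP. H (c + x) + H (c + - x))"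
    by (intro Bochner_Integration.integral_cong) (auto simp: H_def algebra_simps)
  also have "\<dots> = (LINT x:{-pi..pi}|lborel. H (c + x))"
    using fold_integral(3)[OF _ si[of "\<lambda>x. H (c + x)"]] HB by simp
  also have "\<dots> = (LINT x:{-pi..pi}|lborel. H x)"
    by (rule shift_integral[OF Hm HB Hper c])
  also have "\<dots> = (LINT x|HP. H x + H (- x))"
    by (rule fold_integral(3)[OF Hm si[OF Hm HB]])
  also have "\<dots> = (LINT x|HP. 2 * cos (real m * c) * (g x * sin (real m * x)))"
  proof (intro Bochner_Integration.integral_cong refl)
    fix x
    have "H x + H (- x) = g x * (sin (real m * x - real m * c) + sin (real m * x + real m * c))"
    proof -
      have "real m * (- x - c) = - (real m * x + real m * c)" by (simp add: algebra_simps)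
      then have "H (- x) = g x * sin (real m * x + real m * c)" unfolding H_def odd by (simp only: sin_minus minus_mult_minus)
      then show ?thesis unfolding H_def by (simp add: algebra_simps)
    qed
    also have "\<dots> = 2 * cos (real m * c) * (g x * sin (real m * x))"
      by (simp add: sin_add sin_diff)
    finally show "H x + H (- x) = 2 * cos (real m * c) * (g x * sin (real m * x))" .
  qed
  finally show ?thesis unfolding sine_coeff_def by simp
qed

lemma periodic_int:
  fixes g :: "real \<Rightarrow> real"
  assumes per: "\<And>x. g (x + 2 * pi) = g x"
  shows "g (x + 2 * pi * of_int n) = g x"
proof -
  have nat: "g (x + 2 * pi * real n) = g x" for n x
  proof (induction n)
    case (Suc n)
    have "x + 2 * pi * real (Suc n) = (x + 2 * pi * real n) + 2 * pi" by (simp add: algebra_simps)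
    then show ?case using per[of "x + 2 * pi * real n"] Suc by (simp only:)
  qed simp
  show ?thesis
  proof (cases "n \<ge> 0")
    case True
    then show ?thesis using nat[of x "nat n"] by simp
  next
    case False
    then show ?thesis using nat[of "x + 2 * pi * of_int n" "nat (- n)"] by simp
  qed
qed

lemma odd_periodic_bound:
  fixes g :: "real \<Rightarrow> real"
  assumes odd: "\<And>x. g (- x) = - g x" and per: "\<And>x. g (x + 2 * pi) = g x"
    and B: "\<And>x. x \<in> {0..pi} \<Longrightarrow> \<bar>g x\<bar> \<le> B"
  shows "\<bar>g x\<bar> \<le> B"
proof -
  define n where "n = \<lfloor>(x + pi) / (2 * pi)\<rfloor>"
  define y where "y = x - 2 * pi * of_int n"
  have n: "of_int n \<le> (x + pi) / (2 * pi)" "(x + pi) / (2 * pi) < of_int n + 1"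
    unfolding n_def by linarith+
  then have y: "- pi \<le> y" "y \<le> pi" unfolding y_def by (simp_all add: field_simps)
  have "g x = g y" unfolding y_def using periodic_int[where g = g, OF per, of "x - 2 * pi * of_int n" n] by simp
  moreover have "\<bar>g y\<bar> \<le> B"
    using B[of y] B[of "- y"] odd[of y] y by (cases "y \<ge> 0") auto
  ultimately show ?thesis by simp
qed

context fractional_exponent
begin

section \<open>A priori bound for solutions\<close>

lemma resolvent_approx_identity:
  assumes v: "sq_int v"
  shows "(\<lambda>n. LINT x|HP. (real (Suc n) * resolvent (real (Suc n)) v x - v x)^2) \<longlonglongrightarrow> 0"
proof -
  define b where "b m = sine_coeff v m" for m
  have eq: "(LINT x|HP. (real (Suc n) * resolvent (real (Suc n)) v x - v x)^2) =
      pi / 2 * (\<Sum>m. (lam m / (lam m + real (Suc n)) * b m)^2)" for n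
  proof -
    have M: "real (Suc n) > 0" by simp
    note sq = sq_int_cmult[OF resolvent_sq_int[OF v M], of "real (Suc n)"]
    have "sine_coeff (\<lambda>x. real (Suc n) * resolvent (real (Suc n)) v x - v x) m = - (lam m / (lam m + real (Suc n)) * b m)" for m
      using lam_M_pos[OF M, of m]
      unfolding sine_coeff_diff[OF sq_int_integrable[OF sq] sq_int_integrable[OF v]] sine_coeff_cmult
        sine_coeff_resolvent[OF v M] b_def by (simp add: field_simps)
    then show ?thesis unfolding parseval_norm[OF sq_int_diff[OF sq v]] by simp
  qed
  have "(\<lambda>n. \<Sum>m. (lam m / (lam m + real (Suc n)) * b m)^2) \<longlonglongrightarrow> (\<Sum>m. 0)"
  proof (rule tannerys_theorem[THEN conjunct2, THEN conjunct2])
    show "summable (\<lambda>m. (b m)^2)" unfolding b_def by (rule bessel_inequality(1)[OF v])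
    show "(\<lambda>n. (lam m / (lam m + real (Suc n)) * b m)^2) \<longlonglongrightarrow> 0" for m
    proof -
      have "filterlim (\<lambda>n. lam m + real (Suc n)) at_top sequentially"
        by (intro filterlim_tendsto_add_at_top[OF tendsto_const]
            filterlim_compose[OF filterlim_real_sequentially filterlim_Suc])
      then have "(\<lambda>n. lam m / (lam m + real (Suc n))) \<longlonglongrightarrow> 0"
        by (intro real_tendsto_divide_at_top[OF tendsto_const])
      from tendsto_power[OF tendsto_mult[OF this tendsto_const[of "b m"]], of 2] show ?thesis by simp
    qed
    show "\<forall>\<^sub>F (m, n) in sequentially \<times>\<^sub>F sequentially. norm ((lam m / (lam m + real (Suc n)) * b m)^2) \<le> (b m)^2"
    proof (rule always_eventually, safe)
      fix m n
      have "0 \<le> lam m / (lam m + real (Suc n))" "lam m / (lam m + real (Suc n)) \<le> 1"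
        using lam_M_pos[of "real (Suc n)" m] by (simp_all add: divide_le_eq_1_pos del: of_nat_Suc)
      then have "(lam m / (lam m + real (Suc n)))^2 * (b m)^2 \<le> 1 * (b m)^2"
        by (intro mult_right_mono power_le_one) auto
      then show "norm ((lam m / (lam m + real (Suc n)) * b m)^2) \<le> (b m)^2"
        by (simp only: power_mult_distrib[symmetric] real_norm_def abs_power2 mult_1)
    qed
  qed simp
  from tendsto_mult[OF tendsto_const[of "pi / 2"] this] show ?thesis unfolding eq by simp
qed

text \<open>The equation is tested with \<open>sgn \<phi>\<close> on \<open>{\<bar>\<phi>\<bar> > \<surd>\<omega>}\<close>; applying \<open>M\<close> times the resolvent to
  the test function first makes sense of the pairing although only \<open>W \<in> L\<^sup>1\<close> is known.\<close>

lemma weak_solution_bounded: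
  assumes \<phi>: "sq_int \<phi>" and W: "integrable HP W" and \<omega>: "\<omega> > 0"
    and coeff: "\<And>m. sine_coeff W m = lam m * sine_coeff \<phi> m"
    and eq: "AE x in HP. W x = \<omega> * \<phi> x - \<phi> x ^ 3"
  shows "AE x in HP. \<bar>\<phi> x\<bar> \<le> sqrt \<omega>"
proof -
  define a where "a = sqrt \<omega>"
  have a: "a > 0" "a^2 = \<omega>" using \<omega> by (auto simp: a_def)
  note [measurable] = sq_int_measurable[OF \<phi>]
  have Wm [measurable]: "W \<in> borel_measurable borel" using borel_measurable_integrable[OF W] by simp
  define v where "v x = (if \<phi> x > a then 1 else if \<phi> x < - a then - 1 else (0::real))" for x
  define w where "w x = max (- a) (min a (\<phi> x))" for x
  define r where "r x = \<phi> x - w x" for x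
  have v1: "\<bar>v x\<bar> \<le> 1" for x by (simp add: v_def)
  have v: "sq_int v"
  proof (rule sq_int_bounded[of _ 1])
    show "v \<in> borel_measurable borel" unfolding v_def[abs_def] by measurable
  qed (rule v1)
  have wa: "- a \<le> w x" "w x \<le> a" for x unfolding w_def using a by auto
  have w: "sq_int w"
  proof (rule sq_int_bounded[of _ a])
    show "w \<in> borel_measurable borel" unfolding w_def[abs_def] by measurable
    show "\<bar>w x\<bar> \<le> a" for x using wa[of x] by auto
  qed
  have r: "sq_int r" unfolding r_def by (intro sq_int_diff \<phi> w)
  have pair: "0 \<le> (LINT x|HP. W x * (M * resolvent M v x))" if M: "M > 0" for M
  proof -
    \<comment> \<open>\<open>M D\<close> has the multiplier \<open>M lam / (lam + M)\<close>, a
      bounded approximation of \<open>(-\<Delta>)\<^sup>s\<close>; pairing \<open>W\<close> with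
      \<open>M\<close> times the resolvent of \<open>v\<close> amounts to pairing
      \<open>M D \<phi>\<close> with \<open>v\<close>.\<close>
    define D where "D g x = g x - M * resolvent M g x" for g x
    have D: "sq_int (D g)" if "sq_int g" for g
      unfolding D_def by (intro sq_int_diff sq_int_cmult resolvent_sq_int that M)
    have "(\<lambda>m. sine_coeff v m / (lam m + M) * (LINT x|HP. W x * sin (real m * x))) sums
       (LINT x|HP. W x * resolvent M v x)"
      unfolding resolvent_def by (rule integral_series[OF resolvent_coeff_summable[OF v M] W]) auto
    from sums_mult[OF this, of "2 / pi"]
    have s1: "(\<lambda>m. sine_coeff v m / (lam m + M) * (lam m * sine_coeff \<phi> m)) sums (2 / pi * (LINT x|HP. W x * resolvent M v x))"
      unfolding coeff[symmetric] sine_coeff_def[of W] by (simp add: mult_ac)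
    have "sine_coeff (D \<phi>) m = lam m / (lam m + M) * sine_coeff \<phi> m" for m
      using lam_M_pos[OF M, of m] sq_int_integrable[OF \<phi>]
        sq_int_integrable[OF sq_int_cmult[OF resolvent_sq_int[OF \<phi> M]]]
      unfolding D_def by (simp add: sine_coeff_diff sine_coeff_cmult sine_coeff_resolvent[OF \<phi> M] field_simps)
    then have s2: "(\<lambda>m. sine_coeff v m / (lam m + M) * (lam m * sine_coeff \<phi> m)) sums (2 / pi * (LINT x|HP. D \<phi> x * v x))"
      using parseval[OF D[OF \<phi>] v] by (simp add: mult_ac)
    have "2 / pi * (LINT x|HP. W x * resolvent M v x) = 2 / pi * (LINT x|HP. D \<phi> x * v x)"
      by (rule sums_unique2[OF s1 s2])
    then have e1: "(LINT x|HP. W x * resolvent M v x) = (LINT x|HP. D \<phi> x * v x)" by simp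
    \<comment> \<open>\<open>w\<close> is \<open>\<phi>\<close> cut off at height \<open>a\<close>.
      Where \<open>v = \<plusminus>1\<close>, \<open>w = \<plusminus>a\<close> is extremal while
      \<open>M\<close> times its resolvent stays within \<open>\<plusminus>a\<close>, so
      \<open>D w\<close> has the sign of \<open>v\<close>. By symmetry \<open>D\<close> moves from
      \<open>r\<close> to \<open>v\<close>; \<open>r\<close> has the sign of \<open>v\<close>, and
      \<open>v\<close> is itself extremal where \<open>r \<noteq> 0\<close>.\<close>
    have "\<phi> = (\<lambda>x. w x + r x)" by (simp add: r_def fun_eq_iff)
    then have Dsplit: "D \<phi> x = D w x + D r x" for x
      unfolding D_def using resolvent_add[OF w r M, of x] by (simp add: algebra_simps)
    have "(LINT x|HP. D \<phi> x * v x) = (LINT x|HP. D w x * v x) + (LINT x|HP. D r x * v x)"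
      unfolding Dsplit distrib_right using sq_int_mult[OF D[OF w] v] sq_int_mult[OF D[OF r] v] by simp
    also have "(LINT x|HP. D r x * v x) = (LINT x|HP. r x * D v x)"
    proof -
      have "(LINT x|HP. D r x * v x) = (LINT x|HP. r x * v x - M * (resolvent M r x * v x))"
        unfolding D_def by (simp add: algebra_simps)
      also have "\<dots> = (LINT x|HP. r x * v x) - M * (LINT x|HP. resolvent M r x * v x)"
        using sq_int_mult[OF r v] sq_int_mult[OF resolvent_sq_int[OF r M] v] by simp
      also have "\<dots> = (LINT x|HP. r x * v x) - M * (LINT x|HP. r x * resolvent M v x)"
        by (simp add: resolvent_symmetric[OF r v M])
      also have "\<dots> = (LINT x|HP. r x * v x - M * (r x * resolvent M v x))"
        using sq_int_mult[OF r v] sq_int_mult[OF r resolvent_sq_int[OF v M]] by simp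
      also have "\<dots> = (LINT x|HP. r x * D v x)" unfolding D_def by (simp add: algebra_simps)
      finally show ?thesis .
    qed
    finally have split: "(LINT x|HP. D \<phi> x * v x) = (LINT x|HP. D w x * v x) + (LINT x|HP. r x * D v x)" .
    have p1: "0 \<le> (LINT x|HP. D w x * v x)"
    proof (rule integral_nonneg_AE, rule AE_HP_I)
      fix x :: real assume x: "x \<in> {0..pi}"
      have "resolvent M w x \<le> a / M" "- (a / M) \<le> resolvent M w x"
        using resolvent_upper_bound[OF w M _ _ x, of a] resolvent_lower_bound[OF w M _ _ x, of a] wa a by auto
      then have "M * resolvent M w x \<le> a" "- a \<le> M * resolvent M w x" using M by (simp_all add: field_simps)
      then show "0 \<le> D w x * v x" unfolding D_def v_def w_def by auto
    qed
    have p2: "0 \<le> (LINT x|HP. r x * D v x)"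
    proof (rule integral_nonneg_AE, rule AE_HP_I)
      fix x :: real assume x: "x \<in> {0..pi}"
      have "v x \<le> 1" "- 1 \<le> v x" for x using v1[of x] by auto
      then have "resolvent M v x \<le> 1 / M" "- (1 / M) \<le> resolvent M v x"
        using resolvent_upper_bound[OF v M _ _ x, of 1] resolvent_lower_bound[OF v M _ _ x, of 1] by auto
      then have "M * resolvent M v x \<le> 1" "- 1 \<le> M * resolvent M v x" using M by (simp_all add: field_simps)
      then show "0 \<le> r x * D v x" unfolding D_def r_def v_def w_def using a
        by (auto simp: mult_nonpos_nonpos)
    qed
    have "0 \<le> M * (LINT x|HP. W x * resolvent M v x)" unfolding e1 split using p1 p2 M by simp
    also have "\<dots> = (LINT x|HP. W x * (M * resolvent M v x))" by (simp add: mult.left_commute)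
    finally show ?thesis .
  qed
  define V where "V n x = real (Suc n) * resolvent (real (Suc n)) v x" for n x
  have V: "sq_int (V n)" for n unfolding V_def by (intro sq_int_cmult resolvent_sq_int v) simp
  note [measurable] = sq_int_measurable[OF V] sq_int_measurable[OF v]
  have "(\<lambda>n. LINT x|HP. norm ((V n x - v x)^2)) \<longlonglongrightarrow> 0"
    using resolvent_approx_identity[OF v] unfolding V_def by simp
  \<comment> \<open>\<open>L^2\<close> convergence of \<open>V n\<close> to \<open>v\<close> gives
    pointwise convergence along a subsequence, and \<open>\<bar>V n\<bar> \<le> 1\<close> on the
    half period makes \<open>\<bar>W\<bar>\<close> a dominating function.\<close>
  from tendsto_L1_AE_subseq[OF sq_int_integrable_sq[OF sq_int_diff[OF V v]] this]
  obtain q where q: "strict_mono q" "AE x in HP. (\<lambda>n. (V (q n) x - v x)^2) \<longlonglongrightarrow> 0" by blast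
  have Vb: "\<bar>V n x\<bar> \<le> 1" if x: "x \<in> {0..pi}" for n x
  proof -
    have "v x \<le> 1" "- 1 \<le> v x" for x using v1[of x] by auto
    then have "resolvent (real (Suc n)) v x \<le> 1 / real (Suc n)" "- (1 / real (Suc n)) \<le> resolvent (real (Suc n)) v x"
      using resolvent_upper_bound[OF v _ _ _ x, of "real (Suc n)" 1] resolvent_lower_bound[OF v _ _ _ x, of "real (Suc n)" 1] by auto
    then have "V n x \<le> 1" "- 1 \<le> V n x" unfolding V_def by (simp_all add: field_simps)
    then show ?thesis by simp
  qed
  have "(\<lambda>n. LINT x|HP. W x * V (q n) x) \<longlonglongrightarrow> (LINT x|HP. W x * v x)"
  proof (rule integral_dominated_convergence[where w = "\<lambda>x. \<bar>W x\<bar>"])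
    show "AE x in HP. (\<lambda>n. W x * V (q n) x) \<longlonglongrightarrow> W x * v x"
      using q(2)
    proof eventually_elim
      case (elim x)
      then have "(\<lambda>n. \<bar>V (q n) x - v x\<bar>) \<longlonglongrightarrow> 0"
        using tendsto_real_sqrt[OF elim] by simp
      then have "(\<lambda>n. V (q n) x) \<longlonglongrightarrow> v x" by (simp add: tendsto_rabs_zero_iff LIM_zero_iff)
      then show ?case by (intro tendsto_mult tendsto_const)
    qed
    show "AE x in HP. norm (W x * V (q n) x) \<le> \<bar>W x\<bar>" for n
      by (rule AE_HP_I) (auto simp: abs_mult intro!: mult_left_le Vb)
  qed (use W in auto)
  then have "0 \<le> (LINT x|HP. W x * v x)"
    by (rule LIMSEQ_le_const) (auto simp: V_def intro!: pair)
  \<comment> \<open>\<open>W = - \<phi> (\<phi> - a) (\<phi> + a)\<close> has the sign opposite to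
    \<open>v\<close> wherever \<open>v\<close> is nonzero, which clashes with the nonnegative
    integral unless that set is null.\<close>
  have Wv: "AE x in HP. W x * v x \<le> 0 \<and> (W x * v x = 0 \<longrightarrow> \<bar>\<phi> x\<bar> \<le> a)"
    using eq
  proof eventually_elim
    case (elim x)
    have fac: "W x = - \<phi> x * (\<phi> x - a) * (\<phi> x + a)"
      unfolding elim a(2)[symmetric] by (simp add: algebra_simps power2_eq_square power3_eq_cube)
    consider "\<phi> x > a" | "\<phi> x < - a" | "\<bar>\<phi> x\<bar> \<le> a" by linarith
    then show ?case
    proof cases
      case 1
      then have "\<phi> x * (\<phi> x - a) * (\<phi> x + a) > 0" using a by (intro mult_pos_pos) auto
      moreover have "W x = - (\<phi> x * (\<phi> x - a) * (\<phi> x + a))" by (simp add: fac)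
      ultimately have "W x < 0" by linarith
      then show ?thesis using 1 by (simp add: v_def)
    next
      case 2
      then have "(- \<phi> x) * (a - \<phi> x) * (- \<phi> x - a) > 0" using a by (intro mult_pos_pos) auto
      moreover have "W x = (- \<phi> x) * (a - \<phi> x) * (- \<phi> x - a) " unfolding fac by (simp add: algebra_simps)
      ultimately show ?thesis using 2 a by (simp add: v_def)
    qed (auto simp: v_def)
  qed
  have Wvi: "integrable HP (\<lambda>x. W x * v x)"
    by (rule integrable_HP_bounded_mult[OF W, of _ 1]) (use v1 in auto)
  have "(LINT x|HP. - (W x * v x)) = 0"
  proof (rule antisym)
    show "(LINT x|HP. - (W x * v x)) \<le> 0" using \<open>0 \<le> (LINT x|HP. W x * v x)\<close> by simp
    show "0 \<le> (LINT x|HP. - (W x * v x))" by (rule integral_nonneg_AE) (use Wv in auto)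
  qed
  then have "AE x in HP. - (W x * v x) = 0"
    using Wvi Wv by (subst (asm) integral_nonneg_eq_0_iff_AE) auto
  with Wv show ?thesis unfolding a_def[symmetric] by eventually_elim auto
qed

text \<open>Power iteration: with \<open>R = resolvent (M + 1)\<close>, the resolvent identity
  \<open>resolvent M (g - R g) = R g \<ge> 0\<close> keeps a nonpositive value at \<open>x\<close>
  nonpositive when \<open>g\<close> is replaced by its iterates under \<open>R\<close>. Scaled by
  the n-th power of \<open>lam 1 + M + 1\<close>, only the first sine mode survives as
  \<open>n\<close> grows, and it is positive inside the interval.\<close>

lemma resolvent_pos:
  assumes g: "sq_int g" and M: "M > 0" and nn: "AE x in HP. 0 \<le> g x"
    and b1: "sine_coeff g 1 > 0" and x: "x \<in> {0<..<pi}"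
  shows "resolvent M g x > 0"
proof (rule ccontr)
  assume "\<not> resolvent M g x > 0"
  then have le0: "resolvent M g x \<le> 0" by simp
  define G where "G n = (resolvent (M + 1) ^^ n) g" for n
  have M1: "M + 1 > 0" using M by simp
  have x': "x \<in> {0..pi}" using x by auto
  have G: "sq_int (G n)" "AE x in HP. 0 \<le> G n x" for n
  proof -
    have "sq_int (G n) \<and> (AE x in HP. 0 \<le> G n x)"
    proof (induction n)
      case (Suc n)
      then show ?case using resolvent_sq_int[OF _ M1, of "G n"] resolvent_nonneg[OF _ M1, of "G n"]
        by (auto simp: G_def intro!: AE_HP_I)
    qed (use g nn in \<open>auto simp: G_def\<close>)
    then show "sq_int (G n)" "AE x in HP. 0 \<le> G n x" by auto
  qed
  have coeff: "sine_coeff (G n) m = sine_coeff g m / (lam m + (M + 1)) ^ n" for n m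
  proof (induction n)
    case (Suc n)
    have "sine_coeff (G (Suc n)) m = sine_coeff (G n) m / (lam m + (M + 1))"
      using sine_coeff_resolvent[OF G(1) M1, of n m] by (simp add: G_def)
    then show ?case using Suc by simp
  qed (simp add: G_def)
  have step: "resolvent M (G (Suc n)) x \<le> resolvent M (G n) x" for n
  proof -
    have G': "G (Suc n) = resolvent (M + 1) (G n)" by (simp add: G_def)
    have "resolvent M (G n) x - resolvent M (G (Suc n)) x =
        (\<Sum>m. sine_coeff (G n) m / (lam m + M) * sin (real m * x) - sine_coeff (G (Suc n)) m / (lam m + M) * sin (real m * x))"
      unfolding resolvent_def by (rule suminf_diff[OF resolvent_summable[OF G(1) M] resolvent_summable[OF G(1) M]])
    also have "\<dots> = resolvent (M + 1) (G n) x"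
      unfolding resolvent_def
    proof (rule suminf_cong)
      fix m
      have p: "lam m + M > 0" "lam m + (M + 1) > 0" using lam_M_pos[OF M, of m] by auto
      have "sine_coeff (G (Suc n)) m = sine_coeff (G n) m / (lam m + (M + 1))"
        unfolding G' by (rule sine_coeff_resolvent[OF G(1) M1])
      moreover have "q / A - q / (A + 1) / A = q / (A + 1)" if "A > 0" for q A :: real
      proof -
        have "A \<noteq> 0" "A + 1 \<noteq> 0" using that by auto
        then show ?thesis by (simp add: divide_simps) (simp add: algebra_simps)
      qed
      from this[OF p(1), of "sine_coeff (G n) m"]
      have "sine_coeff (G n) m / (lam m + M) - sine_coeff (G n) m / (lam m + (M + 1)) / (lam m + M) =
          sine_coeff (G n) m / (lam m + (M + 1))" by (simp add: add.assoc)
      ultimately show "sine_coeff (G n) m / (lam m + M) * sin (real m * x) - sine_coeff (G (Suc n)) m / (lam m + M) * sin (real m * x) =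
          sine_coeff (G n) m / (lam m + (M + 1)) * sin (real m * x)"
        by (simp only: left_diff_distrib[symmetric])
    qed
    finally show ?thesis using resolvent_nonneg[OF G(1) M1 G(2) x', of n] by simp
  qed
  have all: "resolvent M (G n) x \<le> 0" for n
  proof (induction n)
    case (Suc n) then show ?case using step[of n] by simp
  qed (use le0 in \<open>simp add: G_def\<close>)
  \<comment> \<open>\<open>1 + (M + 1)\<close> is \<open>lam 1 + (M + 1)\<close>: the quotient is
    \<open>1\<close> at mode \<open>1\<close> and below \<open>1\<close> beyond; at mode
    \<open>0\<close>, where it exceeds \<open>1\<close>, the coefficient vanishes.\<close>
  define t where "t n m = sine_coeff g m / (lam m + M) * sin (real m * x) * ((1 + (M + 1)) / (lam m + (M + 1))) ^ n" for n m
  have t_le: "(\<Sum>m. t n m) \<le> 0" for n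
  proof -
    have "(1 + (M + 1)) ^ n * resolvent M (G n) x =
        (\<Sum>m. (1 + (M + 1)) ^ n * (sine_coeff (G n) m / (lam m + M) * sin (real m * x)))"
      unfolding resolvent_def by (rule suminf_mult[OF resolvent_summable[OF G(1) M], symmetric])
    also have "\<dots> = (\<Sum>m. t n m)" unfolding coeff t_def by (simp add: power_divide mult_ac)
    finally have "(1 + (M + 1)) ^ n * resolvent M (G n) x = (\<Sum>m. t n m)" .
    moreover have "(1 + (M + 1)) ^ n * resolvent M (G n) x \<le> 0"
      using all[of n] M by (intro mult_nonneg_nonpos) auto
    ultimately show ?thesis by simp
  qed
  have lim: "(\<lambda>n. \<Sum>m. t n m) \<longlonglongrightarrow> (\<Sum>m. if m = 1 then sine_coeff g m / (lam m + M) * sin (real m * x) else 0)"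
  proof (rule tannerys_theorem[THEN conjunct2, THEN conjunct2, OF _ _ resolvent_coeff_summable[OF g M]])
    fix m :: nat
    consider "m = 0" | "m = 1" | "m \<ge> 2" by linarith
    then show "(\<lambda>n. t n m) \<longlonglongrightarrow> (if m = 1 then sine_coeff g m / (lam m + M) * sin (real m * x) else 0)"
    proof cases
      case 3
      have "norm ((1 + (M + 1)) / (lam m + (M + 1))) < 1" using lam_gt_1[OF 3] M by simp
      from tendsto_mult[OF tendsto_const LIMSEQ_power_zero[OF this], of "sine_coeff g m / (lam m + M) * sin (real m * x)"]
      show ?thesis using 3 unfolding t_def by simp
    qed (use M in \<open>auto simp: t_def\<close>)
  next
    show "\<forall>\<^sub>F (m, n) in sequentially \<times>\<^sub>F sequentially. norm (t n m) \<le> \<bar>sine_coeff g m / (lam m + M)\<bar>"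
    proof (rule always_eventually, safe)
      fix m n
      show "norm (t n m) \<le> \<bar>sine_coeff g m / (lam m + M)\<bar>"
      proof (cases "m = 0")
        case False
        define \<rho> where "\<rho> = ((1 + (M + 1)) / (lam m + (M + 1))) ^ n"
        have "0 \<le> (1 + (M + 1)) / (lam m + (M + 1))" "(1 + (M + 1)) / (lam m + (M + 1)) \<le> 1"
          using lam_ge_1[of m] False M by auto
        then have "0 \<le> \<rho>" "\<rho> \<le> 1" unfolding \<rho>_def by (auto intro!: power_le_one)
        then have "\<bar>sine_coeff g m / (lam m + M) * sin (real m * x)\<bar> * \<rho> \<le> \<bar>sine_coeff g m / (lam m + M)\<bar> * 1"
          by (intro mult_mono abs_mult_sin_le) auto
        then show ?thesis unfolding t_def \<rho>_def[symmetric] real_norm_def abs_mult[of _ \<rho>]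
          using \<open>0 \<le> \<rho>\<close> by simp
      qed (simp add: t_def)
    qed
  qed simp
  have "(\<Sum>m. if m = 1 then sine_coeff g m / (lam m + M) * sin (real m * x) else 0) = sine_coeff g 1 / (1 + M) * sin x"
    using sums_unique[OF sums_single[of 1 "\<lambda>m. sine_coeff g m / (lam m + M) * sin (real m * x)"]] by simp
  with LIMSEQ_le_const2[OF lim] t_le have "sine_coeff g 1 / (1 + M) * sin x \<le> 0" by auto
  moreover have "sine_coeff g 1 / (1 + M) * sin x > 0"
    using b1 M sin_gt_zero[of x] x by (intro mult_pos_pos divide_pos_pos) auto
  ultimately show False by simp
qed

lemma resolvent_reflect:
  assumes gm [measurable]: "g \<in> borel_measurable borel" and B: "\<And>x. \<bar>g x\<bar> \<le> B"
    and odd: "\<And>x. g (- x) = - g x" and per: "\<And>x. g (x + 2 * pi) = g x"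
    and c: "0 \<le> c" "c \<le> 2 * pi" and M: "M > 0"
  shows "resolvent M (\<lambda>x. g (c + x) - g (c - x)) x = resolvent M g (c + x) - resolvent M g (c - x)"
proof -
  have g: "sq_int g" by (rule sq_int_bounded[OF gm B])
  have "resolvent M g (c + x) - resolvent M g (c - x) =
     (\<Sum>m. sine_coeff g m / (lam m + M) * sin (real m * (c + x)) - sine_coeff g m / (lam m + M) * sin (real m * (c - x)))"
    unfolding resolvent_def by (rule suminf_diff[OF resolvent_summable[OF g M] resolvent_summable[OF g M]])
  also have "\<dots> = resolvent M (\<lambda>x. g (c + x) - g (c - x)) x"
    unfolding resolvent_def sine_coeff_reflect[OF gm B odd per c]
    by (intro suminf_cong) (simp add: distrib_left right_diff_distrib sin_add sin_diff)
  finally show ?thesis ..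
qed

text \<open>Cauchy-Schwarz on the sine series: control in \<open>L^2\<close> becomes control at
  every single point, so limits of iterates need no exceptional set.\<close>

lemma resolvent_sq_le:
  assumes g: "sq_int g" and M: "M > 0"
  shows "(resolvent M g x)^2 \<le> (\<Sum>m. (1 / (lam m + M))^2) * (2 / pi * (LINT x|HP. (g x)^2))"
proof (rule LIMSEQ_le_const2[OF tendsto_power[OF summable_LIMSEQ[OF resolvent_summable[OF g M, of x]]], folded resolvent_def])
  have "(\<Sum>m<N. sine_coeff g m / (lam m + M) * sin (real m * x))^2 \<le>
      (\<Sum>m. (1 / (lam m + M))^2) * (2 / pi * (LINT x|HP. (g x)^2))" for N
  proof -
    have "(\<Sum>m<N. (sin (real m * x) / (lam m + M)) * sine_coeff g m)^2 \<le>
        (\<Sum>m<N. (sin (real m * x) / (lam m + M))^2) * (\<Sum>m<N. (sine_coeff g m)^2)"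
      by (rule Cauchy_Schwarz_ineq_sum)
    also have "\<dots> \<le> (\<Sum>m. (1 / (lam m + M))^2) * (\<Sum>m. (sine_coeff g m)^2)"
    proof (intro mult_mono)
      have "(\<Sum>m<N. (sin (real m * x) / (lam m + M))^2) \<le> (\<Sum>m<N. (1 / (lam m + M))^2)"
      proof (intro sum_mono)
        fix m
        have "(sin (real m * x))^2 \<le> 1" by (simp add: abs_square_le_1)
        then show "(sin (real m * x) / (lam m + M))^2 \<le> (1 / (lam m + M))^2"
          by (simp add: power_divide divide_right_mono)
      qed
      also have "\<dots> \<le> (\<Sum>m. (1 / (lam m + M))^2)"
        by (rule sum_le_suminf[OF multiplier_summable[OF M]]) auto
      finally show "(\<Sum>m<N. (sin (real m * x) / (lam m + M))^2) \<le> (\<Sum>m. (1 / (lam m + M))^2)" .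
      show "(\<Sum>m<N. (sine_coeff g m)^2) \<le> (\<Sum>m. (sine_coeff g m)^2)"
        by (rule sum_le_suminf[OF bessel_inequality(1)[OF g]]) auto
    qed (auto intro!: suminf_nonneg multiplier_summable M sum_nonneg)
    also have "(\<Sum>m. (sine_coeff g m)^2) = 2 / pi * (LINT x|HP. (g x)^2)"
      unfolding parseval_norm[OF g] by simp
    finally show ?thesis by (simp add: mult_ac)
  qed
  then show "\<exists>N. \<forall>n\<ge>N. (\<Sum>m<n. sine_coeff g m / (lam m + M) * sin (real m * x))^2 \<le>
      (\<Sum>m. (1 / (lam m + M))^2) * (2 / pi * (LINT x|HP. (g x)^2))" by blast
qed

lemma resolvent_tendsto:
  assumes g: "\<And>n. sq_int (g n)" "sq_int h" and M: "M > 0"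
    and lim: "(\<lambda>n. LINT x|HP. (g n x - h x)^2) \<longlonglongrightarrow> 0"
  shows "(\<lambda>n. resolvent M (g n) x) \<longlonglongrightarrow> resolvent M h x"
proof -
  define S where "S = (\<Sum>m. (1 / (lam m + M))^2)"
  have "(\<lambda>n. (resolvent M (g n) x - resolvent M h x)^2) \<longlonglongrightarrow> 0"
  proof (rule tendsto_sandwich[OF _ _ tendsto_const])
    show "\<forall>\<^sub>F n in sequentially. (resolvent M (g n) x - resolvent M h x)^2 \<le> S * (2 / pi * (LINT x|HP. (g n x - h x)^2))"
      using resolvent_sq_le[OF sq_int_diff[OF g] M] unfolding S_def resolvent_diff[OF g M] by simp
    show "(\<lambda>n. S * (2 / pi * (LINT x|HP. (g n x - h x)^2))) \<longlonglongrightarrow> 0"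
      using tendsto_mult[OF tendsto_const tendsto_mult[OF tendsto_const lim], of S "2 / pi"] by simp
  qed auto
  from tendsto_real_sqrt[OF this] show ?thesis by (simp add: tendsto_rabs_zero_iff LIM_zero_iff)
qed

end

section \<open>The maximal solution and its shape\<close>

text \<open>The right-hand side once \<open>2 \<omega> u\<close> has been added to both sides of the
  equation. The shift \<open>2 \<omega>\<close> is the least for which the derivative, here
  \<open>3 (\<omega> - t^2)\<close>, is nonnegative on
  \<open>\<bar>t\<bar> \<le> \<surd>\<omega>\<close>; the value at the endpoint is
  \<open>2 \<omega> \<surd>\<omega>\<close>, so the resolvent returns the same bound
  \<open>\<surd>\<omega>\<close>.\<close>

definition nonlin :: "real \<Rightarrow> real \<Rightarrow> real" where
  "nonlin \<omega> t = 3 * \<omega> * t - t ^ 3"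

lemma nonlin_measurable [measurable]: "nonlin \<omega> \<in> borel_measurable borel"
  unfolding nonlin_def[abs_def] by measurable

lemma nonlin_minus: "nonlin \<omega> (- t) = - nonlin \<omega> t"
  by (simp add: nonlin_def)

lemma abs_le_sqrt_imp_sq_le: "\<bar>t\<bar> \<le> sqrt \<omega> \<Longrightarrow> t^2 \<le> \<omega>"
proof -
  assume t: "\<bar>t\<bar> \<le> sqrt \<omega>"
  then have "\<omega> \<ge> 0" using order_trans[OF abs_ge_zero t] by simp
  with power_mono[OF t abs_ge_zero, of 2] show ?thesis by simp
qed

lemma nonlin_mono:
  assumes "x \<le> y" "\<bar>x\<bar> \<le> sqrt \<omega>" "\<bar>y\<bar> \<le> sqrt \<omega>"
  shows "nonlin \<omega> x \<le> nonlin \<omega> y"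
proof -
  have "x^2 \<le> \<omega>" "y^2 \<le> \<omega>" using abs_le_sqrt_imp_sq_le assms by auto
  moreover have "2 * x * y \<le> x^2 + y^2" by (rule sum_squares_bound)
  ultimately have "0 \<le> (y - x) * (3 * \<omega> - (x^2 + x * y + y^2))" using assms(1) by simp
  also have "\<dots> = nonlin \<omega> y - nonlin \<omega> x"
    by (simp add: nonlin_def algebra_simps power2_eq_square power3_eq_cube)
  finally show ?thesis by simp
qed

lemma nonlin_sqrt: "\<omega> \<ge> 0 \<Longrightarrow> nonlin \<omega> (sqrt \<omega>) = 2 * \<omega> * sqrt \<omega>"
  by (simp add: nonlin_def power3_eq_cube)

lemma nonlin_bound:
  assumes "\<bar>t\<bar> \<le> sqrt \<omega>" "\<omega> \<ge> 0"
  shows "\<bar>nonlin \<omega> t\<bar> \<le> 2 * \<omega> * sqrt \<omega>"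
  using nonlin_mono[of t "sqrt \<omega>" \<omega>] nonlin_mono[of "- sqrt \<omega>" t \<omega>] assms
  by (auto simp: nonlin_sqrt nonlin_minus abs_le_iff)

lemma nonlin_nonneg:
  assumes "0 \<le> t" "t \<le> sqrt \<omega>" "\<omega> \<ge> 0"
  shows "0 \<le> nonlin \<omega> t"
  using nonlin_mono[of 0 t \<omega>] assms by (simp add: nonlin_def)

lemma nonlin_pos:
  assumes "0 < t" "t \<le> sqrt \<omega>"
  shows "0 < nonlin \<omega> t"
proof -
  have "t^2 \<le> \<omega>" using abs_le_sqrt_imp_sq_le[of t \<omega>] assms by auto
  moreover have "0 < t^2" using assms by simp
  ultimately have "0 < t * (3 * \<omega> - t^2)" using assms by (intro mult_pos_pos) linarith+
  then show ?thesis by (simp add: nonlin_def algebra_simps power2_eq_square power3_eq_cube)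
qed

text \<open>The reflection inequalities say that \<open>u\<close> is symmetric about \<open>\<pi>/2\<close> and nondecreasing on
  \<open>[-\<pi>/2, \<pi>/2]\<close>, in a form preserved by every operator that commutes with reflections and
  preserves nonnegativity on \<open>(0, \<pi>)\<close> of odd functions.\<close>

definition lobe :: "real \<Rightarrow> (real \<Rightarrow> real) \<Rightarrow> bool" where
  "lobe a u \<longleftrightarrow> u \<in> borel_measurable borel \<and> (\<forall>x. u (- x) = - u x) \<and> (\<forall>x. u (x + 2 * pi) = u x) \<and>
     (\<forall>x\<in>{0..pi}. 0 \<le> u x \<and> u x \<le> a) \<and>
     (\<forall>c\<in>{0..pi / 2}. \<forall>x\<in>{0..pi}. u (c - x) \<le> u (c + x)) \<and>
     (\<forall>c\<in>{pi / 2..pi}. \<forall>x\<in>{0..pi}. u (c + x) \<le> u (c - x))"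

lemma lobeD:
  assumes "lobe a u"
  shows "u \<in> borel_measurable borel" "\<And>x. u (- x) = - u x" "\<And>x. u (x + 2 * pi) = u x"
    "\<And>x. x \<in> {0..pi} \<Longrightarrow> 0 \<le> u x" "\<And>x. x \<in> {0..pi} \<Longrightarrow> u x \<le> a"
    "\<And>c x. c \<in> {0..pi / 2} \<Longrightarrow> x \<in> {0..pi} \<Longrightarrow> u (c - x) \<le> u (c + x)"
    "\<And>c x. c \<in> {pi / 2..pi} \<Longrightarrow> x \<in> {0..pi} \<Longrightarrow> u (c + x) \<le> u (c - x)"
  using assms unfolding lobe_def by blast+

lemma lobe_abs_le:
  assumes "lobe a u"
  shows "\<bar>u x\<bar> \<le> a"
  by (rule odd_periodic_bound[OF lobeD(2,3)[OF assms]]) (use lobeD(4,5)[OF assms] in auto)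

lemma lobe_square_wave:
  assumes "a \<ge> 0"
  shows "lobe a (\<lambda>x. a * sgn (sin x))"
proof -
  have sgn_mono: "sgn x \<le> sgn y" if "x \<le> y" for x y :: real using that by (auto simp: sgn_if)
  have 1: "a * sgn (sin (c - x)) \<le> a * sgn (sin (c + x))" if "c \<in> {0..pi / 2}" "x \<in> {0..pi}" for c x
  proof (intro mult_left_mono sgn_mono assms)
    have "0 \<le> cos c * sin x" using that by (intro mult_nonneg_nonneg cos_ge_zero sin_ge_zero) auto
    then show "sin (c - x) \<le> sin (c + x)" by (simp add: sin_add sin_diff)
  qed
  have 2: "a * sgn (sin (c + x)) \<le> a * sgn (sin (c - x))" if "c \<in> {pi / 2..pi}" "x \<in> {0..pi}" for c x
  proof (intro mult_left_mono sgn_mono assms)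
    have "cos c \<le> cos (pi / 2)" using that by (intro cos_monotone_0_pi_le) auto
    then have "cos c * sin x \<le> 0" using that by (intro mult_nonpos_nonneg sin_ge_zero) auto
    then show "sin (c + x) \<le> sin (c - x)" by (simp add: sin_add sin_diff)
  qed
  have "0 \<le> sgn (sin x)" "sgn (sin x) \<le> (1::real)" if "x \<in> {0..pi}" for x
    using sin_ge_zero[of x] that by (auto simp: sgn_if)
  then have 3: "0 \<le> a * sgn (sin x) \<and> a * sgn (sin x) \<le> a" if "x \<in> {0..pi}" for x
    using that assms by (simp add: mult_left_le)
  show ?thesis unfolding lobe_def using 1 2 3 by (auto simp: sgn_minus)
qed

context fractional_exponent
begin

section \<open>Monotone iteration for the shifted equation\<close>

lemma nonlin_lobe:
  assumes u: "lobe (sqrt \<omega>) u" and \<omega>: "\<omega> > 0"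
  shows "(\<lambda>x. nonlin \<omega> (u x)) \<in> borel_measurable borel" "\<And>x. \<bar>nonlin \<omega> (u x)\<bar> \<le> 2 * \<omega> * sqrt \<omega>"
    "\<And>x. nonlin \<omega> (u (- x)) = - nonlin \<omega> (u x)" "\<And>x. nonlin \<omega> (u (x + 2 * pi)) = nonlin \<omega> (u x)"
    "sq_int (\<lambda>x. nonlin \<omega> (u x))"
proof -
  show 1: "(\<lambda>x. nonlin \<omega> (u x)) \<in> borel_measurable borel" using lobeD(1)[OF u] by measurable
  show 2: "\<bar>nonlin \<omega> (u x)\<bar> \<le> 2 * \<omega> * sqrt \<omega>" for x
    by (rule nonlin_bound[OF lobe_abs_le[OF u]]) (use \<omega> in simp)
  show "sq_int (\<lambda>x. nonlin \<omega> (u x))" by (rule sq_int_bounded[OF 1 2])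
qed (simp_all add: lobeD(2,3)[OF u] nonlin_minus)

text \<open>For each admissible \<open>c\<close> the odd function
  \<open>g (c + x) - g (c - x)\<close> has a fixed sign on \<open>[0, pi]\<close>, because
  \<open>nonlin\<close> is increasing; the resolvent keeps that sign and commutes with the
  reflection. The height is kept by \<open>nonlin \<omega> (sqrt \<omega>) / (2 * \<omega>) = sqrt
  \<omega>\<close>.\<close>

lemma resolvent_lobe:
  assumes u: "lobe (sqrt \<omega>) u" and \<omega>: "\<omega> > 0"
  shows "lobe (sqrt \<omega>) (resolvent (2 * \<omega>) (\<lambda>x. nonlin \<omega> (u x)))"
proof -
  define g where "g x = nonlin \<omega> (u x)" for x
  note g = nonlin_lobe[OF u \<omega>, folded g_def[abs_def] g_def]
  have M: "2 * \<omega> > 0" using \<omega> by simp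
  have reflc: "resolvent (2 * \<omega>) (\<lambda>x. g (c + x) - g (c - x)) x = resolvent (2 * \<omega>) g (c + x) - resolvent (2 * \<omega>) g (c - x)"
    if "0 \<le> c" "c \<le> pi" for c x
    by (rule resolvent_reflect[OF g(1-4) _ _ M]) (use that in auto)
  have sq: "sq_int (\<lambda>x. g (c + x) - g (c - x))" for c
  proof (rule sq_int_bounded)
    show "\<bar>g (c + x) - g (c - x)\<bar> \<le> 4 * \<omega> * sqrt \<omega>" for x
      using g(2)[of "c + x"] g(2)[of "c - x"] by linarith
  qed (use g(1) in measurable)
  have mono: "nonlin \<omega> (u x) \<le> nonlin \<omega> (u y)" if "u x \<le> u y" for x y
    by (rule nonlin_mono[OF that]) (rule lobe_abs_le[OF u])+
  have s1: "resolvent (2 * \<omega>) g (c - x) \<le> resolvent (2 * \<omega>) g (c + x)" if c: "c \<in> {0..pi / 2}" and x: "x \<in> {0..pi}" for c x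
  proof -
    have "AE y in HP. 0 \<le> g (c + y) - g (c - y)"
      by (rule AE_HP_I) (use mono lobeD(6)[OF u c] in \<open>auto simp: g_def\<close>)
    from resolvent_nonneg[OF sq M this x] show ?thesis using reflc[of c x] c by auto
  qed
  have s2: "resolvent (2 * \<omega>) g (c + x) \<le> resolvent (2 * \<omega>) g (c - x)" if c: "c \<in> {pi / 2..pi}" and x: "x \<in> {0..pi}" for c x
  proof -
    have "AE y in HP. g (c + y) - g (c - y) \<le> 0"
      by (rule AE_HP_I) (use mono lobeD(7)[OF u c] in \<open>auto simp: g_def\<close>)
    from resolvent_upper_bound[OF sq M _ this x] show ?thesis using reflc[of c x] c by auto
  qed
  have b: "0 \<le> resolvent (2 * \<omega>) g x" "resolvent (2 * \<omega>) g x \<le> sqrt \<omega>" if x: "x \<in> {0..pi}" for x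
  proof -
    have "AE x in HP. 0 \<le> g x"
      by (rule AE_HP_I) (use lobeD(4,5)[OF u] \<omega> in \<open>auto simp: g_def intro!: nonlin_nonneg\<close>)
    then show "0 \<le> resolvent (2 * \<omega>) g x" by (rule resolvent_nonneg[OF g(5) M _ x])
    have "AE x in HP. g x \<le> 2 * \<omega> * sqrt \<omega>" using g(2) by (intro AE_I2) (auto intro: order_trans[OF abs_ge_self])
    from resolvent_upper_bound[OF g(5) M _ this x] show "resolvent (2 * \<omega>) g x \<le> sqrt \<omega>" using \<omega> by simp
  qed
  have "lobe (sqrt \<omega>) (resolvent (2 * \<omega>) g)"
    unfolding lobe_def
    using borel_measurable_continuous_onI[OF resolvent_continuous[OF g(5) M]] resolvent_odd[OF g(5) M] resolvent_periodic s1 s2 b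
    by blast
  then show ?thesis unfolding g_def[abs_def] .
qed

text \<open>On the open half period the square wave dominates every function bounded by
  \<open>\<surd>\<omega>\<close>, so monotonicity of \<open>T\<close> makes the iterates decrease
  and keeps them above \<open>\<bar>\<phi>\<bar>\<close> for every solution \<open>\<phi>\<close>.
  Reflection inequalities are closed under pointwise limits.\<close>

lemma maximal_solution:
  assumes \<omega>: "\<omega> > 0"
  obtains U where "lobe (sqrt \<omega>) U" "continuous_on UNIV U" "U = resolvent (2 * \<omega>) (\<lambda>y. nonlin \<omega> (U y))"
    "\<And>\<phi>. \<phi> \<in> borel_measurable borel \<Longrightarrow> AE x in HP. \<bar>\<phi> x\<bar> \<le> sqrt \<omega> \<Longrightarrow>
       (\<And>m. sine_coeff \<phi> m = sine_coeff (\<lambda>x. nonlin \<omega> (\<phi> x)) m / (lam m + 2 * \<omega>)) \<Longrightarrow>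
       AE x in HP. \<bar>\<phi> x\<bar> \<le> U x"
proof -
  define a where "a = sqrt \<omega>"
  have a: "a > 0" using \<omega> by (simp add: a_def)
  have M: "2 * \<omega> > 0" using \<omega> by simp
  define T where "T v = resolvent (2 * \<omega>) (\<lambda>y. nonlin \<omega> (v y))" for v
  define u where "u n = (T ^^ n) (\<lambda>x. a * sgn (sin x))" for n
  have uS: "u (Suc n) = T (u n)" for n by (simp add: u_def)
  have lobe: "lobe a (u n)" for n
  proof (induction n)
    case 0 then show ?case using lobe_square_wave[of a] a by (simp add: u_def)
  next
    case (Suc n) then show ?case using resolvent_lobe[OF _ \<omega>, of "u n"] by (simp add: uS T_def a_def)
  qed
  note nl = nonlin_lobe[OF lobe[unfolded a_def] \<omega>, folded a_def]
  note [measurable] = lobeD(1)[OF lobe]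
  have u0: "u 0 x = a" if "x \<in> {0<..<pi}" for x
    using sin_gt_zero[of x] that by (simp add: u_def)
  have dec: "u (Suc n) x \<le> u n x" if "x \<in> {0<..<pi}" for n x
    using that
  proof (induction n arbitrary: x)
    case 0
    then show ?case using lobeD(5)[OF lobe, of x 1] u0[OF 0] by simp
  next
    case (Suc n)
    have "AE y in HP. nonlin \<omega> (u (Suc n) y) \<le> nonlin \<omega> (u n y)"
      by (rule AE_HP_I') (use Suc.IH lobe_abs_le[OF lobe] in \<open>auto intro!: nonlin_mono simp: a_def\<close>)
    from resolvent_mono[OF nl(5) nl(5) M this] show ?case using Suc.prems unfolding uS[of "Suc n"] uS[of n] T_def
      by (simp add: uS T_def)
  qed
  \<comment> \<open>Monotonicity starts on the open interval only, as the square wave vanishes at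
    \<open>0\<close> and \<open>pi\<close>. The limit is completed by \<open>0\<close> and then
    replaced by \<open>U = T w\<close>, which is continuous everywhere.\<close>
  define w where "w x = (if x \<in> {0<..<pi} then lim (\<lambda>n. u n x) else 0)" for x
  have wm [measurable]: "w \<in> borel_measurable borel" unfolding w_def[abs_def] by measurable
  have lim: "(\<lambda>n. u n x) \<longlonglongrightarrow> w x" if x: "x \<in> {0<..<pi}" for x
  proof -
    have "decseq (\<lambda>n. u n x)" by (rule decseq_SucI) (rule dec[OF x])
    moreover have "0 \<le> u n x" for n using lobeD(4)[OF lobe, of x n] x by simp
    ultimately have "convergent (\<lambda>n. u n x)" by (metis convergentI decseq_convergent)
    then show ?thesis using x by (simp add: w_def convergent_LIMSEQ_iff)
  qed
  have wb: "\<bar>w x\<bar> \<le> a" for x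
  proof (cases "x \<in> {0<..<pi}")
    case True
    show ?thesis by (rule LIMSEQ_le_const2[OF tendsto_rabs[OF lim[OF True]]]) (use lobe_abs_le[OF lobe] in auto)
  qed (use a in \<open>auto simp: w_def\<close>)
  have h: "sq_int (\<lambda>x. nonlin \<omega> (w x))"
    by (rule sq_int_bounded[of _ "2 * \<omega> * sqrt \<omega>"])
      (measurable, use wb \<omega> in \<open>auto intro!: nonlin_bound simp: a_def\<close>)
  define U where "U = T w"
  have L2: "(\<lambda>n. LINT x|HP. (nonlin \<omega> (u n x) - nonlin \<omega> (w x))^2) \<longlonglongrightarrow> (LINT x|HP. 0)"
  proof (rule integral_dominated_convergence[where w = "\<lambda>_. (4 * \<omega> * a)^2"])
    show "AE x in HP. (\<lambda>n. (nonlin \<omega> (u n x) - nonlin \<omega> (w x))^2) \<longlonglongrightarrow> 0"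
    proof (rule AE_HP_I')
      fix x :: real assume "x \<in> {0<..<pi}"
      from lim[OF this] have "(\<lambda>n. (nonlin \<omega> (u n x) - nonlin \<omega> (w x))^2) \<longlonglongrightarrow> (nonlin \<omega> (w x) - nonlin \<omega> (w x))^2"
        unfolding nonlin_def by (intro tendsto_intros)
      then show "(\<lambda>n. (nonlin \<omega> (u n x) - nonlin \<omega> (w x))^2) \<longlonglongrightarrow> 0" by simp
    qed
    show "AE x in HP. norm ((nonlin \<omega> (u n x) - nonlin \<omega> (w x))^2) \<le> (4 * \<omega> * a)^2" for n
    proof (rule AE_I2)
      fix x
      have "\<bar>nonlin \<omega> (w x)\<bar> \<le> 2 * \<omega> * a" using nonlin_bound[of "w x" \<omega>] wb[of x] \<omega> by (simp add: a_def)
      then have "\<bar>nonlin \<omega> (u n x) - nonlin \<omega> (w x)\<bar> \<le> 4 * \<omega> * a" using nl(2)[of n x] by linarith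
      from power_mono[OF this abs_ge_zero, of 2]
      show "norm ((nonlin \<omega> (u n x) - nonlin \<omega> (w x))^2) \<le> (4 * \<omega> * a)^2" by simp
    qed
  qed auto
  have Ulim: "(\<lambda>n. u (Suc n) x) \<longlonglongrightarrow> U x" for x
    unfolding uS U_def T_def by (rule resolvent_tendsto[OF nl(5) h M]) (use L2 in simp)
  have Uw: "U x = w x" if "x \<in> {0<..<pi}" for x
    using LIMSEQ_unique[OF Ulim LIMSEQ_Suc[OF lim[OF that]]] .
  have Ucont: "continuous_on UNIV U" unfolding U_def T_def by (rule resolvent_continuous[OF h M])
  have Um [measurable]: "U \<in> borel_measurable borel" by (rule borel_measurable_continuous_onI[OF Ucont])
  have Ueq: "U = resolvent (2 * \<omega>) (\<lambda>y. nonlin \<omega> (U y))"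
  proof -
    have "sine_coeff (\<lambda>y. nonlin \<omega> (U y)) m = sine_coeff (\<lambda>y. nonlin \<omega> (w y)) m" for m
      by (rule sine_coeff_cong_AE) (auto intro!: AE_HP_I' simp: Uw)
    from resolvent_cong_coeff[OF this, of "2 * \<omega>"] show ?thesis by (simp add: U_def T_def)
  qed
  have Ulobe: "lobe a U"
  proof -
    have "u (Suc n) (c - x) \<le> u (Suc n) (c + x)" if "c \<in> {0..pi / 2}" "x \<in> {0..pi}" for n c x
      using lobeD(6)[OF lobe that] .
    then have 1: "U (c - x) \<le> U (c + x)" if "c \<in> {0..pi / 2}" "x \<in> {0..pi}" for c x
      using that by (intro LIMSEQ_le[OF Ulim Ulim]) auto
    have "u (Suc n) (c + x) \<le> u (Suc n) (c - x)" if "c \<in> {pi / 2..pi}" "x \<in> {0..pi}" for n c x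
      using lobeD(7)[OF lobe that] .
    then have 2: "U (c + x) \<le> U (c - x)" if "c \<in> {pi / 2..pi}" "x \<in> {0..pi}" for c x
      using that by (intro LIMSEQ_le[OF Ulim Ulim]) auto
    have 3: "0 \<le> U x" "U x \<le> a" if "x \<in> {0..pi}" for x
      using LIMSEQ_le_const[OF Ulim[of x], of 0] LIMSEQ_le_const2[OF Ulim[of x], of a]
        lobeD(4,5)[OF lobe that] by auto
    show ?thesis unfolding lobe_def using Um resolvent_odd[OF h M] resolvent_periodic[of "2 * \<omega>"] 1 2 3
      by (auto simp: U_def T_def)
  qed
  have max: "AE x in HP. \<bar>\<phi> x\<bar> \<le> U x"
    if \<phi>m [measurable]: "\<phi> \<in> borel_measurable borel" and \<phi>a: "AE x in HP. \<bar>\<phi> x\<bar> \<le> sqrt \<omega>"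
      and coeff: "\<And>m. sine_coeff \<phi> m = sine_coeff (\<lambda>x. nonlin \<omega> (\<phi> x)) m / (lam m + 2 * \<omega>)" for \<phi>
  proof -
    have sq\<phi>: "sq_int \<phi>" by (rule sq_int_AE_bounded[OF \<phi>m \<phi>a])
    have sqn: "sq_int (\<lambda>x. nonlin \<omega> (\<phi> x))"
    proof (rule sq_int_AE_bounded)
      show "AE x in HP. \<bar>nonlin \<omega> (\<phi> x)\<bar> \<le> 2 * \<omega> * sqrt \<omega>"
        using \<phi>a by eventually_elim (rule nonlin_bound, use \<omega> in auto)
    qed measurable
    have fixp: "AE x in HP. \<phi> x = resolvent (2 * \<omega>) (\<lambda>x. nonlin \<omega> (\<phi> x)) x"
      by (rule sine_coeff_eq_imp_AE_eq[OF sq_int_integrable[OF sq\<phi>] sq_int_integrable[OF resolvent_sq_int[OF sqn M]]])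
        (simp add: sine_coeff_resolvent[OF sqn M] coeff)
    have "AE x in HP. \<bar>\<phi> x\<bar> \<le> u n x" for n
    proof (induction n)
      case 0
      have "AE x in HP. u 0 x = a" by (rule AE_HP_I'[OF u0])
      with \<phi>a show ?case by eventually_elim (simp add: a_def)
    next
      case (Suc n)
      \<comment> \<open>The second inequality treats \<open>- \<phi>\<close>, which is a solution
        too because \<open>nonlin\<close> is odd.\<close>
      have le: "AE x in HP. nonlin \<omega> (\<phi> x) \<le> nonlin \<omega> (u n x)" "AE x in HP. (-1) * nonlin \<omega> (\<phi> x) \<le> nonlin \<omega> (u n x)"
        using Suc \<phi>a
        by (eventually_elim, use lobe_abs_le[OF lobe] in \<open>auto intro!: nonlin_mono simp: a_def nonlin_minus[symmetric]\<close>)+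
      have b1: "resolvent (2 * \<omega>) (\<lambda>x. nonlin \<omega> (\<phi> x)) x \<le> u (Suc n) x" if "x \<in> {0..pi}" for x
        unfolding uS T_def by (rule resolvent_mono[OF sqn nl(5) M le(1) that])
      have b2: "- resolvent (2 * \<omega>) (\<lambda>x. nonlin \<omega> (\<phi> x)) x \<le> u (Suc n) x" if "x \<in> {0..pi}" for x
        using resolvent_mono[OF sq_int_cmult[OF sqn, of "-1"] nl(5) M le(2) that] resolvent_cmult[OF sqn M, of "-1" x]
        unfolding uS T_def by simp
      have "AE x in HP. \<bar>resolvent (2 * \<omega>) (\<lambda>x. nonlin \<omega> (\<phi> x)) x\<bar> \<le> u (Suc n) x"
        by (rule AE_HP_I) (use b1 b2 in \<open>auto simp: abs_le_iff\<close>)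
      with fixp show ?case by eventually_elim simp
    qed
    then have "AE x in HP. \<forall>n. \<bar>\<phi> x\<bar> \<le> u n x" by (simp add: AE_all_countable)
    then show ?thesis by eventually_elim (auto intro: LIMSEQ_le_const[OF Ulim])
  qed
  show ?thesis
    by (rule that[OF Ulobe[unfolded a_def] Ucont Ueq max])
qed

text \<open>The reflected difference of \<open>nonlin \<omega> (U x)\<close> is nonnegative on the
  half period, and its first sine coefficient is \<open>2 cos c\<close> times that of
  \<open>nonlin \<omega> (U x)\<close>, positive for \<open>c < pi / 2\<close>; strict positivity of
  the resolvent applies to it.\<close>

lemma lobe_strict:
  assumes U: "lobe (sqrt \<omega>) U" and eq: "U = resolvent (2 * \<omega>) (\<lambda>y. nonlin \<omega> (U y))"
    and \<omega>: "\<omega> > 0" and nz: "\<not> (AE x in HP. U x = 0)"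
    and c: "0 \<le> c" "c < pi / 2" and x: "x \<in> {0<..<pi}"
  shows "U (c - x) < U (c + x)"
proof -
  define g where "g x = nonlin \<omega> (U x)" for x
  note g = nonlin_lobe[OF U \<omega>, folded g_def[abs_def] g_def]
  have M: "2 * \<omega> > 0" using \<omega> by simp
  have g0: "0 \<le> g x" if "x \<in> {0..pi}" for x
    using lobeD(4,5)[OF U that] \<omega> unfolding g_def by (intro nonlin_nonneg) auto
  have g1: "sine_coeff g 1 > 0"
  proof (rule ccontr)
    assume "\<not> sine_coeff g 1 > 0"
    then have "(LINT x|HP. g x * sin (real 1 * x)) \<le> 0"
      unfolding sine_coeff_def by (metis linorder_not_le mult_pos_pos pi_gt_zero zero_less_divide_iff zero_less_numeral)
    moreover have nn: "AE x in HP. 0 \<le> g x * sin (real 1 * x)"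
      by (rule AE_HP_I) (use g0 sin_ge_zero in auto)
    ultimately have "(LINT x|HP. g x * sin (real 1 * x)) = 0" using integral_nonneg_AE[OF nn] by simp
    then have "AE x in HP. g x * sin (real 1 * x) = 0"
      using integral_nonneg_eq_0_iff_AE[OF integrable_mult_sin[OF sq_int_integrable[OF g(5)], of 1] nn] by simp
    moreover have "AE x in HP. sin (real 1 * x) \<noteq> 0 \<and> 0 \<le> U x \<and> U x \<le> sqrt \<omega>"
      by (rule AE_HP_I') (use lobeD(4,5)[OF U] sin_gt_zero in force)
    ultimately have "AE x in HP. U x = 0"
      by eventually_elim (metis g_def less_eq_real_def mult_eq_0_iff nonlin_pos order_less_irrefl)
    then show False using nz by simp
  qed
  have sq: "sq_int (\<lambda>x. g (c + x) - g (c - x))"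
  proof (rule sq_int_bounded)
    show "\<bar>g (c + x) - g (c - x)\<bar> \<le> 4 * \<omega> * sqrt \<omega>" for x
      using g(2)[of "c + x"] g(2)[of "c - x"] by linarith
  qed (use g(1) in measurable)
  have "AE y in HP. 0 \<le> g (c + y) - g (c - y)"
    by (rule AE_HP_I)
      (use lobeD(6)[OF U, of c] lobe_abs_le[OF U] c in \<open>auto simp: g_def intro!: nonlin_mono\<close>)
  moreover have "sine_coeff (\<lambda>x. g (c + x) - g (c - x)) 1 > 0"
  proof -
    have "sine_coeff (\<lambda>x. g (c + x) - g (c - x)) 1 = 2 * cos (real 1 * c) * sine_coeff g 1"
      by (rule sine_coeff_reflect[OF g(1-4) c(1)]) (use c in auto)
    moreover have "cos (real 1 * c) > 0" using cos_gt_zero_pi[of c] c by simp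
    ultimately show ?thesis using g1 by simp
  qed
  ultimately have "0 < resolvent (2 * \<omega>) (\<lambda>x. g (c + x) - g (c - x)) x"
    by (intro resolvent_pos[OF sq M _ _ x])
  also have "\<dots> = resolvent (2 * \<omega>) g (c + x) - resolvent (2 * \<omega>) g (c - x)"
    by (rule resolvent_reflect[OF g(1-4) _ _ M]) (use c in auto)
  also have "resolvent (2 * \<omega>) g = U" using eq unfolding g_def[abs_def] ..
  finally show ?thesis by simp
qed

end

section \<open>From reflection inequalities to the two-lobe profile\<close>

lemma not_eventually_nhds_right:
  fixes x :: real
  assumes "x < r" "\<And>z. x < z \<Longrightarrow> z < r \<Longrightarrow> \<not> P z"
  shows "\<not> (\<forall>\<^sub>F y in nhds x. P y)"
proof
  assume "\<forall>\<^sub>F y in nhds x. P y"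
  then obtain d where d: "d > 0" "\<And>y. dist y x < d \<Longrightarrow> P y" by (auto simp: eventually_nhds_metric)
  define z where "z = x + min (d / 2) ((r - x) / 2)"
  have "x < z" "z < r" "dist z x < d" using d assms(1) unfolding z_def dist_real_def by (auto simp: min_def field_simps)
  then show False using assms(2) d by blast
qed

lemma not_eventually_nhds_left:
  fixes x :: real
  assumes "l < x" "\<And>z. l < z \<Longrightarrow> z < x \<Longrightarrow> \<not> P z"
  shows "\<not> (\<forall>\<^sub>F y in nhds x. P y)"
proof
  assume "\<forall>\<^sub>F y in nhds x. P y"
  then obtain d where d: "d > 0" "\<And>y. dist y x < d \<Longrightarrow> P y" by (auto simp: eventually_nhds_metric)
  define z where "z = x - min (d / 2) ((x - l) / 2)"
  have "l < z" "z < x" "dist z x < d" using d assms(1) unfolding z_def dist_real_def by (auto simp: min_def field_simps)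
  then show False using assms(2) d by blast
qed

lemma two_lobe_profileI:
  assumes U: "lobe a U"
    and strict: "\<And>c x. 0 \<le> c \<Longrightarrow> c < pi / 2 \<Longrightarrow> x \<in> {0<..<pi} \<Longrightarrow> U (c - x) < U (c + x)"
  shows "two_lobe_profile U"
proof -
  note odd = lobeD(2)[OF U] and per = lobeD(3)[OF U]
  \<comment> \<open>Reflection about the midpoint, with half the distance as argument; a negative
    midpoint is carried to a positive one by oddness.\<close>
  have inc: "U y < U z" if yz: "- pi / 2 \<le> y" "y < z" "z \<le> pi / 2" for y z
  proof (cases "y + z \<ge> 0")
    case True
    then show ?thesis using strict[of "(y + z) / 2" "(z - y) / 2"] yz by (simp add: field_simps)
  next
    case False
    then have "U (- z) < U (- y)" using strict[of "- (y + z) / 2" "(z - y) / 2"] yz by (simp add: field_simps)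
    then show ?thesis by (simp add: odd)
  qed
  have sym: "U (pi - y) = U y" if "- pi / 2 \<le> y" "y \<le> 3 * pi / 2" for y
  proof -
    have "U (pi / 2 + x) = U (pi / 2 - x)" if "x \<in> {0..pi}" for x
      using lobeD(6,7)[OF U, of "pi / 2" x] that by (intro antisym) auto
    from this[of "y - pi / 2"] this[of "pi / 2 - y"] show ?thesis using that by (cases "y \<ge> pi / 2") auto
  qed
  \<comment> \<open>This range and the next reach beyond \<open>\<plusminus>pi\<close>, so that
    neighbourhoods of the endpoints in \<open>\<real>\<close> are covered.\<close>
  have dec: "U z < U y" if yz: "pi / 2 \<le> y" "y < z" "z \<le> 3 * pi / 2" for y z
    using inc[of "pi - z" "pi - y"] sym[of y] sym[of z] yz by simp
  have dec': "U z < U y" if yz: "- 3 * pi / 2 \<le> y" "y < z" "z \<le> - pi / 2" for y z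
    using dec[of "y + 2 * pi" "z + 2 * pi"] yz by (simp add: per)
  have max: "(\<forall>\<^sub>F y in nhds x. U y \<le> U x) \<longleftrightarrow> x = pi / 2" if x: "x \<in> {-pi..pi}" for x
  proof
    assume ev: "\<forall>\<^sub>F y in nhds x. U y \<le> U x"
    show "x = pi / 2"
    proof (rule ccontr)
      assume "x \<noteq> pi / 2"
      then consider "- pi / 2 \<le> x" "x < pi / 2" | "pi / 2 < x" | "x < - pi / 2" by linarith
      then show False
      proof cases
        case 1
        have "\<not> U z \<le> U x" if "x < z" "z < pi / 2" for z
          using inc[of x z] that 1 by auto
        then show False using not_eventually_nhds_right[OF 1(2), of "\<lambda>y. U y \<le> U x"] ev by blast
      next
        case 2
        have "\<not> U z \<le> U x" if "pi / 2 < z" "z < x" for z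
          using dec[of z x] that x pi_gt_zero by auto
        then show False using not_eventually_nhds_left[OF 2, of "\<lambda>y. U y \<le> U x"] ev by blast
      next
        case 3
        have l: "- 3 * pi / 2 < x" using x pi_gt_zero unfolding atLeastAtMost_iff by linarith
        have "\<not> U z \<le> U x" if "- 3 * pi / 2 < z" "z < x" for z
          using dec'[of z x] that 3 by auto
        then show False using not_eventually_nhds_left[OF l, of "\<lambda>y. U y \<le> U x"] ev by blast
      qed
    qed
  next
    assume x: "x = pi / 2"
    have "\<forall>\<^sub>F y in nhds x. y \<in> {- pi / 2<..<3 * pi / 2}"
      by (rule eventually_nhds_in_open) (auto simp: x)
    then show "\<forall>\<^sub>F y in nhds x. U y \<le> U x"
    proof eventually_elim
      case (elim y)
      consider "y < x" | "y = x" | "x < y" by linarith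
      then show ?case
      proof cases
        case 2
        then show ?thesis by simp
      qed (use inc[of y x] dec[of x y] elim in \<open>auto simp: x\<close>)
    qed
  qed
  have min: "(\<forall>\<^sub>F y in nhds x. U x \<le> U y) \<longleftrightarrow> x = - pi / 2" if x: "x \<in> {-pi..pi}" for x
  proof
    assume ev: "\<forall>\<^sub>F y in nhds x. U x \<le> U y"
    show "x = - pi / 2"
    proof (rule ccontr)
      assume "x \<noteq> - pi / 2"
      then consider "- pi / 2 < x" "x \<le> pi / 2" | "pi / 2 < x" | "x < - pi / 2" by linarith
      then show False
      proof cases
        case 1
        have "\<not> U x \<le> U z" if "- pi / 2 < z" "z < x" for z
          using inc[of z x] that 1 by auto
        then show False using not_eventually_nhds_left[OF 1(1), of "\<lambda>y. U x \<le> U y"] ev by blast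
      next
        case 2
        have r: "x < 3 * pi / 2" using x pi_gt_zero unfolding atLeastAtMost_iff by linarith
        have "\<not> U x \<le> U z" if "x < z" "z < 3 * pi / 2" for z
          using dec[of x z] that 2 by auto
        then show False using not_eventually_nhds_right[OF r, of "\<lambda>y. U x \<le> U y"] ev by blast
      next
        case 3
        have "\<not> U x \<le> U z" if "x < z" "z < - pi / 2" for z
          using dec'[of x z] that x pi_gt_zero by auto
        then show False using not_eventually_nhds_right[OF 3, of "\<lambda>y. U x \<le> U y"] ev by blast
      qed
    qed
  next
    assume x: "x = - pi / 2"
    have "\<forall>\<^sub>F y in nhds x. y \<in> {- 3 * pi / 2<..<pi / 2}"
      by (rule eventually_nhds_in_open) (auto simp: x)
    then show "\<forall>\<^sub>F y in nhds x. U x \<le> U y"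
    proof eventually_elim
      case (elim y)
      consider "y < x" | "y = x" | "x < y" by linarith
      then show ?case
      proof cases
        case 2
        then show ?thesis by simp
      qed (use inc[of x y] dec'[of y x] elim in \<open>auto simp: x\<close>)
    qed
  qed
  show ?thesis unfolding two_lobe_profile_def
  proof (intro conjI set_eqI)
    fix x
    have "pi / 2 \<in> {-pi..pi}" "- pi / 2 \<in> {-pi..pi}"
      using pi_gt_zero unfolding atLeastAtMost_iff by linarith+
    then show "x \<in> {x \<in> {-pi..pi}. \<forall>\<^sub>F y in nhds x. U y \<le> U x} \<longleftrightarrow> x \<in> {pi / 2}"
      "x \<in> {x \<in> {-pi..pi}. \<forall>\<^sub>F y in nhds x. U x \<le> U y} \<longleftrightarrow> x \<in> {- pi / 2}"
      using max[of x] min[of x] by blast+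
  qed
qed

section \<open>Convexity of the energy\<close>

context fractional_exponent
begin

text \<open>The Yosida approximation \<open>M (1 - M T\<^sub>M)\<close> has multipliers
  \<open>M lam / (lam + M)\<close> increasing to \<open>lam\<close>, and expresses the quadratic
  form through the positive operator \<open>T\<^sub>M\<close>.\<close>

lemma quadratic_form_series:
  assumes g: "sq_int g" and M: "M > 0"
  shows "(\<lambda>m. M * lam m / (lam m + M) * (sine_coeff g m)^2) sums
    (2 / pi * (M * ((LINT x|HP. (g x)^2) - M * (LINT x|HP. g x * resolvent M g x))))"
proof -
  have "(\<lambda>m. M * (sine_coeff g m * sine_coeff g m - M * (sine_coeff g m * sine_coeff (resolvent M g) m))) sums
     (M * (2 / pi * (LINT x|HP. g x * g x) - M * (2 / pi * (LINT x|HP. g x * resolvent M g x))))"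
    by (intro sums_mult sums_diff parseval g resolvent_sq_int M)
  moreover have "M * (sine_coeff g m * sine_coeff g m - M * (sine_coeff g m * sine_coeff (resolvent M g) m)) =
      M * lam m / (lam m + M) * (sine_coeff g m)^2" for m
    using lam_M_pos[OF M, of m] unfolding sine_coeff_resolvent[OF g M] by (simp add: field_simps power2_eq_square)
  moreover have "M * (2 / pi * (LINT x|HP. g x * g x) - M * (2 / pi * (LINT x|HP. g x * resolvent M g x))) =
      2 / pi * (M * ((LINT x|HP. (g x)^2) - M * (LINT x|HP. g x * resolvent M g x)))"
    by (simp add: power2_eq_square algebra_simps)
  ultimately show ?thesis by simp
qed

text \<open>Convexity of \<open>\<rho> \<mapsto> \<langle>(-\<Delta>)\<^sup>s \<surd>\<rho>, \<surd>\<rho>\<rangle>\<close>. Positivity of the resolvent gives a pointwise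
  Cauchy-Schwarz inequality: at each point choose the unit vector along \<open>(v1, v2)\<close>.\<close>

lemma quadratic_form_convex:
  assumes v: "sq_int v1" "sq_int v2" and V: "sq_int V"
    and eq: "\<And>x. x \<in> {0<..<pi} \<Longrightarrow> 0 \<le> V x \<and> (V x)^2 = (v1 x)^2 + (v2 x)^2"
    and s1: "summable (\<lambda>m. lam m * (sine_coeff v1 m)^2)"
    and s2: "summable (\<lambda>m. lam m * (sine_coeff v2 m)^2)"
  shows "summable (\<lambda>m. lam m * (sine_coeff V m)^2)"
    "(\<Sum>m. lam m * (sine_coeff V m)^2) \<le>
       (\<Sum>m. lam m * (sine_coeff v1 m)^2) + (\<Sum>m. lam m * (sine_coeff v2 m)^2)"
proof -
  define Q where "Q = (\<Sum>m. lam m * (sine_coeff v1 m)^2) + (\<Sum>m. lam m * (sine_coeff v2 m)^2)"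
  define E where "E M g = 2 / pi * (M * ((LINT x|HP. (g x)^2) - M * (LINT x|HP. g x * resolvent M g x)))" for M g
  have form: "(LINT x|HP. v1 x * resolvent M v1 x) + (LINT x|HP. v2 x * resolvent M v2 x) \<le> (LINT x|HP. V x * resolvent M V x)"
    if M: "M > 0" for M
  proof -
    note int = sq_int_mult[OF v(1) resolvent_sq_int[OF v(1) M]] sq_int_mult[OF v(2) resolvent_sq_int[OF v(2) M]]
      sq_int_mult[OF V resolvent_sq_int[OF V M]]
    have "(LINT x|HP. v1 x * resolvent M v1 x + v2 x * resolvent M v2 x) \<le> (LINT x|HP. V x * resolvent M V x)"
    proof (rule integral_mono_AE)
      show "AE x in HP. v1 x * resolvent M v1 x + v2 x * resolvent M v2 x \<le> V x * resolvent M V x"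
      proof (rule AE_HP_I')
        fix x :: real assume x: "x \<in> {0<..<pi}"
        show "v1 x * resolvent M v1 x + v2 x * resolvent M v2 x \<le> V x * resolvent M V x"
        proof (cases "V x = 0")
          case True
          then have "v1 x = 0 \<and> v2 x = 0" using eq[OF x] by (simp add: sum_power2_eq_zero_iff)
          then show ?thesis using True by simp
        next
          case False
          then have Vx: "V x > 0" using eq[OF x] by simp
          define e1 e2 where "e1 = v1 x / V x" and "e2 = v2 x / V x"
          have e: "e1^2 + e2^2 = 1"
          proof -
            have "(v1 x)^2 + (v2 x)^2 = (V x)^2" using eq[OF x] by simp
            then show ?thesis
              using Vx unfolding e1_def e2_def power_divide add_divide_distrib[symmetric] by simp
          qed
          have le: "e1 * v1 y + e2 * v2 y \<le> V y" if y: "y \<in> {0<..<pi}" for y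
          proof (rule power2_le_imp_le)
            have "(e1 * v1 y + e2 * v2 y)^2 + (e1 * v2 y - e2 * v1 y)^2 = (e1^2 + e2^2) * ((v1 y)^2 + (v2 y)^2)"
              by (simp add: power2_eq_square algebra_simps)
            then have "(e1 * v1 y + e2 * v2 y)^2 + (e1 * v2 y - e2 * v1 y)^2 = (V y)^2"
              using e eq[OF y] by simp
            then show "(e1 * v1 y + e2 * v2 y)^2 \<le> (V y)^2" by (smt (verit) zero_le_power2)
          qed (use eq[OF y] in simp)
          have "resolvent M (\<lambda>y. e1 * v1 y + e2 * v2 y) x \<le> resolvent M V x"
            by (rule resolvent_mono[OF sq_int_add[OF sq_int_cmult sq_int_cmult] V M])
              (use v x le in \<open>auto intro!: AE_HP_I'\<close>)
          then have "e1 * resolvent M v1 x + e2 * resolvent M v2 x \<le> resolvent M V x"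
            using resolvent_add[OF sq_int_cmult[OF v(1)] sq_int_cmult[OF v(2)] M] resolvent_cmult[OF v(1) M] resolvent_cmult[OF v(2) M]
            by simp
          then have "V x * (e1 * resolvent M v1 x + e2 * resolvent M v2 x) \<le> V x * resolvent M V x"
            using Vx by (intro mult_left_mono) auto
          then show ?thesis using Vx unfolding e1_def e2_def by (simp add: distrib_left)
        qed
      qed
    qed (use int in auto)
    then show ?thesis using int by simp
  qed
  have VV: "(LINT x|HP. (V x)^2) = (LINT x|HP. (v1 x)^2) + (LINT x|HP. (v2 x)^2)"
  proof -
    have "(LINT x|HP. (V x)^2) = (LINT x|HP. (v1 x)^2 + (v2 x)^2)"
      by (rule integral_cong_AE) (use eq v V in \<open>auto intro!: AE_HP_I' dest!: sq_int_measurable\<close>)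
    then show ?thesis using v by (simp add: sq_int_def)
  qed
  have E_le: "E M g \<le> (\<Sum>m. lam m * (sine_coeff g m)^2)"
    if g: "sq_int g" and s: "summable (\<lambda>m. lam m * (sine_coeff g m)^2)" and M: "M > 0" for M g
  proof -
    have "M * lam m / (lam m + M) \<le> lam m" for m
      by (subst pos_divide_le_eq[OF lam_M_pos[OF M]]) (simp add: distrib_left mult.commute)
    then have "M * lam m / (lam m + M) * (sine_coeff g m)^2 \<le> lam m * (sine_coeff g m)^2" for m
      by (intro mult_right_mono) auto
    from sums_le[OF this quadratic_form_series[OF g M] summable_sums[OF s]] show ?thesis unfolding E_def .
  qed
  \<comment> \<open>The masses add up by \<open>VV\<close>, and \<open>T\<^sub>M\<close> enters
    \<open>E\<close> with a minus sign, so the lower bound \<open>form\<close> becomes an upper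
    bound for \<open>E M V\<close>.\<close>
  have EV: "E M V \<le> Q" if M: "M > 0" for M
  proof -
    have "E M V \<le> E M v1 + E M v2"
    proof -
      have "M * (M * ((LINT x|HP. v1 x * resolvent M v1 x) + (LINT x|HP. v2 x * resolvent M v2 x))) \<le> M * (M * (LINT x|HP. V x * resolvent M V x))"
        using form[OF M] M by simp
      then have "M * ((LINT x|HP. (V x)^2) - M * (LINT x|HP. V x * resolvent M V x)) \<le>
          M * ((LINT x|HP. (v1 x)^2) - M * (LINT x|HP. v1 x * resolvent M v1 x)) +
          M * ((LINT x|HP. (v2 x)^2) - M * (LINT x|HP. v2 x * resolvent M v2 x))"
        unfolding VV by (simp add: algebra_simps)
      from mult_left_mono[OF this, of "2 / pi"] show ?thesis unfolding E_def by (simp add: distrib_left)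
    qed
    also have "\<dots> \<le> Q" unfolding Q_def by (intro add_mono E_le v s1 s2 M)
    finally show ?thesis .
  qed
  \<comment> \<open>Only finite partial sums are passed to the limit
    \<open>M \<rightarrow> \<infinity>\<close>, since summability for \<open>V\<close> is not yet
    known.\<close>
  have part: "(\<Sum>m<N. lam m * (sine_coeff V m)^2) \<le> Q" for N
  proof -
    have lim: "(\<lambda>n. \<Sum>m<N. real (Suc n) * lam m / (lam m + real (Suc n)) * (sine_coeff V m)^2) \<longlonglongrightarrow> (\<Sum>m<N. lam m * (sine_coeff V m)^2)"
    proof (intro tendsto_sum tendsto_mult tendsto_const)
      fix m
      have "filterlim (\<lambda>n. lam m + real (Suc n)) at_top sequentially"
        by (intro filterlim_tendsto_add_at_top[OF tendsto_const]
            filterlim_compose[OF filterlim_real_sequentially filterlim_Suc])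
      then have "(\<lambda>n. lam m - lam m * (lam m / (lam m + real (Suc n)))) \<longlonglongrightarrow> lam m - lam m * 0"
        by (intro tendsto_diff tendsto_mult tendsto_const real_tendsto_divide_at_top[OF tendsto_const])
      moreover have "lam m - lam m * (lam m / (lam m + real (Suc n))) = real (Suc n) * lam m / (lam m + real (Suc n))" for n
        using lam_M_pos[of "real (Suc n)" m] by (simp add: field_simps)
      ultimately show "(\<lambda>n. real (Suc n) * lam m / (lam m + real (Suc n))) \<longlonglongrightarrow> lam m" by simp
    qed
    have "(\<Sum>m<N. real (Suc n) * lam m / (lam m + real (Suc n)) * (sine_coeff V m)^2) \<le> Q" for n
    proof -
      have M: "real (Suc n) > 0" by simp
      note ser = quadratic_form_series[OF V M]
      have "(\<Sum>m<N. real (Suc n) * lam m / (lam m + real (Suc n)) * (sine_coeff V m)^2) \<le>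
          (\<Sum>m. real (Suc n) * lam m / (lam m + real (Suc n)) * (sine_coeff V m)^2)"
        using lam_nonneg by (intro sum_le_suminf[OF sums_summable[OF ser]]) (auto intro!: mult_nonneg_nonneg divide_nonneg_nonneg)
      also have "\<dots> = E (real (Suc n)) V" unfolding E_def by (rule sums_unique[OF ser, symmetric])
      also have "\<dots> \<le> Q" by (rule EV[OF M])
      finally show ?thesis .
    qed
    then show ?thesis by (intro LIMSEQ_le_const2[OF lim]) auto
  qed
  show 1: "summable (\<lambda>m. lam m * (sine_coeff V m)^2)"
    by (rule summableI_nonneg_bounded[OF _ part]) simp
  show "(\<Sum>m. lam m * (sine_coeff V m)^2) \<le>
       (\<Sum>m. lam m * (sine_coeff v1 m)^2) + (\<Sum>m. lam m * (sine_coeff v2 m)^2)"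
    unfolding Q_def[symmetric] by (rule suminf_le_const[OF 1 part])
qed

text \<open>The equation paired with \<open>\<psi>\<close> by Parseval; this turns the quadratic
  forms of solutions into integrals of powers.\<close>

lemma solution_quadratic_form:
  assumes \<psi>m [measurable]: "\<psi> \<in> borel_measurable borel" and B: "AE x in HP. \<bar>\<psi> x\<bar> \<le> B"
    and coeff: "\<And>m. sine_coeff (\<lambda>x. \<omega> * \<psi> x - \<psi> x ^ 3) m = lam m * sine_coeff \<psi> m"
  shows "(\<lambda>m. lam m * (sine_coeff \<psi> m)^2) sums (2 / pi * (\<omega> * (LINT x|HP. (\<psi> x)^2) - (LINT x|HP. \<psi> x ^ 4)))"
    "integrable HP (\<lambda>x. \<psi> x ^ 4)"
proof -
  have \<psi>: "sq_int \<psi>" by (rule sq_int_AE_bounded[OF \<psi>m B])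
  have pow: "AE x in HP. \<bar>\<psi> x ^ k\<bar> \<le> B ^ k" for k
    using B by eventually_elim (auto simp: power_abs intro: power_mono)
  have \<psi>3: "sq_int (\<lambda>x. \<psi> x ^ 3)" by (rule sq_int_AE_bounded[OF _ pow]) measurable
  have w: "sq_int (\<lambda>x. \<omega> * \<psi> x - \<psi> x ^ 3)" by (intro sq_int_diff sq_int_cmult \<psi> \<psi>3)
  show i4: "integrable HP (\<lambda>x. \<psi> x ^ 4)"
    using sq_int_mult[OF \<psi> \<psi>3] by (simp add: power_Suc[symmetric] del: power_Suc)
  have "(LINT x|HP. (\<omega> * \<psi> x - \<psi> x ^ 3) * \<psi> x) = (LINT x|HP. \<omega> * (\<psi> x)^2 - \<psi> x ^ 4)"
    by (simp add: left_diff_distrib power2_eq_square mult.assoc power3_eq_cube power4_eq_xxxx)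
  also have "\<dots> = \<omega> * (LINT x|HP. (\<psi> x)^2) - (LINT x|HP. \<psi> x ^ 4)"
    using i4 sq_int_integrable_sq[OF \<psi>] by simp
  finally have "2 / pi * (LINT x|HP. (\<omega> * \<psi> x - \<psi> x ^ 3) * \<psi> x) = 2 / pi * (\<omega> * (LINT x|HP. (\<psi> x)^2) - (LINT x|HP. \<psi> x ^ 4))"
    by simp
  then show "(\<lambda>m. lam m * (sine_coeff \<psi> m)^2) sums (2 / pi * (\<omega> * (LINT x|HP. (\<psi> x)^2) - (LINT x|HP. \<psi> x ^ 4)))"
    using parseval[OF w \<psi>] unfolding coeff by (simp add: power2_eq_square mult.assoc)
qed

text \<open>\<open>energy s\<close> for odd functions: its factor \<open>1/2\<close> cancels against
  the two halves of the period, and \<open>pi / 2\<close> comes from Parseval.\<close>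

definition sine_energy :: "(real \<Rightarrow> real) \<Rightarrow> real" where
  "sine_energy g = pi / 2 * (\<Sum>m. lam m * (sine_coeff g m)^2) + 1 / 2 * (LINT x|HP. g x ^ 4)"

text \<open>The competitor \<open>\<surd>((1 - t \<kappa>) \<psi>\<^sup>2 + t U\<^sup>2)\<close> has the same mass as \<open>\<psi>\<close>; the derivative of its energy
  at \<open>t = 0\<close> is \<open>\<integral> U\<^sup>2 (\<psi>\<^sup>2 - U\<^sup>2)\<close>.\<close>

lemma minimizer_dominates_maximal_solution:
  assumes \<psi>c: "continuous_on UNIV \<psi>" and \<psi>odd: "\<And>x. \<psi> (- x) = - \<psi> x" and \<psi>per: "\<And>x. \<psi> (x + 2 * pi) = \<psi> x"
    and \<psi>a: "\<And>x. \<bar>\<psi> x\<bar> \<le> a"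
    and \<psi>eq: "\<And>m. sine_coeff (\<lambda>x. \<omega> * \<psi> x - \<psi> x ^ 3) m = lam m * sine_coeff \<psi> m"
    and Uc: "continuous_on UNIV U" and U: "lobe a U"
    and Ueq: "\<And>m. sine_coeff (\<lambda>x. \<omega> * U x - U x ^ 3) m = lam m * sine_coeff U m"
    and pos: "(LINT x|HP. (\<psi> x)^2) > 0"
    and minimal: "\<And>V. V \<in> borel_measurable borel \<Longrightarrow> (\<And>x. V (- x) = - V x) \<Longrightarrow> (\<And>x. V (x + 2 * pi) = V x) \<Longrightarrow>
      (\<exists>B. \<forall>x. \<bar>V x\<bar> \<le> B) \<Longrightarrow> summable (\<lambda>m. lam m * (sine_coeff V m)^2) \<Longrightarrow>
      (LINT x|HP. (V x)^2) = (LINT x|HP. (\<psi> x)^2) \<Longrightarrow> sine_energy \<psi> \<le> sine_energy V"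
  shows "(LINT x|HP. U x ^ 4) \<le> (LINT x|HP. (\<psi> x)^2 * (U x)^2)"
proof -
  have [measurable]: "\<psi> \<in> borel_measurable borel" "U \<in> borel_measurable borel"
    using \<psi>c Uc by (auto intro: borel_measurable_continuous_onI)
  note Ua = lobe_abs_le[OF U]
  have a0: "a \<ge> 0" using order_trans[OF abs_ge_zero \<psi>a] .
  have sq: "sq_int \<psi>" "sq_int U" using \<psi>a Ua by (auto intro: sq_int_bounded[of _ a])
  have i22: "integrable HP (\<lambda>x. f x * g x)" if "f \<in> borel_measurable borel" "g \<in> borel_measurable borel"
    "\<And>x. \<bar>f x\<bar> \<le> b" "\<And>x. \<bar>g x\<bar> \<le> c" for f g :: "real \<Rightarrow> real" and b c
    by (rule sq_int_mult) (use that in \<open>auto intro: sq_int_bounded\<close>)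
  have \<psi>2: "\<bar>(\<psi> x)^2\<bar> \<le> a^2" and U2: "\<bar>(U x)^2\<bar> \<le> a^2" for x
    using power_mono[OF \<psi>a abs_ge_zero, of x 2] power_mono[OF Ua abs_ge_zero, of x 2] by simp_all
  define A where "A = (LINT x|HP. (\<psi> x)^2)"
  define B where "B = (LINT x|HP. (U x)^2)"
  define P4 where "P4 = (LINT x|HP. \<psi> x ^ 4)"
  define U4 where "U4 = (LINT x|HP. U x ^ 4)"
  define X where "X = (LINT x|HP. (\<psi> x)^2 * (U x)^2)"
  \<comment> \<open>Ratio of the masses, so that adding \<open>t U^2\<close> is compensated by
    removing \<open>t \<kappa> \<psi>^2\<close>.\<close>
  define \<kappa> where "\<kappa> = B / A"
  define D where "D x = (U x)^2 - \<kappa> * (\<psi> x)^2" for x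
  define R where "R = (LINT x|HP. (D x)^2)"
  have A: "A > 0" using pos by (simp add: A_def)
  have B0: "B \<ge> 0" by (simp add: B_def)
  have \<kappa>0: "\<kappa> \<ge> 0" using A B0 by (simp add: \<kappa>_def)
  have \<kappa>A: "\<kappa> * A = B" using A by (simp add: \<kappa>_def)
  note Q\<psi> = solution_quadratic_form[OF \<open>\<psi> \<in> _\<close> _ \<psi>eq, of a, OF AE_I2[OF \<psi>a]]
  note QU = solution_quadratic_form[OF \<open>U \<in> _\<close> _ Ueq, of a, OF AE_I2[OF Ua]]
  have Dm [measurable]: "D \<in> borel_measurable borel" unfolding D_def[abs_def] by measurable
  have Db: "\<bar>D x\<bar> \<le> a^2 + \<kappa> * a^2" for x
  proof -
    have "\<bar>\<kappa> * (\<psi> x)^2\<bar> \<le> \<kappa> * a^2" using \<psi>2[of x] \<kappa>0 by (simp add: mult_left_mono)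
    then show ?thesis using U2[of x] unfolding D_def by linarith
  qed
  have iD: "integrable HP (\<lambda>x. (\<psi> x)^2 * D x)" by (rule i22[OF _ Dm \<psi>2 Db]) measurable
  have iDD: "integrable HP (\<lambda>x. (D x)^2)" using i22[OF Dm Dm Db Db] by (simp add: power2_eq_square)
  have \<psi>D: "(LINT x|HP. (\<psi> x)^2 * D x) = X - \<kappa> * P4"
  proof -
    have "(LINT x|HP. (\<psi> x)^2 * D x) = (LINT x|HP. (\<psi> x)^2 * (U x)^2 - \<kappa> * \<psi> x ^ 4)"
      by (simp add: D_def right_diff_distrib power2_eq_square power4_eq_xxxx mult_ac)
    then show ?thesis using i22[OF _ _ \<psi>2 U2] Q\<psi>(2) by (simp add: X_def P4_def)
  qed
  have key: "0 \<le> X - U4 + t * (R / 2)" if t: "0 < t" "t * \<kappa> < 1" for t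
  proof -
    \<comment> \<open>\<open>sgn (sin x)\<close> selects the nonnegative root on
      \<open>(0, pi)\<close> and makes \<open>V\<close> odd and periodic.\<close>
    define V where "V x = sgn (sin x) * sqrt ((1 - t * \<kappa>) * (\<psi> x)^2 + t * (U x)^2)" for x
    define v1 where "v1 x = sqrt (1 - t * \<kappa>) * \<psi> x" for x
    define v2 where "v2 x = sqrt t * U x" for x
    have V2: "V x \<ge> 0 \<and> (V x)^2 = (1 - t * \<kappa>) * (\<psi> x)^2 + t * (U x)^2" if "x \<in> {0<..<pi}" for x
    proof -
      have "sgn (sin x) = 1" using sin_gt_zero[of x] that by simp
      then show ?thesis using t unfolding V_def by simp
    qed
    have Vb: "\<bar>V x\<bar> \<le> sqrt ((1 - t * \<kappa>) * a^2 + t * a^2)" for x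
    proof -
      have "\<bar>V x\<bar> \<le> sqrt ((1 - t * \<kappa>) * (\<psi> x)^2 + t * (U x)^2)"
        unfolding V_def using t by (auto simp: abs_mult sgn_if)
      also have "\<dots> \<le> sqrt ((1 - t * \<kappa>) * a^2 + t * a^2)"
        using \<psi>2[of x] U2[of x] t by (intro real_sqrt_le_mono add_mono mult_left_mono) auto
      finally show ?thesis .
    qed
    have Vm [measurable]: "V \<in> borel_measurable borel" unfolding V_def[abs_def] by measurable
    have sqV: "sq_int V" by (rule sq_int_bounded[OF Vm Vb])
    have c1: "sine_coeff v1 m = sqrt (1 - t * \<kappa>) * sine_coeff \<psi> m" "sine_coeff v2 m = sqrt t * sine_coeff U m" for m
      unfolding v1_def[abs_def] v2_def[abs_def] by (rule sine_coeff_cmult)+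
    have q1: "(\<lambda>m. lam m * (sine_coeff v1 m)^2) sums ((1 - t * \<kappa>) * (2 / pi * (\<omega> * A - P4)))"
      using sums_mult[OF Q\<psi>(1), of "1 - t * \<kappa>"] t unfolding c1 A_def P4_def
      by (simp add: power_mult_distrib mult_ac)
    have q2: "(\<lambda>m. lam m * (sine_coeff v2 m)^2) sums (t * (2 / pi * (\<omega> * B - U4)))"
      using sums_mult[OF QU(1), of t] t unfolding c1 B_def U4_def
      by (simp add: power_mult_distrib mult_ac)
    have sqv: "sq_int v1" "sq_int v2" unfolding v1_def[abs_def] v2_def[abs_def] by (intro sq_int_cmult sq)+
    have Vv: "0 \<le> V x \<and> (V x)^2 = (v1 x)^2 + (v2 x)^2" if "x \<in> {0<..<pi}" for x
      using V2[OF that] t unfolding v1_def v2_def by (simp add: power_mult_distrib)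
    note conv = quadratic_form_convex[OF sqv sqV Vv sums_summable[OF q1] sums_summable[OF q2]]
    have Q_le: "(\<Sum>m. lam m * (sine_coeff V m)^2) \<le> (1 - t * \<kappa>) * (2 / pi * (\<omega> * A - P4)) + t * (2 / pi * (\<omega> * B - U4))"
      using conv(2) sums_unique[OF q1] sums_unique[OF q2] by simp
    have mass: "(LINT x|HP. (V x)^2) = A"
    proof -
      have "(LINT x|HP. (V x)^2) = (LINT x|HP. (1 - t * \<kappa>) * (\<psi> x)^2 + t * (U x)^2)"
        by (rule integral_cong_AE) (use V2 in \<open>auto intro!: AE_HP_I'\<close>)
      also have "\<dots> = (1 - t * \<kappa>) * A + t * B"
        using sq_int_integrable_sq[OF sq(1)] sq_int_integrable_sq[OF sq(2)] by (simp add: A_def B_def)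
      also have "\<dots> = A" using \<kappa>A by (simp add: algebra_simps)
      finally show ?thesis .
    qed
    \<comment> \<open>\<open>V^2 = \<psi>^2 + t D\<close> makes the quartic term an exact quadratic
      polynomial in \<open>t\<close>.\<close>
    have V4: "(LINT x|HP. V x ^ 4) = P4 + 2 * t * (X - \<kappa> * P4) + t^2 * R"
    proof -
      have "(LINT x|HP. V x ^ 4) = (LINT x|HP. \<psi> x ^ 4 + 2 * t * ((\<psi> x)^2 * D x) + t^2 * (D x)^2)"
      proof (rule integral_cong_AE)
        show "AE x in HP. V x ^ 4 = \<psi> x ^ 4 + 2 * t * ((\<psi> x)^2 * D x) + t^2 * (D x)^2"
        proof (rule AE_HP_I')
          fix x :: real assume x: "x \<in> {0<..<pi}"
          have "V x ^ 4 = ((V x)^2)^2" by simp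
          also have "(V x)^2 = (\<psi> x)^2 + t * D x" using V2[OF x] by (simp add: D_def algebra_simps)
          also have "((\<psi> x)^2 + t * D x)^2 = \<psi> x ^ 4 + 2 * t * ((\<psi> x)^2 * D x) + t^2 * (D x)^2"
            by (simp add: power2_sum power_mult_distrib mult_ac)
          finally show "V x ^ 4 = \<psi> x ^ 4 + 2 * t * ((\<psi> x)^2 * D x) + t^2 * (D x)^2" .
        qed
      qed measurable
      also have "\<dots> = P4 + 2 * t * (X - \<kappa> * P4) + t^2 * R"
        using Q\<psi>(2) iD iDD by (simp add: P4_def \<psi>D R_def)
      finally show ?thesis .
    qed
    have "sine_energy \<psi> \<le> sine_energy V"
    proof (rule minimal[OF Vm])
      show "V (- x) = - V x" for x unfolding V_def \<psi>odd lobeD(2)[OF U] by (simp add: sgn_minus)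
      show "V (x + 2 * pi) = V x" for x unfolding V_def \<psi>per lobeD(3)[OF U] by simp
    qed (use Vb conv(1) mass in \<open>auto simp: A_def\<close>)
    moreover have "sine_energy \<psi> = (\<omega> * A - P4) + 1 / 2 * P4"
    proof -
      have cancel: "pi / 2 * (2 / pi * z) = z" for z :: real by simp
      show ?thesis unfolding sine_energy_def A_def P4_def sums_unique[OF Q\<psi>(1), symmetric] cancel ..
    qed
    moreover have "sine_energy V \<le> (1 - t * \<kappa>) * (\<omega> * A - P4) + t * (\<omega> * B - U4) + 1 / 2 * (P4 + 2 * t * (X - \<kappa> * P4) + t^2 * R)"
    proof -
      have cancel: "pi / 2 * (c * (2 / pi * y) + d * (2 / pi * z)) = c * y + d * z" for c d y z :: real
        by (simp add: field_simps)
      have "pi / 2 * (\<Sum>m. lam m * (sine_coeff V m)^2) \<le> (1 - t * \<kappa>) * (\<omega> * A - P4) + t * (\<omega> * B - U4)"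
        using mult_left_mono[OF Q_le, of "pi / 2"] unfolding cancel by simp
      then show ?thesis unfolding sine_energy_def V4 by linarith
    qed
    ultimately have "(\<omega> * A - P4) + 1 / 2 * P4 \<le>
      (1 - t * \<kappa>) * (\<omega> * A - P4) + t * (\<omega> * (\<kappa> * A) - U4) + 1 / 2 * (P4 + 2 * t * (X - \<kappa> * P4) + t^2 * R)"
      unfolding \<kappa>A by linarith
    \<comment> \<open>The mass terms cancel by \<open>\<kappa> A = B\<close>, and the multiples of
      \<open>P4\<close> cancel because the quadratic form of \<open>\<psi>\<close> is
      \<open>\<omega> A - P4\<close>; a factor \<open>t\<close> remains.\<close>
    then have "0 \<le> t * (X - U4 + t * (R / 2))" by (simp add: algebra_simps power2_eq_square)
    then show ?thesis using t by (simp add: zero_le_mult_iff)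
  qed
  have "0 \<le> X - U4"
  proof (rule field_le_epsilon)
    fix e :: real assume e: "e > 0"
    have R0: "R \<ge> 0" by (simp add: R_def)
    \<comment> \<open>The first entry makes \<open>t R / 2 \<le> e\<close>, the second keeps
      \<open>t \<kappa> < 1\<close>; the added \<open>1\<close> guards against \<open>R = 0\<close>
      and \<open>\<kappa> = 0\<close>.\<close>
    define t where "t = min (e / (R + 1)) (1 / (\<kappa> + 1) / 2)"
    have t: "0 < t" "t \<le> e / (R + 1)" "t \<le> 1 / (\<kappa> + 1) / 2" using e R0 \<kappa>0 by (auto simp: t_def)
    have "t * \<kappa> \<le> 1 / (\<kappa> + 1) / 2 * \<kappa>" using t \<kappa>0 by (intro mult_right_mono) auto
    also have "\<dots> < 1" using \<kappa>0 by (simp add: field_simps)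
    finally have "0 \<le> X - U4 + t * (R / 2)" using key t by blast
    moreover have "t * (R / 2) \<le> e / (R + 1) * (R / 2)" using t R0 by (intro mult_right_mono) auto
    moreover have "e / (R + 1) * (R / 2) \<le> e" using e R0 by (simp add: field_simps)
    ultimately show "0 \<le> X - U4 + e" by linarith
  qed
  then show ?thesis unfolding X_def U4_def by simp
qed

end

section \<open>Fourier coefficients and sine coefficients\<close>

lemma AE_lborel_translate:
  assumes "AE x in lborel. P x"
  shows "AE x in lborel. P (c + x :: real)"
proof -
  have "AE x in distr lborel borel ((+) c). P x" unfolding lborel_distr_plus by (rule assms)
  then show ?thesis by (rule AE_distrD[rotated]) simp
qed

lemma AE_lborel_minus:
  assumes "AE x in lborel. P x"
  shows "AE x in lborel. P (- x :: real)"
proof -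
  have "AE x in distr lborel borel uminus. P x" unfolding lborel_distr_uminus by (rule assms)
  then show ?thesis by (rule AE_distrD[rotated]) simp
qed

lemma AE_odd_periodic_eq:
  fixes f g :: "real \<Rightarrow> real"
  assumes eq: "AE x in HP. f x = g x"
    and odd: "AE x in lborel. f (- x) = - f x" "AE x in lborel. g (- x) = - g x"
    and per: "\<And>x. f (x + 2 * pi) = f x" "\<And>x. g (x + 2 * pi) = g x"
  shows "AE x in lborel. f x = g x"
proof -
  have "AE x in lborel. x \<in> {0..pi} \<longrightarrow> f x = g x" using eq by (simp add: AE_HP_iff)
  then have "AE x in lborel. x \<in> {-pi..pi} \<longrightarrow> f x = g x"
    using AE_lborel_minus[OF \<open>AE x in lborel. x \<in> {0..pi} \<longrightarrow> f x = g x\<close>] odd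
    by eventually_elim (case_tac "x \<ge> 0"; auto)
  from AE_lborel_translate[OF this]
  have "AE x in lborel. - 2 * pi * of_int n + x \<in> {-pi..pi} \<longrightarrow> f (- 2 * pi * of_int n + x) = g (- 2 * pi * of_int n + x)" for n :: int .
  then have "AE x in lborel. \<forall>n::int. - 2 * pi * of_int n + x \<in> {-pi..pi} \<longrightarrow> f (- 2 * pi * of_int n + x) = g (- 2 * pi * of_int n + x)"
    by (simp add: AE_all_countable)
  then show ?thesis
  proof eventually_elim
    case (elim x)
    define n where "n = \<lfloor>(x + pi) / (2 * pi)\<rfloor>"
    have n: "of_int n \<le> (x + pi) / (2 * pi)" "(x + pi) / (2 * pi) < of_int n + 1"
      unfolding n_def by linarith+
    then have "- 2 * pi * of_int n + x \<in> {-pi..pi}" by (simp add: field_simps)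
    then have "f (- 2 * pi * of_int n + x) = g (- 2 * pi * of_int n + x)" using elim by blast
    moreover have "f (- 2 * pi * of_int n + x) = f x" "g (- 2 * pi * of_int n + x) = g x"
      using periodic_int[where g = f, OF per(1), of x "- n"] periodic_int[where g = g, OF per(2), of x "- n"]
      by (simp_all add: add.commute)
    ultimately show ?case by simp
  qed
qed

lemma set_integrable_symmetric:
  fixes H :: "real \<Rightarrow> real"
  assumes Hm [measurable]: "H \<in> borel_measurable borel" and H: "integrable HP H" "integrable HP (\<lambda>x. H (- x))"
  shows "set_integrable lborel {-pi..pi} H"
proof -
  have p: "set_integrable lborel {0..pi} H" using H(1) by (simp add: integrable_HP_iff)
  have "set_integrable lborel {0..pi} (\<lambda>x. H (- x))" using H(2) by (subst (asm) integrable_HP_iff) auto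
  note n' = lborel_integrable_real_affine[OF this[unfolded set_integrable_def], of "-1" 0]
  have ind: "indicator {0..pi} (0 + - 1 * x) = (indicator {-pi..0} x :: real)" for x :: real
    by (auto simp: indicator_def)
  have n: "set_integrable lborel {-pi..0} H" using n' unfolding ind by (simp add: set_integrable_def)
  have "{-pi..pi} = {-pi..0} \<union> {0..pi}" using pi_gt_zero by (auto simp del: pi_gt_zero)
  then show ?thesis using set_integrable_Un[OF n p] by simp
qed

lemma integrable_AE_odd:
  fixes f :: "real \<Rightarrow> real"
  assumes fm [measurable]: "f \<in> borel_measurable borel" and odd: "AE x in lborel. f (- x) = - f x"
    and f: "integrable HP f"
  shows "set_integrable lborel {-pi..pi} f"
proof (rule set_integrable_symmetric[OF fm f])
  have "integrable HP (\<lambda>x. f (- x)) \<longleftrightarrow> integrable HP (\<lambda>x. - f x)"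
    using odd by (intro integrable_cong_AE) (auto simp: AE_HP_iff elim: eventually_mono)
  then show "integrable HP (\<lambda>x. f (- x))" using f by simp
qed

lemma fourier_coeff_fold:
  fixes f :: "real \<Rightarrow> real"
  assumes fm [measurable]: "f \<in> borel_measurable borel" and f: "set_integrable lborel {-pi..pi} f"
  shows "fourier_coeff f k = (complex_of_real (LINT x|HP. (f x + f (- x)) * cos (of_int k * x)) -
     \<i> * complex_of_real (LINT x|HP. (f x - f (- x)) * sin (of_int k * x))) / (2 * pi)"
proof -
  define H where "H x = complex_of_real (f x) * exp (- \<i> * of_int k * complex_of_real x)" for x
  have e: "exp (- \<i> * of_int k * complex_of_real x) = of_real (cos (of_int k * x)) - \<i> * of_real (sin (of_int k * x))" for x
  proof -
    have "exp (- \<i> * of_int k * complex_of_real x) = cis (- (of_int k * x))"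
      by (simp add: cis_conv_exp mult.assoc)
    then show ?thesis by (simp add: complex_eq_iff)
  qed
  have Hm [measurable]: "H \<in> borel_measurable borel" unfolding H_def[abs_def] by measurable
  have Hi: "set_integrable lborel {-pi..pi} H"
  proof (rule set_integrable_bound[OF f])
    show "set_borel_measurable lborel {-pi..pi} H" unfolding set_borel_measurable_def by measurable
    have "norm (exp (- \<i> * of_int k * complex_of_real x)) = 1" for x by simp
    then show "AE x in lborel. x \<in> {-pi..pi} \<longrightarrow> norm (H x) \<le> norm (f x)" unfolding H_def norm_mult by simp
  qed
  note fi = fold_integral(1,2)[OF fm f]
  have i1: "integrable HP (\<lambda>x. (f x + f (- x)) * cos (of_int k * x))"
    by (rule integrable_HP_bounded_mult[where B = 1]) (use fi in auto)
  have i2: "integrable HP (\<lambda>x. (f x - f (- x)) * sin (of_int k * x))"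
    by (rule integrable_HP_bounded_mult[where B = 1]) (use fi in auto)
  have "(LINT x:{-pi..pi}|lborel. H x) = (LINT x|HP. H x + H (- x))"
    by (rule fold_integral(3)[OF Hm Hi])
  also have "\<dots> = (LINT x|HP. complex_of_real ((f x + f (- x)) * cos (of_int k * x)) -
      \<i> * complex_of_real ((f x - f (- x)) * sin (of_int k * x)))"
  proof (intro Bochner_Integration.integral_cong refl)
    fix x
    have "H x = of_real (f x) * (of_real (cos (of_int k * x)) - \<i> * of_real (sin (of_int k * x)))"
      unfolding H_def e ..
    moreover have "H (- x) = of_real (f (- x)) * (of_real (cos (of_int k * x)) + \<i> * of_real (sin (of_int k * x)))"
      unfolding H_def e by simp
    ultimately show "H x + H (- x) = complex_of_real ((f x + f (- x)) * cos (of_int k * x)) -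
      \<i> * complex_of_real ((f x - f (- x)) * sin (of_int k * x))"
      by (simp add: algebra_simps)
  qed
  also have "\<dots> = complex_of_real (LINT x|HP. (f x + f (- x)) * cos (of_int k * x)) -
     \<i> * complex_of_real (LINT x|HP. (f x - f (- x)) * sin (of_int k * x))"
    using i1 i2 by (simp del: of_real_mult of_real_add of_real_diff)
  finally show ?thesis unfolding fourier_coeff_def H_def[symmetric] by simp
qed

lemma sine_coeff_abs: "(LINT x|HP. g x * sin (of_int k * x)) = pi / 2 * (sgn (of_int k) * sine_coeff g (nat \<bar>k\<bar>))"
proof (cases "k \<ge> 0")
  case True
  then show ?thesis by (cases "k = 0") (auto simp: sine_coeff_def)
next
  case False
  then have "sin (of_int k * x) = - sin (real (nat \<bar>k\<bar>) * x)" for x :: real by simp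
  then show ?thesis using False by (simp add: sine_coeff_def)
qed

lemma fourier_coeff_odd:
  fixes f :: "real \<Rightarrow> real"
  assumes fm [measurable]: "f \<in> borel_measurable borel" and f: "set_integrable lborel {-pi..pi} f"
    and odd: "AE x in lborel. f (- x) = - f x"
  shows "fourier_coeff f k = - \<i> / 2 * complex_of_real (sgn (of_int k) * sine_coeff f (nat \<bar>k\<bar>))"
proof -
  have odd': "AE x in HP. f (- x) = - f x" using odd by (auto simp: AE_HP_iff elim: eventually_mono)
  have "(LINT x|HP. (f x + f (- x)) * cos (of_int k * x)) = (LINT x|HP. 0)"
    by (rule integral_cong_AE) (use odd' in \<open>auto elim: eventually_mono\<close>)
  moreover have "(LINT x|HP. (f x - f (- x)) * sin (of_int k * x)) = (LINT x|HP. 2 * (f x * sin (of_int k * x)))"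
    by (rule integral_cong_AE) (use odd' in \<open>auto elim: eventually_mono\<close>)
  ultimately have "fourier_coeff f k = (complex_of_real (LINT x|HP. 0) -
     \<i> * complex_of_real (LINT x|HP. 2 * (f x * sin (of_int k * x)))) / (2 * pi)"
    unfolding fourier_coeff_fold[OF fm f] by (simp only:)
  also have "(LINT x|HP. 2 * (f x * sin (of_int k * x))) = pi * (sgn (of_int k) * sine_coeff f (nat \<bar>k\<bar>))"
    using sine_coeff_abs[of f k] by simp
  finally show ?thesis by simp
qed

text \<open>Odd and even parts are treated separately, by sine coefficients and by cosine moments.
  The even part matters because the representative picked by \<open>frac_laplacian\<close> is not
  known to be odd in advance.\<close>

lemma L1_fourier_zero:
  fixes G :: "real \<Rightarrow> real"
  assumes Gm [measurable]: "G \<in> borel_measurable borel" and G: "set_integrable lborel {-pi..pi} G"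
    and zero: "\<And>k. fourier_coeff G k = 0"
  shows "AE x in HP. G x = 0 \<and> G (- x) = 0"
proof -
  note Gi = fold_integral(1,2)[OF Gm G]
  have "(LINT x|HP. (G x + G (- x)) * cos (of_int k * x)) = 0 \<and> (LINT x|HP. (G x - G (- x)) * sin (of_int k * x)) = 0" for k :: int
    using zero[of k] unfolding fourier_coeff_fold[OF Gm G] by (simp add: complex_eq_iff)
  then have ev: "(LINT x|HP. (G x + G (- x)) * cos (of_int k * x)) = 0"
    and od: "(LINT x|HP. (G x - G (- x)) * sin (of_int k * x)) = 0" for k :: int by auto
  have ie: "integrable HP (\<lambda>x. G x + G (- x))" and io: "integrable HP (\<lambda>x. G x - G (- x))"
    using Gi by auto
  have "AE x in HP. G x - G (- x) = 0"
    by (rule sine_coeff_zero_imp_AE_zero[OF io]) (use od[of "int _"] in \<open>simp add: sine_coeff_def\<close>)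
  moreover have "AE x in HP. G x + G (- x) = 0"
  proof (rule cos_moments_zero_imp_AE_zero[OF ie])
    have int: "integrable HP (\<lambda>x. (G x + G (- x)) * (cos (of_int k * x) * cos x ^ j))" for k :: int and j
      by (rule integrable_HP_bounded_mult[OF ie, of _ 1])
        (auto simp: abs_mult power_abs intro!: mult_le_one power_le_one)
    have 0: "(LINT x|HP. (G x + G (- x)) * (cos (of_int k * x) * cos x ^ j)) = 0" for k :: int and j
    proof (induction j arbitrary: k)
      case (Suc j)
      have prod: "cos (of_int k * x) * cos x = (cos (of_int (k + 1) * x) + cos (of_int (k - 1) * x)) / 2" for x :: real
        by (simp add: distrib_right left_diff_distrib cos_add cos_diff)
      have eq: "(G x + G (- x)) * (cos (of_int k * x) * cos x ^ Suc j) =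
          ((G x + G (- x)) * (cos (of_int (k + 1) * x) * cos x ^ j) + (G x + G (- x)) * (cos (of_int (k - 1) * x) * cos x ^ j)) / 2" for x
      proof -
        have "(G x + G (- x)) * (cos (of_int k * x) * cos x ^ Suc j) = (G x + G (- x)) * cos x ^ j * (cos (of_int k * x) * cos x)"
          by simp
        then show ?thesis unfolding prod by (simp add: field_simps del: of_int_add of_int_diff)
      qed
      show ?case unfolding eq using int Suc.IH by (simp del: of_int_add of_int_diff)
    qed (use ev in simp)
    show "(LINT x|HP. (G x + G (- x)) * cos x ^ j) = 0" for j using 0[of 0 j] by simp
  qed
  ultimately show ?thesis by eventually_elim auto
qed

lemma has_sum_int_even:
  fixes h :: "nat \<Rightarrow> real"
  assumes h: "h sums S" and nn: "\<And>n. h n \<ge> 0" and h0: "h 0 = 0"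
  shows "((\<lambda>k::int. h (nat \<bar>k\<bar>)) has_sum (2 * S)) UNIV"
proof -
  have hs: "(h has_sum S) UNIV"
    using norm_summable_imp_has_sum[OF _ h] sums_summable[OF h] nn by simp
  have "((\<lambda>k::int. h (nat \<bar>k\<bar>)) has_sum S) (range int)"
    using hs by (subst has_sum_reindex) (auto simp: o_def)
  moreover have "range int = {0..}" by (auto intro: zero_le_imp_eq_int simp: image_iff)
  ultimately have p: "((\<lambda>k::int. h (nat \<bar>k\<bar>)) has_sum S) {0..}" by simp
  have "(h has_sum S) {0<..}"
    using hs by (subst (asm) has_sum_cong_neutral[of "{0<..}" UNIV h h]) (use h0 in auto)
  then have "((\<lambda>k::int. h (nat \<bar>k\<bar>)) has_sum S) ((\<lambda>n. - int n) ` {0<..})"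
    by (subst has_sum_reindex) (auto simp: o_def inj_on_def)
  moreover have "(\<lambda>n. - int n) ` {0<..} = {..<0}"
  proof (intro set_eqI iffI)
    fix k :: int assume "k \<in> {..<0}"
    then show "k \<in> (\<lambda>n. - int n) ` {0<..}" by (intro image_eqI[of _ _ "nat (- k)"]) auto
  qed auto
  ultimately have n: "((\<lambda>k::int. h (nat \<bar>k\<bar>)) has_sum S) {..<0}" by simp
  have "((\<lambda>k::int. h (nat \<bar>k\<bar>)) has_sum (S + S)) ({0..} \<union> {..<0})"
    by (rule has_sum_Un_disjoint[OF p n]) auto
  moreover have "({0..} \<union> {..<0} :: int set) = UNIV" by auto
  ultimately show ?thesis by simp
qed

lemma continuous_AE_zero:
  fixes f :: "real \<Rightarrow> real"
  assumes f: "continuous_on UNIV f" and ae: "AE x in HP. f x = 0" and x: "x \<in> {0<..<pi}"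
  shows "f x = 0"
proof (rule ccontr)
  assume "f x \<noteq> 0"
  define A where "A = {y \<in> {0<..<pi}. f y \<noteq> 0}"
  have "A = {0<..<pi} \<inter> f -` (- {0})" by (auto simp: A_def)
  moreover have "open (f -` (- {0}))" using f by (intro open_vimage) auto
  ultimately have op: "open A" by (simp add: open_Int)
  have "AE y in lborel. y \<notin> A" using ae unfolding AE_HP_iff A_def by eventually_elim auto
  then have "A \<in> null_sets lborel" using op by (subst AE_iff_null_sets) auto
  then have "negligible A" by (simp add: negligible_iff_null_sets null_sets_completionI)
  then show False using open_not_negligible[OF op] x \<open>f x \<noteq> 0\<close> by (auto simp: A_def)
qed

context fractional_exponent
begin

section \<open>Sobolev norm and energy in terms of sine coefficients\<close>

lemma powr_coeff_sq: "(real m powr s * c)^2 = lam m * c^2"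
  unfolding power_mult_distrib lam_def by (simp add: power2_eq_square flip: powr_add)

lemma Hs_norm_0_odd:
  assumes V: "sq_int V" and odd: "AE x in lborel. V (- x) = - V x"
  shows "(Hs_norm 0 V)^2 = 2 * (LINT x|HP. (V x)^2)"
proof -
  note Vm = sq_int_measurable[OF V]
  have si: "set_integrable lborel {-pi..pi} V" by (rule integrable_AE_odd[OF Vm odd sq_int_integrable[OF V]])
  have cm: "(cmod (fourier_coeff V k))^2 = (sine_coeff V (nat \<bar>k\<bar>))^2 / 4" for k
    unfolding fourier_coeff_odd[OF Vm si odd] by (cases "k = 0") (auto simp: norm_mult power_mult_distrib power_divide abs_mult)
  have sums: "(\<lambda>m. (sine_coeff V m)^2 / 4) sums ((2 / pi * (LINT x|HP. (V x)^2)) / 4)"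
    using sums_divide[OF parseval[OF V V], of 4] by (simp add: power2_eq_square)
  have trm: "(1 + (real_of_int k)^2) powr 0 * (cmod (fourier_coeff V k))^2 = (sine_coeff V (nat \<bar>k\<bar>))^2 / 4" for k
  proof -
    have "1 + (real_of_int k)^2 \<noteq> 0" by (smt (verit) zero_le_power2)
    then show ?thesis unfolding cm by simp
  qed
  have "(\<Sum>\<^sub>\<infinity>k::int. (1 + (real_of_int k)^2) powr 0 * (cmod (fourier_coeff V k))^2) = 2 * ((2 / pi * (LINT x|HP. (V x)^2)) / 4)"
    unfolding trm using has_sum_int_even[OF sums] by (intro infsumI) auto
  then have "2 * pi * (\<Sum>\<^sub>\<infinity>k::int. (1 + (real_of_int k)^2) powr 0 * (cmod (fourier_coeff V k))^2) = 2 * (LINT x|HP. (V x)^2)"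
    by simp
  then show ?thesis unfolding Hs_norm_def by simp
qed

lemma in_Hs_per_odd:
  assumes Vm [measurable]: "V \<in> borel_measurable borel" and odd: "\<And>x. V (- x) = - V x"
    and per: "\<And>x. V (x + 2 * pi) = V x" and B: "\<And>x. \<bar>V x\<bar> \<le> B"
    and sm: "summable (\<lambda>m. lam m * (sine_coeff V m)^2)"
  shows "V \<in> Hs_per_odd s"
proof -
  have V: "sq_int V" by (rule sq_int_bounded[OF Vm B])
  have odd': "AE x in lborel. V (- x) = - V x" using odd by simp
  have si: "set_integrable lborel {-pi..pi} V" by (rule integrable_AE_odd[OF Vm odd' sq_int_integrable[OF V]])
  have cm: "(cmod (fourier_coeff V k))^2 = (sine_coeff V (nat \<bar>k\<bar>))^2 / 4" for k
    unfolding fourier_coeff_odd[OF Vm si odd'] by (cases "k = 0") (auto simp: norm_mult power_mult_distrib power_divide abs_mult)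
  have "V \<in> L2_per" unfolding L2_per_def periodic_def
    using per Vm set_integrable_symmetric[OF _ sq_int_integrable_sq[OF V]] sq_int_integrable_sq[OF V]
    by (simp add: odd)
  define h where "h m = (1 + (real m)^2) powr s * ((sine_coeff V m)^2 / 4)" for m
  have hs: "summable h"
  proof (rule summable_comparison_test'[OF sm, of 1])
    fix m :: nat assume m: "m \<ge> 1"
    have "1 + (real m)^2 \<le> 2 * (real m)^2" using m by (simp add: one_le_power)
    then have "(1 + (real m)^2) powr s \<le> (2 * (real m)^2) powr s"
      using s_gt by (intro powr_mono2) (auto simp: add_nonneg_nonneg)
    also have "\<dots> = 2 powr s * lam m"
      unfolding lam_def using m by (simp add: powr_mult powr_powr flip: powr_numeral)
    also have "\<dots> \<le> 2 * lam m"
      using powr_mono[of s 1 2] s_le by (intro mult_right_mono) auto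
    finally have "(1 + (real m)^2) powr s * ((sine_coeff V m)^2 / 4) \<le> 2 * lam m * ((sine_coeff V m)^2 / 4)"
      by (intro mult_right_mono) auto
    also have "\<dots> \<le> lam m * (sine_coeff V m)^2" by simp
    finally show "norm (h m) \<le> lam m * (sine_coeff V m)^2" unfolding h_def by simp
  qed
  have "h n \<ge> 0" "h 0 = 0" for n by (simp_all add: h_def)
  then have "(\<lambda>k::int. h (nat \<bar>k\<bar>)) summable_on UNIV"
    by (intro has_sum_imp_summable[OF has_sum_int_even[OF summable_sums[OF hs]]])
  moreover have "h (nat \<bar>k\<bar>) = (1 + (real_of_int k)^2) powr s * (cmod (fourier_coeff V k))^2" for k
    unfolding h_def cm by simp
  ultimately show ?thesis unfolding Hs_per_odd_def Hs_per_def using \<open>V \<in> L2_per\<close> odd' by simp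
qed

text \<open>\<open>frac_laplacian\<close> is an arbitrary choice, accessible only through
  uniqueness: the Riesz-Fischer function \<open>w\<close> with coefficients \<open>m^s\<close> times
  those of \<open>V\<close> is one candidate, and the chosen one agrees with it almost everywhere on
  \<open>[-pi, pi]\<close>.\<close>

lemma energy_odd:
  assumes Vm [measurable]: "V \<in> borel_measurable borel" and odd: "\<And>x. V (- x) = - V x"
    and per: "\<And>x. V (x + 2 * pi) = V x" and B: "\<And>x. \<bar>V x\<bar> \<le> B"
    and sm: "summable (\<lambda>m. lam m * (sine_coeff V m)^2)"
  shows "energy s V = sine_energy V" "frac_laplacian (s / 2) V \<in> L1_per"
proof -
  have V: "sq_int V" by (rule sq_int_bounded[OF Vm B])
  have odd': "AE x in lborel. V (- x) = - V x" using odd by simp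
  have si: "set_integrable lborel {-pi..pi} V" by (rule integrable_AE_odd[OF Vm odd' sq_int_integrable[OF V]])
  define c where "c m = real m powr s * sine_coeff V m" for m
  have c2: "(c m)^2 = lam m * (sine_coeff V m)^2" for m unfolding c_def by (rule powr_coeff_sq)
  obtain w where w: "sq_int w" "\<And>m. sine_coeff w m = c m" "(LINT x|HP. (w x)^2) = pi / 2 * (\<Sum>m. (c m)^2)"
    "\<And>x. w (- x) = - w x" "\<And>x. w (x + 2 * pi) = w x"
    using riesz_fischer[of c] sm unfolding c2 by (auto simp: c_def)
  note [measurable] = sq_int_measurable[OF w(1)]
  have wsi: "set_integrable lborel {-pi..pi} w"
    by (rule integrable_AE_odd[OF _ _ sq_int_integrable[OF w(1)]]) (auto simp: w(4))
  have lapw: "is_frac_laplacian (s / 2) V w"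
    unfolding is_frac_laplacian_def
  proof (intro conjI allI)
    show "V \<in> L1_per" "w \<in> L1_per" using per w(5) si wsi by (auto simp: L1_per_def periodic_def)
    fix \<xi>
    have "fourier_coeff w \<xi> = - \<i> / 2 * complex_of_real (sgn (of_int \<xi>) * c (nat \<bar>\<xi>\<bar>))"
      using fourier_coeff_odd[OF _ wsi, of \<xi>] by (simp add: w(4) w(2))
    then show "fourier_coeff w \<xi> = complex_of_real (\<bar>real_of_int \<xi>\<bar> powr (2 * (s / 2))) * fourier_coeff V \<xi>"
      unfolding fourier_coeff_odd[OF Vm si odd'] c_def by simp
  qed
  define W where "W = frac_laplacian (s / 2) V"
  have "is_frac_laplacian (s / 2) V W"
    unfolding W_def frac_laplacian_def by (rule someI[where P = "is_frac_laplacian (s / 2) V", OF lapw])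
  then have W: "W \<in> L1_per" "fourier_coeff W \<xi> = fourier_coeff w \<xi>" for \<xi>
    using lapw unfolding is_frac_laplacian_def by auto
  then show "frac_laplacian (s / 2) V \<in> L1_per" by (simp add: W_def)
  have Wm [measurable]: "W \<in> borel_measurable borel" and Wsi: "set_integrable lborel {-pi..pi} W"
    using W(1) by (auto simp: L1_per_def)
  have dm: "(\<lambda>x. W x - w x) \<in> borel_measurable borel" by measurable
  have dsi: "set_integrable lborel {-pi..pi} (\<lambda>x. W x - w x)" by (rule set_integral_diff(1)[OF Wsi wsi])
  have "fourier_coeff (\<lambda>x. W x - w x) k = 0" for k
  proof -
    note iW = fold_integral(1,2)[OF Wm Wsi] and iw = fold_integral(1,2)[OF sq_int_measurable[OF w(1)] wsi]
    have i: "integrable HP (\<lambda>x. (f x) * cos (of_int k * x))" "integrable HP (\<lambda>x. (f x) * sin (of_int k * x))"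
      if "integrable HP f" for f
      by (rule integrable_HP_bounded_mult[where B = 1]; use that in simp)+
    have "(LINT x|HP. (W x - w x + (W (- x) - w (- x))) * cos (of_int k * x)) =
        (LINT x|HP. (W x + W (- x)) * cos (of_int k * x)) - (LINT x|HP. (w x + w (- x)) * cos (of_int k * x))"
      using i(1)[of "\<lambda>x. W x + W (- x)"] i(1)[of "\<lambda>x. w x + w (- x)"] iW iw
      by (subst Bochner_Integration.integral_diff[symmetric]) (auto simp: algebra_simps)
    moreover have "(LINT x|HP. (W x - w x - (W (- x) - w (- x))) * sin (of_int k * x)) =
        (LINT x|HP. (W x - W (- x)) * sin (of_int k * x)) - (LINT x|HP. (w x - w (- x)) * sin (of_int k * x))"
      using i(2)[of "\<lambda>x. W x - W (- x)"] i(2)[of "\<lambda>x. w x - w (- x)"] iW iw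
      by (subst Bochner_Integration.integral_diff[symmetric]) (auto simp: algebra_simps)
    moreover note W(2)[of k]
    ultimately show ?thesis
      unfolding fourier_coeff_fold[OF Wm Wsi] fourier_coeff_fold[OF sq_int_measurable[OF w(1)] wsi]
        fourier_coeff_fold[OF dm dsi] by (simp add: complex_eq_iff)
  qed
  from L1_fourier_zero[OF dm dsi this]
  have ae: "AE x in lborel. x \<in> {0..pi} \<longrightarrow> W x = w x \<and> W (- x) = w (- x)"
    unfolding AE_HP_iff by eventually_elim auto
  have aeW: "AE x in lborel. x \<in> {-pi..pi} \<longrightarrow> W x = w x"
    using ae AE_lborel_minus[OF ae] by eventually_elim (case_tac "x \<ge> 0"; auto)
  define F where "F x = (w x)^2 + 1 / 2 * V x ^ 4" for x
  have Fm [measurable]: "F \<in> borel_measurable borel" unfolding F_def[abs_def] by measurable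
  have V4: "integrable HP (\<lambda>x. V x ^ 4)"
  proof (rule integrable_HP_bounded)
    show "\<bar>V x ^ 4\<bar> \<le> B ^ 4" for x using power_mono[OF B abs_ge_zero, of x 4] by (simp add: power_abs)
  qed measurable
  have Fi: "integrable HP F" unfolding F_def[abs_def] using V4 sq_int_integrable_sq[OF w(1)] by simp
  have Feven: "F (- x) = F x" for x unfolding F_def odd w(4) by simp
  have Fsi: "set_integrable lborel {-pi..pi} F" by (rule set_integrable_symmetric[OF Fm Fi]) (use Fi in \<open>simp add: Feven\<close>)
  have "(LINT x:{-pi..pi}|lborel. (W x)^2 + 1 / 2 * V x ^ 4) = (LINT x:{-pi..pi}|lborel. F x)"
    unfolding set_lebesgue_integral_def
    by (rule integral_cong_AE) (use aeW in \<open>auto simp: F_def indicator_def elim!: eventually_mono\<close>)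
  also have "\<dots> = (LINT x|HP. F x + F (- x))" by (rule fold_integral(3)[OF Fm Fsi])
  also have "\<dots> = 2 * (LINT x|HP. F x)" unfolding Feven using Fi by simp
  also have "(LINT x|HP. F x) = (LINT x|HP. (w x)^2) + 1 / 2 * (LINT x|HP. V x ^ 4)"
    unfolding F_def using V4 sq_int_integrable_sq[OF w(1)] by simp
  finally show "energy s V = sine_energy V" unfolding energy_def sine_energy_def W_def[symmetric] w(3) c2 by simp
qed

text \<open>Equal Fourier coefficients give the same predicate \<open>is_frac_laplacian\<close>, so
  the choice returns literally the same function for both arguments.\<close>

lemma energy_cong_AE:
  assumes V: "V \<in> L1_per" and U: "U \<in> L1_per" and ae: "AE x in lborel. V x = U x"
  shows "fourier_coeff V = fourier_coeff U"
    "frac_laplacian (s / 2) U \<in> L1_per \<Longrightarrow> energy s V = energy s U"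
proof -
  have [measurable]: "V \<in> borel_measurable borel" "U \<in> borel_measurable borel" using V U by (auto simp: L1_per_def)
  show fc: "fourier_coeff V = fourier_coeff U"
    unfolding fourier_coeff_def[abs_def] set_lebesgue_integral_def
    by (intro ext arg_cong2[where f = "(/)"] refl integral_cong_AE) (use ae in \<open>auto elim: eventually_mono\<close>)
  have fl: "frac_laplacian (s / 2) V = frac_laplacian (s / 2) U"
    unfolding frac_laplacian_def is_frac_laplacian_def fc using V U by simp
  define W where "W = frac_laplacian (s / 2) U"
  assume "frac_laplacian (s / 2) U \<in> L1_per"
  then have [measurable]: "W \<in> borel_measurable borel" by (simp add: W_def L1_per_def)
  show "energy s V = energy s U"
    unfolding energy_def fl W_def[symmetric] set_lebesgue_integral_def
    by (intro arg_cong2[where f = "(*)"] refl integral_cong_AE) (use ae in \<open>auto elim: eventually_mono\<close>)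
qed

end

section \<open>The minimizer\<close>

lemma L1_per_AE_odd:
  assumes "f \<in> borel_measurable borel" "periodic f" "AE x in lborel. f (- x) = - f x" "integrable HP f"
  shows "f \<in> L1_per"
  using assms integrable_AE_odd by (simp add: L1_per_def)

text \<open>The equation itself makes \<open>W\<close> odd almost everywhere, so the complex
  coefficient identity reduces to one for sine coefficients.\<close>

lemma (in fractional_exponent) solution_coeffs:
  assumes \<phi>: "\<phi> \<in> Hs_per_odd s" and sol: "solves s \<omega> \<phi>"
  obtains W where "sq_int \<phi>" "integrable HP W" "is_frac_laplacian s \<phi> W"
    "AE x in lborel. W x - \<omega> * \<phi> x + \<phi> x ^ 3 = 0"
    "\<And>m. sine_coeff W m = lam m * sine_coeff \<phi> m"
proof -
  obtain W where W: "is_frac_laplacian s \<phi> W" "AE x in lborel. W x - \<omega> * \<phi> x + \<phi> x ^ 3 = 0"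
    using sol by (auto simp: solves_def)
  have \<phi>odd: "AE x in lborel. \<phi> (- x) = - \<phi> x" using \<phi> by (simp add: Hs_per_odd_def)
  have \<phi>L1: "\<phi> \<in> L1_per" and WL1: "W \<in> L1_per" using W(1) by (auto simp: is_frac_laplacian_def)
  have \<phi>L2: "\<phi> \<in> L2_per" using \<phi> by (simp add: Hs_per_odd_def Hs_per_def)
  have [measurable]: "\<phi> \<in> borel_measurable borel" "W \<in> borel_measurable borel" using \<phi>L1 WL1 by (auto simp: L1_per_def)
  have \<phi>sq: "sq_int \<phi>" unfolding sq_int_def
    using fold_integral(1)[of "\<lambda>x. (\<phi> x)^2"] \<phi>L2 by (simp add: L2_per_def)
  have \<phi>si: "set_integrable lborel {-pi..pi} \<phi>" and Wsi: "set_integrable lborel {-pi..pi} W"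
    using \<phi>L1 WL1 by (auto simp: L1_per_def)
  have Wi: "integrable HP W" by (rule fold_integral(1)[OF _ Wsi]) measurable
  have Wodd: "AE x in lborel. W (- x) = - W x"
    using W(2) AE_lborel_minus[OF W(2)] \<phi>odd by eventually_elim simp
  have coeff: "sine_coeff W m = lam m * sine_coeff \<phi> m" for m
  proof (cases "m = 0")
    case False
    have "fourier_coeff W (int m) = complex_of_real (lam m) * fourier_coeff \<phi> (int m)"
      using W(1) by (simp add: is_frac_laplacian_def lam_def)
    then have "complex_of_real (sine_coeff W m) = complex_of_real (lam m * sine_coeff \<phi> m)"
      using False by (simp add: fourier_coeff_odd Wsi Wodd \<phi>si \<phi>odd)
    then show ?thesis by (simp only: of_real_eq_iff)
  qed simp
  show ?thesis by (rule that[OF \<phi>sq Wi W coeff])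
qed

lemma (in fractional_exponent) minimizer_structure:
  assumes pos: "\<tau> > 0" and min: "is_arg_min (energy s) (\<lambda>u. u \<in> constraint_set s \<tau>) \<phi>"
    and \<omega>: "\<omega> > 0" and sol: "solves s \<omega> \<phi>"
  shows "\<omega> > 1" "\<exists>\<psi>. (AE x in lborel. \<phi> x = \<psi> x) \<and>
                 continuous_on UNIV \<psi> \<and> periodic \<psi> \<and> (\<forall>x. \<psi> (- x) = - \<psi> x) \<and>
                 solves s \<omega> \<psi> \<and>
                 (two_lobe_profile \<psi> \<or> two_lobe_profile (\<lambda>x. - \<psi> x))"
proof -
  have \<phi>c: "\<phi> \<in> constraint_set s \<tau>" using min by (simp add: is_arg_min_def)
  then have \<phi>H: "\<phi> \<in> Hs_per_odd s" and \<phi>\<tau>: "(Hs_norm 0 \<phi>)^2 = \<tau>" by (auto simp: constraint_set_def)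
  obtain W where \<phi>sq: "sq_int \<phi>" and Wi: "integrable HP W" and lap: "is_frac_laplacian s \<phi> W"
    and Weq: "AE x in lborel. W x - \<omega> * \<phi> x + \<phi> x ^ 3 = 0"
    and Wcoeff: "\<And>m. sine_coeff W m = lam m * sine_coeff \<phi> m"
    using solution_coeffs[OF \<phi>H sol] by blast
  have \<phi>odd: "AE x in lborel. \<phi> (- x) = - \<phi> x" using \<phi>H by (simp add: Hs_per_odd_def)
  have \<phi>L1: "\<phi> \<in> L1_per" using lap by (simp add: is_frac_laplacian_def)
  then have \<phi>per: "\<phi> (x + 2 * pi) = \<phi> x" for x by (simp add: L1_per_def periodic_def)
  note [measurable] = sq_int_measurable[OF \<phi>sq]
  have Wm [measurable]: "W \<in> borel_measurable borel" using borel_measurable_integrable[OF Wi] by simp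
  have mass: "2 * (LINT x|HP. (\<phi> x)^2) = \<tau>" using Hs_norm_0_odd[OF \<phi>sq \<phi>odd] \<phi>\<tau> by simp
  have WHP: "AE x in HP. W x = \<omega> * \<phi> x - \<phi> x ^ 3"
    using Weq by (auto simp: AE_HP_iff elim: eventually_mono)
  have \<phi>b: "AE x in HP. \<bar>\<phi> x\<bar> \<le> sqrt \<omega>"
    by (rule weak_solution_bounded[OF \<phi>sq Wi \<omega> Wcoeff WHP])
  have \<phi>eq: "sine_coeff (\<lambda>x. \<omega> * \<phi> x - \<phi> x ^ 3) m = lam m * sine_coeff \<phi> m" for m
    using sine_coeff_cong_AE[OF WHP] Wcoeff by simp
  note Q\<phi> = solution_quadratic_form[OF _ \<phi>b \<phi>eq]

  have nz: "\<not> (AE x in HP. \<phi> x = 0)"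
  proof
    assume "AE x in HP. \<phi> x = 0"
    then have "(LINT x|HP. (\<phi> x)^2) = (LINT x|HP. 0)" by (intro integral_cong_AE) (auto elim: eventually_mono)
    then show False using mass pos by simp
  qed

  \<comment> \<open>The positive mass \<open>\<tau>\<close> excludes the zero solution, so
    \<open>\<omega> \<le> 1\<close> is contradictory.\<close>
  show "\<omega> > 1"
  proof (rule ccontr)
    assume "\<not> \<omega> > 1"
    have mass_sums: "(\<lambda>m. (sine_coeff \<phi> m)^2) sums (2 / pi * (LINT x|HP. (\<phi> x)^2))"
      using parseval[OF \<phi>sq \<phi>sq] by (simp add: power2_eq_square)
    have le: "(sine_coeff \<phi> m)^2 \<le> lam m * (sine_coeff \<phi> m)^2" for m
      using mult_right_mono[OF lam_ge_1[of m], of "(sine_coeff \<phi> m)^2"] by (cases "m = 0") auto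
    have "2 / pi * (LINT x|HP. (\<phi> x)^2) \<le> 2 / pi * (\<omega> * (LINT x|HP. (\<phi> x)^2) - (LINT x|HP. \<phi> x ^ 4))"
      by (rule sums_le[OF le mass_sums Q\<phi>(1)]) measurable
    then have "(LINT x|HP. (\<phi> x)^2) \<le> \<omega> * (LINT x|HP. (\<phi> x)^2) - (LINT x|HP. \<phi> x ^ 4)"
      by (rule mult_left_le_imp_le) simp
    moreover have "\<omega> * (LINT x|HP. (\<phi> x)^2) \<le> 1 * (LINT x|HP. (\<phi> x)^2)"
      using \<open>\<not> \<omega> > 1\<close> by (intro mult_right_mono) auto
    moreover have "0 \<le> (LINT x|HP. \<phi> x ^ 4)" by simp
    ultimately have "(LINT x|HP. \<phi> x ^ 4) = 0" by linarith
    then have "AE x in HP. \<phi> x ^ 4 = 0" using Q\<phi>(2) by (subst (asm) integral_nonneg_eq_0_iff_AE) auto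
    then have "AE x in HP. \<phi> x = 0" by eventually_elim simp
    then show False using nz by simp
  qed

  have M: "2 * \<omega> > 0" using \<omega> by simp
  obtain U where U: "lobe (sqrt \<omega>) U" and Uc: "continuous_on UNIV U"
    and Ufix: "U = resolvent (2 * \<omega>) (\<lambda>y. nonlin \<omega> (U y))"
    and Umax: "\<And>\<phi>. \<phi> \<in> borel_measurable borel \<Longrightarrow> AE x in HP. \<bar>\<phi> x\<bar> \<le> sqrt \<omega> \<Longrightarrow>
       (\<And>m. sine_coeff \<phi> m = sine_coeff (\<lambda>x. nonlin \<omega> (\<phi> x)) m / (lam m + 2 * \<omega>)) \<Longrightarrow>
       AE x in HP. \<bar>\<phi> x\<bar> \<le> U x"
    by (rule maximal_solution[OF \<omega>]) blast
  have Um [measurable]: "U \<in> borel_measurable borel" by (rule lobeD(1)[OF U])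
  note nlU = nonlin_lobe[OF U \<omega>]
  have split: "sine_coeff (\<lambda>x. nonlin \<omega> (f x)) m = 2 * \<omega> * sine_coeff f m + sine_coeff (\<lambda>x. \<omega> * f x - f x ^ 3) m"
    if fm [measurable]: "f \<in> borel_measurable borel" and fb: "AE x in HP. \<bar>f x\<bar> \<le> sqrt \<omega>" for f m
  proof -
    have f: "sq_int f" by (rule sq_int_AE_bounded[OF fm fb])
    have f3: "sq_int (\<lambda>x. f x ^ 3)"
    proof (rule sq_int_AE_bounded)
      show "AE x in HP. \<bar>f x ^ 3\<bar> \<le> sqrt \<omega> ^ 3"
        using fb by eventually_elim (simp add: power_abs power_mono)
    qed measurable
    have "(\<lambda>x. nonlin \<omega> (f x)) = (\<lambda>x. 2 * \<omega> * f x + (\<omega> * f x - f x ^ 3))"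
      by (simp add: nonlin_def fun_eq_iff)
    then show ?thesis
      using sine_coeff_add[OF sq_int_integrable[OF sq_int_cmult[OF f, of "2 * \<omega>"]]
          sq_int_integrable[OF sq_int_diff[OF sq_int_cmult[OF f, of \<omega>] f3]], of m]
      by (simp add: sine_coeff_cmult)
  qed
  have lp: "lam m + 2 * \<omega> \<noteq> 0" for m using lam_M_pos[OF M, of m] by simp
  have \<phi>fix: "sine_coeff \<phi> m = sine_coeff (\<lambda>x. nonlin \<omega> (\<phi> x)) m / (lam m + 2 * \<omega>)" for m
    unfolding split[OF sq_int_measurable[OF \<phi>sq] \<phi>b] \<phi>eq using lp[of m] by (simp add: field_simps)
  have \<phi>U: "AE x in HP. \<bar>\<phi> x\<bar> \<le> U x" by (rule Umax[OF _ \<phi>b \<phi>fix]) measurable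
  have Ueq: "sine_coeff (\<lambda>x. \<omega> * U x - U x ^ 3) m = lam m * sine_coeff U m" for m
  proof -
    have "sine_coeff U m = sine_coeff (\<lambda>x. nonlin \<omega> (U x)) m / (lam m + 2 * \<omega>)"
      by (subst Ufix) (rule sine_coeff_resolvent[OF nlU(5) M])
    then show ?thesis using lp[of m] split[OF Um, of m] lobe_abs_le[OF U] by (simp add: field_simps)
  qed

  have n\<phi>: "sq_int (\<lambda>x. nonlin \<omega> (\<phi> x))"
  proof (rule sq_int_AE_bounded)
    show "AE x in HP. \<bar>nonlin \<omega> (\<phi> x)\<bar> \<le> 2 * \<omega> * sqrt \<omega>"
      using \<phi>b by eventually_elim (rule nonlin_bound, use \<omega> in auto)
  qed measurable
  \<comment> \<open>The fixed-point form of the equation supplies the continuous representative, for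
    which the comparison with \<open>U\<close> and the sign argument can be made pointwise.\<close>
  define \<psi> where "\<psi> = resolvent (2 * \<omega>) (\<lambda>x. nonlin \<omega> (\<phi> x))"
  have \<psi>c: "continuous_on UNIV \<psi>" unfolding \<psi>_def by (rule resolvent_continuous[OF n\<phi> M])
  have \<psi>odd: "\<psi> (- x) = - \<psi> x" for x unfolding \<psi>_def by (rule resolvent_odd[OF n\<phi> M])
  have \<psi>per: "\<psi> (x + 2 * pi) = \<psi> x" for x unfolding \<psi>_def by (rule resolvent_periodic)
  have \<psi>m [measurable]: "\<psi> \<in> borel_measurable borel" by (rule borel_measurable_continuous_onI[OF \<psi>c])
  have \<psi>sq: "sq_int \<psi>" unfolding \<psi>_def by (rule resolvent_sq_int[OF n\<phi> M])
  have \<phi>\<psi>: "AE x in HP. \<phi> x = \<psi> x"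
    by (rule sine_coeff_eq_imp_AE_eq[OF sq_int_integrable[OF \<phi>sq] sq_int_integrable[OF \<psi>sq]])
      (simp add: \<psi>_def sine_coeff_resolvent[OF n\<phi> M] \<phi>fix)
  have \<phi>\<psi>': "AE x in lborel. \<phi> x = \<psi> x"
    by (rule AE_odd_periodic_eq[OF \<phi>\<psi> \<phi>odd _ \<phi>per \<psi>per]) (simp add: \<psi>odd)
  \<comment> \<open>Domination holds at every point, as \<open>\<psi>\<close> and \<open>U\<close>
    are resolvents of functions ordered almost everywhere.\<close>
  have \<psi>U: "\<bar>\<psi> x\<bar> \<le> U x" if x: "x \<in> {0..pi}" for x
  proof -
    have le: "AE x in HP. nonlin \<omega> (\<phi> x) \<le> nonlin \<omega> (U x)" "AE x in HP. - 1 * nonlin \<omega> (\<phi> x) \<le> nonlin \<omega> (U x)"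
      using \<phi>U \<phi>b by (eventually_elim, use lobe_abs_le[OF U] in \<open>auto intro!: nonlin_mono simp: nonlin_minus[symmetric]\<close>)+
    have "\<psi> x \<le> resolvent (2 * \<omega>) (\<lambda>y. nonlin \<omega> (U y)) x"
      unfolding \<psi>_def by (rule resolvent_mono[OF n\<phi> nlU(5) M le(1) x])
    moreover have "- \<psi> x \<le> resolvent (2 * \<omega>) (\<lambda>y. nonlin \<omega> (U y)) x"
      using resolvent_mono[OF sq_int_cmult[OF n\<phi>, of "-1"] nlU(5) M le(2) x] resolvent_cmult[OF n\<phi> M, of "-1" x]
      unfolding \<psi>_def by simp
    ultimately show ?thesis unfolding Ufix[symmetric] by simp
  qed
  have \<psi>a: "\<bar>\<psi> x\<bar> \<le> sqrt \<omega>" for x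
    by (rule odd_periodic_bound[OF \<psi>odd \<psi>per]) (rule order_trans[OF \<psi>U lobeD(5)[OF U]])
  have \<psi>coeff: "sine_coeff \<psi> m = sine_coeff \<phi> m" for m
    by (rule sine_coeff_cong_AE[symmetric, OF \<phi>\<psi>]) measurable
  have \<psi>eq: "sine_coeff (\<lambda>x. \<omega> * \<psi> x - \<psi> x ^ 3) m = lam m * sine_coeff \<psi> m" for m
  proof -
    have "sine_coeff (\<lambda>x. \<omega> * \<psi> x - \<psi> x ^ 3) m = sine_coeff (\<lambda>x. \<omega> * \<phi> x - \<phi> x ^ 3) m"
      by (rule sine_coeff_cong_AE) (use \<phi>\<psi> in \<open>auto elim: eventually_mono\<close>)
    then show ?thesis using \<phi>eq \<psi>coeff by simp
  qed
  have \<psi>mass: "(LINT x|HP. (\<psi> x)^2) = (LINT x|HP. (\<phi> x)^2)"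
    by (rule integral_cong_AE) (use \<phi>\<psi> in \<open>auto elim: eventually_mono\<close>)
  have \<psi>L1: "\<psi> \<in> L1_per"
    by (rule L1_per_AE_odd[OF \<psi>m]) (use \<psi>per \<psi>odd sq_int_integrable[OF \<psi>sq] in \<open>auto simp: periodic_def\<close>)
  have \<psi>sm: "summable (\<lambda>m. lam m * (sine_coeff \<psi> m)^2)"
    unfolding \<psi>coeff using sums_summable[OF Q\<phi>(1)] by simp
  note E\<psi> = energy_odd[OF \<psi>m \<psi>odd \<psi>per \<psi>a \<psi>sm]
  have E\<phi>: "energy s \<phi> = sine_energy \<psi>"
    using energy_cong_AE(2)[OF \<phi>L1 \<psi>L1 \<phi>\<psi>' E\<psi>(2)] E\<psi>(1) by simp

  have "(LINT x|HP. U x ^ 4) \<le> (LINT x|HP. (\<psi> x)^2 * (U x)^2)"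
  proof (rule minimizer_dominates_maximal_solution[OF \<psi>c \<psi>odd \<psi>per \<psi>a \<psi>eq Uc U Ueq])
    show "(LINT x|HP. (\<psi> x)^2) > 0" unfolding \<psi>mass using mass pos by simp
    fix V :: "real \<Rightarrow> real"
    assume Vm: "V \<in> borel_measurable borel" and Vodd: "\<And>x. V (- x) = - V x" and Vper: "\<And>x. V (x + 2 * pi) = V x"
      and "\<exists>B. \<forall>x. \<bar>V x\<bar> \<le> B" and Vs: "summable (\<lambda>m. lam m * (sine_coeff V m)^2)"
      and Vmass: "(LINT x|HP. (V x)^2) = (LINT x|HP. (\<psi> x)^2)"
    then obtain B where B: "\<And>x. \<bar>V x\<bar> \<le> B" by blast
    have "(Hs_norm 0 V)^2 = \<tau>"
      using Hs_norm_0_odd[OF sq_int_bounded[OF Vm B]] Vodd Vmass \<psi>mass mass by simp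
    then have "V \<in> constraint_set s \<tau>"
      using in_Hs_per_odd[OF Vm Vodd Vper B Vs] by (simp add: constraint_set_def)
    then have "\<not> energy s V < energy s \<phi>" using min by (auto simp: is_arg_min_def)
    then show "sine_energy \<psi> \<le> sine_energy V" using E\<phi> energy_odd(1)[OF Vm Vodd Vper B Vs] by simp
  qed
  moreover have i: "integrable HP (\<lambda>x. U x ^ 4)" "integrable HP (\<lambda>x. (\<psi> x)^2 * (U x)^2)"
  proof -
    have "\<bar>U x ^ 4\<bar> \<le> sqrt \<omega> ^ 4" for x using power_mono[OF lobe_abs_le[OF U] abs_ge_zero, of x 4] by (simp add: power_abs)
    then show "integrable HP (\<lambda>x. U x ^ 4)" by (intro integrable_HP_bounded) auto
    have "\<bar>(\<psi> x)^2 * (U x)^2\<bar> \<le> (sqrt \<omega>)^2 * (sqrt \<omega>)^2" for x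
      using power_mono[OF lobe_abs_le[OF U] abs_ge_zero, of x 2] power_mono[OF \<psi>a abs_ge_zero, of x 2]
      unfolding abs_mult by (intro mult_mono) auto
    then show "integrable HP (\<lambda>x. (\<psi> x)^2 * (U x)^2)" by (intro integrable_HP_bounded) auto
  qed
  ultimately have int0: "(LINT x|HP. U x ^ 4 - (\<psi> x)^2 * (U x)^2) \<le> 0" by simp
  have nn: "AE x in HP. 0 \<le> U x ^ 4 - (\<psi> x)^2 * (U x)^2"
  proof (rule AE_HP_I)
    fix x :: real assume "x \<in> {0..pi}"
    from power_mono[OF \<psi>U[OF this] abs_ge_zero, of 2] have "(\<psi> x)^2 \<le> (U x)^2" by simp
    then have "(\<psi> x)^2 * (U x)^2 \<le> (U x)^2 * (U x)^2" by (rule mult_right_mono) simp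
    then show "0 \<le> U x ^ 4 - (\<psi> x)^2 * (U x)^2" by (simp add: power2_eq_square power4_eq_xxxx mult.assoc)
  qed
  have "(LINT x|HP. U x ^ 4 - (\<psi> x)^2 * (U x)^2) = 0" using int0 integral_nonneg_AE[OF nn] by simp
  then have ae0: "AE x in HP. U x ^ 4 - (\<psi> x)^2 * (U x)^2 = 0"
    using i nn by (subst (asm) integral_nonneg_eq_0_iff_AE) auto
  have zero: "U x ^ 4 - (\<psi> x)^2 * (U x)^2 = 0" if "x \<in> {0<..<pi}" for x
    by (rule continuous_AE_zero[OF _ ae0 that]) (intro continuous_intros Uc \<psi>c)
  have Unz: "\<not> (AE x in HP. U x = 0)"
  proof
    assume "AE x in HP. U x = 0"
    with \<phi>U have "AE x in HP. \<phi> x = 0" by eventually_elim simp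
    then show False using nz by simp
  qed
  note strict = lobe_strict[OF U Ufix \<omega> Unz]
  \<comment> \<open>\<open>c = 0\<close> in the strict reflection inequality reads
    \<open>U (- x) < U x\<close>.\<close>
  have Upos: "U x > 0" if "x \<in> {0<..<pi}" for x
    using strict[of 0 x] that by (simp add: lobeD(2)[OF U])
  have abs: "\<bar>\<psi> x\<bar> = U x" if x: "x \<in> {0<..<pi}" for x
  proof -
    have "(U x)^2 * ((U x)^2 - (\<psi> x)^2) = 0"
      using zero[OF x] by (simp add: algebra_simps power2_eq_square power4_eq_xxxx)
    then have "(\<psi> x)^2 = (U x)^2" using Upos[OF x] by simp
    then show ?thesis using Upos[OF x] by (simp add: power2_eq_iff) linarith
  qed
  \<comment> \<open>Odd periodic functions vanish at \<open>0\<close> and \<open>pi\<close>, so an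
    identity on the open interval extends to \<open>\<real>\<close>.\<close>
  have eqI: "\<psi> = (\<lambda>x. c * U x)" if c: "\<And>x. x \<in> {0<..<pi} \<Longrightarrow> \<psi> x = c * U x" for c :: real
  proof
    fix x
    have end0: "f 0 = 0 \<and> f pi = 0" if "\<And>x. f (- x) = - f x" "\<And>x. f (x + 2 * pi) = f x" for f :: "real \<Rightarrow> real"
      using that(1)[of 0] that(1)[of pi] that(2)[of "- pi"] by simp
    have "\<bar>\<psi> x - c * U x\<bar> \<le> 0"
    proof (rule odd_periodic_bound[where g = "\<lambda>x. \<psi> x - c * U x"])
      fix y assume "y \<in> {0..pi}"
      then have "y = 0 \<or> y = pi \<or> y \<in> {0<..<pi}" by auto
      then show "\<bar>\<psi> y - c * U y\<bar> \<le> 0"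
        using end0[OF \<psi>odd \<psi>per] end0[OF lobeD(2,3)[OF U]] c[of y] by auto
    qed (simp_all add: \<psi>odd \<psi>per lobeD(2,3)[OF U])
    then show "\<psi> x = c * U x" by simp
  qed
  \<comment> \<open>\<open>\<bar>\<psi>\<bar> = U > 0\<close> leaves \<open>\<psi>\<close> no zero
    in the open interval, so by connectedness it has one sign.\<close>
  have "(\<forall>x\<in>{0<..<pi}. \<psi> x > 0) \<or> (\<forall>x\<in>{0<..<pi}. \<psi> x < 0)"
  proof (rule ccontr)
    assume "\<not> ?thesis"
    then obtain x y where xy: "x \<in> {0<..<pi}" "y \<in> {0<..<pi}" "\<psi> x \<le> 0" "0 \<le> \<psi> y" by (auto simp: not_less)
    have "connected (\<psi> ` {0<..<pi})"
      by (intro connected_continuous_image continuous_on_subset[OF \<psi>c]) auto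
    from connectedD_interval[OF this, of "\<psi> x" "\<psi> y" 0] xy have "0 \<in> \<psi> ` {0<..<pi}" by auto
    then obtain z where "z \<in> {0<..<pi}" "\<psi> z = 0" by auto
    then show False using abs[of z] Upos[of z] by simp
  qed
  then have "\<psi> = (\<lambda>x. 1 * U x) \<or> \<psi> = (\<lambda>x. - 1 * U x)"
  proof
    assume "\<forall>x\<in>{0<..<pi}. \<psi> x > 0"
    then have "\<psi> x = 1 * U x" if "x \<in> {0<..<pi}" for x using abs[OF that] that by force
    from eqI[OF this] show ?thesis ..
  next
    assume "\<forall>x\<in>{0<..<pi}. \<psi> x < 0"
    then have "\<psi> x = - 1 * U x" if "x \<in> {0<..<pi}" for x using abs[OF that] that by force
    from eqI[OF this] show ?thesis ..
  qed
  then have lobes: "two_lobe_profile \<psi> \<or> two_lobe_profile (\<lambda>x. - \<psi> x)"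
    using two_lobe_profileI[OF U strict] by auto
  have "solves s \<omega> \<psi>" unfolding solves_def
  proof (intro exI[of _ W] conjI)
    show "is_frac_laplacian s \<psi> W"
      using lap \<psi>L1 unfolding is_frac_laplacian_def energy_cong_AE(1)[OF \<phi>L1 \<psi>L1 \<phi>\<psi>'] by simp
    show "AE x in lborel. W x - \<omega> * \<psi> x + \<psi> x ^ 3 = 0"
      using Weq \<phi>\<psi>' by eventually_elim simp
  qed
  then show "\<exists>\<psi>. (AE x in lborel. \<phi> x = \<psi> x) \<and>
                 continuous_on UNIV \<psi> \<and> periodic \<psi> \<and> (\<forall>x. \<psi> (- x) = - \<psi> x) \<and>
                 solves s \<omega> \<psi> \<and>
                 (two_lobe_profile \<psi> \<or> two_lobe_profile (\<lambda>x. - \<psi> x))"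
    using \<phi>\<psi>' \<psi>c \<psi>per \<psi>odd lobes by (intro exI[of _ \<psi>]) (simp add: periodic_def)
qed

theorem proposition3p3:
  fixes s \<tau> \<omega> :: real and \<phi> :: "real \<Rightarrow> real"
  assumes "1 / 4 < s" and "s \<le> 1"
    and "\<tau> > 0"
    and "is_arg_min (energy s) (\<lambda>u. u \<in> constraint_set s \<tau>) \<phi>"
    and "\<omega> > 0"
    and "solves s \<omega> \<phi>"
  shows "(\<omega> \<le> 1 \<longrightarrow> (AE x in lborel. \<phi> x = 0)) \<and>
         (\<omega> > 1 \<longrightarrow>
            (\<exists>\<psi>. (AE x in lborel. \<phi> x = \<psi> x) \<and>
                 continuous_on UNIV \<psi> \<and> periodic \<psi> \<and> (\<forall>x. \<psi> (- x) = - \<psi> x) \<and>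
                 solves s \<omega> \<psi> \<and>
                 (two_lobe_profile \<psi> \<or> two_lobe_profile (\<lambda>x. - \<psi> x))))"
proof -
  interpret fractional_exponent s using assms by unfold_locales
  \<comment> \<open>The premise \<open>\<omega> \<le> 1\<close> is refuted by the first conclusion,
    so the first implication holds vacuously.\<close>
  show ?thesis using minimizer_structure[OF assms(3-6)] by simp
qed

end
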